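(* Consider the $q$-state Potts model with Hamiltonian $H$ on the $K\times L$ grid $\Lambda$, with $\max\{K,L\}\ge 3$ and with periodic boundary conditions. For every $\mathbf r,\mathbf s\in\mathcal X^s$, $\mathbf s\ne\mathbf r$, the following sets are minimal restricted-gates for the transition $\mathbf r\to\mathbf s$: (a) $\overline{\mathscr P}(\mathbf r,\mathbf s)$ and $\widetilde{\mathscr P}(\mathbf r,\mathbf s)$; (b) $\overline{\mathcal Q}(\mathbf r,\mathbf s)$ and $\widetilde{\mathcal Q}(\mathbf r,\mathbf s)$; (c) $\overline{\mathscr H}_i(\mathbf r,\mathbf s)$ and $\widetilde{\mathscr H}_i(\mathbf r,\mathbf s)$, for any $i=1,\dots,K-3$; (d) $\mathcal W_j^{(h)}(\mathbf r,\mathbf s)$, for any $j=2,\dots,L-3$ and any $h=1,\dots,K-1$.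
   Context: Model. Fix integers $q\ge 2$, $K<L$, $L\ge 3$. $\Lambda=(V,E)$ is the two-dimensional torus with $V=\{0,\dots,K-1\}\times\{0,\dots,L-1\}$ (vertex $(i,j)$ lies in row $i$ and column $j$; there are $K$ rows and $L$ columns) and $E$ the set of nearest-neighbour pairs with periodic boundary conditions. $S=\{1,\dots,q\}$, $\mathcal X=S^V$, $H(\sigma)=-\sum_{(v,w)\in E}1_{\{\sigma(v)=\sigma(w)\}}$. $Q(\sigma,\sigma')=1/(q|V|)$ if $\sigma,\sigma'$ differ at exactly one vertex, and $Q(\sigma,\sigma')=0$ if they differ at more than one vertex. For $s\in S$, bold $\mathbf s\in\mathcal X$ is the configuration constantly equal to $s$; $\mathcal X^s=\{\mathbf 1,\dots,\mathbf q\}$ is the set of global minima of $H$ (stable configurations). Paths and saddles. A path $\omega:\sigma\to\sigma'$ is a finite sequence $\omega_0=\sigma,\dots,\omega_n=\sigma'$ in $\mathcal X$ with $Q(\omega_i,\omega_{i+1})>0$ for $i=0,\dots,n-1$; $\Omega_{\sigma,\sigma'}$ is the set of such paths. $\Phi_\omega=\max_i H(\omega_i)$ and $\Phi(\sigma,\sigma')=\min_{\omega:\sigma\to\sigma'}\Phi_\omega$. $\Omega^{opt}_{\sigma,\sigma'}=\{\omega\in\Omega_{\sigma,\sigma'}:\Phi_\omega=\Phi(\sigma,\sigma')\}$ is the set of optimal paths. $\mathcal S(\sigma,\sigma')$ (minimal saddles) is the set of $\xi\in\mathcal X$ such that there is $\omega\in\Omega^{opt}_{\sigma,\sigma'}$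 with $\xi\in\omega$ and $H(\xi)=\max_{\eta\in\omega}H(\eta)$. Restricted-gates. Let $\sigma\ne\sigma'$ in $\mathcal X^s$. For $\eta\in\mathcal X^s\setminus\{\sigma,\sigma'\}$ let $\mathcal C^\eta$ be the valley of the energy landscape whose bottom is the stable state $\eta$ and whose depth is $\Phi(\sigma,\sigma')$, i.e. $\mathcal C^\eta=\{\xi\in\mathcal X:\Phi(\eta,\xi)<\Phi(\sigma,\sigma')\}$. A restricted-path between $\sigma$ and $\sigma'$ is an $\omega\in\Omega^{opt}_{\sigma,\sigma'}$ with $\omega\cap\mathcal C^\eta=\varnothing$ for every $\eta\in\mathcal X^s\setminus\{\sigma,\sigma'\}$. A restricted-gate for the transition from $\sigma$ to $\sigma'$ is a subset of $\mathcal S(\sigma,\sigma')$ intersected by every restricted-path between $\sigma$ and $\sigma'$. A restricted-gate $\mathcal W$ for the transition from $\sigma$ to $\sigma'$ is a minimal restricted-gate if for every proper subset $\mathcal W'\subset\mathcal W$ there exists an optimal path $\omega'\in\Omega^{opt}_{\sigma,\sigma'}$ such that $\omega'\cap\mathcal W'=\varnothing$. Sets of configurations. For distinct spins $r,s$: $\bar R_{a,b}(r,s)$ is the set of configurations in which all spins are $r$ except those, equal to $s$, in a rectangle $a\times b$ of $\Lambda$ ($a$ = horizontal length, i.e. number of columns; $b$ = vertical length, i.e. number of rows). $\bar B^h_{a,b}(r,s)$, $1\le h\le b-1$, is the set of configurations in which all spins are $r$ except those, equal to $s$, in a rectangle $a\times b$ together with a bar $1\times h$ (one column wide, $h$ consecutive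 rows) adjacent to one of the sides of length $b$. $\tilde R_{a,b}(r,s)$ and $\tilde B^h_{a,b}(r,s)$ are the same with the roles of $r$ and $s$ interchanged. Put $\overline{\mathscr P}(\mathbf r,\mathbf s)=\bar B^{K-1}_{1,K}(r,s)$ and $\widetilde{\mathscr P}(\mathbf r,\mathbf s)=\tilde B^{K-1}_{1,K}(r,s)$; $\overline{\mathcal Q}(\mathbf r,\mathbf s)=\bar R_{2,K-1}(r,s)\cup\bar B^{K-2}_{1,K}(r,s)$ and $\widetilde{\mathcal Q}(\mathbf r,\mathbf s)=\tilde R_{2,K-1}(r,s)\cup\tilde B^{K-2}_{1,K}(r,s)$; for $i=1,\dots,K-3$, $\overline{\mathscr H}_i(\mathbf r,\mathbf s)=\bar B^i_{1,K}(r,s)\cup\bigcup_{h=i+1}^{K-2}\bar B^h_{1,K-1}(r,s)$ and $\widetilde{\mathscr H}_i(\mathbf r,\mathbf s)=\tilde B^i_{1,K}(r,s)\cup\bigcup_{h=i+1}^{K-2}\tilde B^h_{1,K-1}(r,s)$; for $j=2,\dots,L-3$ and $h=1,\dots,K-1$, $\mathcal W_j^{(h)}(\mathbf r,\mathbf s)=\bar B^h_{j,K}(r,s)=\tilde B^{K-h}_{L-j-1,K}(r,s)$.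
   Formalization: Proved for K ≥ 3 (the bar of length K−2 in (b) is undefined for K = 2) and only when q = 2 or K is even: for q ≥ 3 and odd K the claim is false, as a restricted-path through a third spin avoids all the sets. *)

theory Defs
  imports Complex_Main "HOL-Library.FuncSet"
begin

section \<open>The Potts model on the \<open>K \<times> L\<close> torus\<close>

text \<open>A vertex \<open>(i, j)\<close> lies in row \<open>i < K\<close> and column \<open>j < L\<close>.\<close>

definition vertices :: "nat \<Rightarrow> nat \<Rightarrow> (nat \<times> nat) set" where
  "vertices K L = {0..<K} \<times> {0..<L}"

text \<open>
  Every nearest-neighbour pair is oriented, from a vertex to its successor in the column or in the
  row. For \<open>K, L \<ge> 3\<close> each unordered pair is thus represented exactly once
  (lemma \<open>edges_oriented\<close> below).
\<close>

definition edges :: "nat \<Rightarrow> nat \<Rightarrow> ((nat \<times> nat) \<times> (nat \<times> nat)) set" where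
  "edges K L =
     (\<lambda>(i, j). ((i, j), (Suc i mod K, j))) ` vertices K L \<union>
     (\<lambda>(i, j). ((i, j), (i, Suc j mod L))) ` vertices K L"

type_synonym config = "nat \<times> nat \<Rightarrow> nat"

definition configs :: "nat \<Rightarrow> nat \<Rightarrow> nat \<Rightarrow> config set" where
  "configs q K L = vertices K L \<rightarrow>\<^sub>E {1..q}"

definition hamiltonian :: "nat \<Rightarrow> nat \<Rightarrow> config \<Rightarrow> int" where
  "hamiltonian K L \<sigma> = - (\<Sum>(v, w)\<in>edges K L. of_bool (\<sigma> v = \<sigma> w))"

definition const_config :: "nat \<Rightarrow> nat \<Rightarrow> nat \<Rightarrow> config" where
  "const_config K L s = (\<lambda>v\<in>vertices K L. s)"

text \<open>The set of global minima of the Hamiltonian; see \<open>stable_configs_eq\<close> below.\<close>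

definition stable_configs :: "nat \<Rightarrow> nat \<Rightarrow> nat \<Rightarrow> config set" where
  "stable_configs q K L =
     {\<sigma> \<in> configs q K L. \<forall>\<eta>\<in>configs q K L. hamiltonian K L \<sigma> \<le> hamiltonian K L \<eta>}"

definition disagreements :: "nat \<Rightarrow> nat \<Rightarrow> config \<Rightarrow> config \<Rightarrow> (nat \<times> nat) set" where
  "disagreements K L \<sigma> \<sigma>' = {v \<in> vertices K L. \<sigma> v \<noteq> \<sigma>' v}"

definition connectivity_off_diag :: "nat \<Rightarrow> nat \<Rightarrow> nat \<Rightarrow> config \<Rightarrow> config \<Rightarrow> real" where
  "connectivity_off_diag q K L \<sigma> \<sigma>' =
     (if card (disagreements K L \<sigma> \<sigma>') = 1
      then 1 / (real q * real (card (vertices K L))) else 0)"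

text \<open>The diagonal is chosen so that every row of the connectivity matrix sums to one.\<close>

definition connectivity :: "nat \<Rightarrow> nat \<Rightarrow> nat \<Rightarrow> config \<Rightarrow> config \<Rightarrow> real" where
  "connectivity q K L \<sigma> \<sigma>' =
     (if \<sigma> = \<sigma>'
      then 1 - (\<Sum>\<eta>\<in>configs q K L - {\<sigma>}. connectivity_off_diag q K L \<sigma> \<eta>)
      else connectivity_off_diag q K L \<sigma> \<sigma>')"


section \<open>Paths, minimal saddles and restricted-gates\<close>

definition paths :: "nat \<Rightarrow> nat \<Rightarrow> nat \<Rightarrow> config \<Rightarrow> config \<Rightarrow> config list set" where
  "paths q K L \<sigma> \<sigma>' =
     {\<omega>. \<omega> \<noteq> [] \<and> set \<omega> \<subseteq> configs q K L \<and> hd \<omega> = \<sigma> \<and> last \<omega> = \<sigma>' \<and>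
         (\<forall>i. Suc i < length \<omega> \<longrightarrow> connectivity q K L (\<omega> ! i) (\<omega> ! Suc i) > 0)}"

definition path_height :: "nat \<Rightarrow> nat \<Rightarrow> config list \<Rightarrow> int" where
  "path_height K L \<omega> = Max (hamiltonian K L ` set \<omega>)"

definition comm_height :: "nat \<Rightarrow> nat \<Rightarrow> nat \<Rightarrow> config \<Rightarrow> config \<Rightarrow> int" where
  "comm_height q K L \<sigma> \<sigma>' = Min (path_height K L ` paths q K L \<sigma> \<sigma>')"

definition optimal_paths :: "nat \<Rightarrow> nat \<Rightarrow> nat \<Rightarrow> config \<Rightarrow> config \<Rightarrow> config list set" where
  "optimal_paths q K L \<sigma> \<sigma>' =
     {\<omega> \<in> paths q K L \<sigma> \<sigma>'. path_height K L \<omega> = comm_height q K L \<sigma> \<sigma>'}"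

definition minimal_saddles :: "nat \<Rightarrow> nat \<Rightarrow> nat \<Rightarrow> config \<Rightarrow> config \<Rightarrow> config set" where
  "minimal_saddles q K L \<sigma> \<sigma>' =
     {\<xi> \<in> configs q K L. \<exists>\<omega>\<in>optimal_paths q K L \<sigma> \<sigma>'.
        \<xi> \<in> set \<omega> \<and> hamiltonian K L \<xi> = Max (hamiltonian K L ` set \<omega>)}"

text \<open>\<open>valley q K L \<sigma> \<sigma>' \<eta>\<close> is the valley with bottom \<open>\<eta>\<close> for the transition from \<open>\<sigma>\<close> to \<open>\<sigma>'\<close>.\<close>

definition valley :: "nat \<Rightarrow> nat \<Rightarrow> nat \<Rightarrow> config \<Rightarrow> config \<Rightarrow> config \<Rightarrow> config set" where
  "valley q K L \<sigma> \<sigma>' \<eta> =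
     {\<xi> \<in> configs q K L. comm_height q K L \<eta> \<xi> < comm_height q K L \<sigma> \<sigma>'}"

definition restricted_paths :: "nat \<Rightarrow> nat \<Rightarrow> nat \<Rightarrow> config \<Rightarrow> config \<Rightarrow> config list set" where
  "restricted_paths q K L \<sigma> \<sigma>' =
     {\<omega> \<in> optimal_paths q K L \<sigma> \<sigma>'.
        \<forall>\<eta>\<in>stable_configs q K L - {\<sigma>, \<sigma>'}. set \<omega> \<inter> valley q K L \<sigma> \<sigma>' \<eta> = {}}"

definition restricted_gate ::
    "nat \<Rightarrow> nat \<Rightarrow> nat \<Rightarrow> config \<Rightarrow> config \<Rightarrow> config set \<Rightarrow> bool" where
  "restricted_gate q K L \<sigma> \<sigma>' \<W> \<longleftrightarrow>
     \<W> \<subseteq> minimal_saddles q K L \<sigma> \<sigma>' \<and>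
     (\<forall>\<omega>\<in>restricted_paths q K L \<sigma> \<sigma>'. set \<omega> \<inter> \<W> \<noteq> {})"

text \<open>
  In the minimality clause the avoiding path is only required to be optimal, not restricted.
\<close>

definition minimal_restricted_gate ::
    "nat \<Rightarrow> nat \<Rightarrow> nat \<Rightarrow> config \<Rightarrow> config \<Rightarrow> config set \<Rightarrow> bool" where
  "minimal_restricted_gate q K L \<sigma> \<sigma>' \<W> \<longleftrightarrow>
     restricted_gate q K L \<sigma> \<sigma>' \<W> \<and>
     (\<forall>\<W>'. \<W>' \<subset> \<W> \<longrightarrow> (\<exists>\<omega>\<in>optimal_paths q K L \<sigma> \<sigma>'. set \<omega> \<inter> \<W>' = {}))"


section \<open>Rectangles with bars\<close>

text \<open>
  The block of \<open>a\<close> columns and \<open>b\<close> rows whose first row is \<open>i\<close> and whose first column is \<open>j\<close>,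
  both taken modulo the size of the torus: the horizontal length comes first.
\<close>

definition block :: "nat \<Rightarrow> nat \<Rightarrow> nat \<Rightarrow> nat \<Rightarrow> nat \<Rightarrow> nat \<Rightarrow> (nat \<times> nat) set" where
  "block K L i j a b = {((i + y) mod K, (j + x) mod L) | x y. x < a \<and> y < b}"

definition droplet :: "nat \<Rightarrow> nat \<Rightarrow> nat \<Rightarrow> nat \<Rightarrow> (nat \<times> nat) set \<Rightarrow> config" where
  "droplet K L r s A = (\<lambda>v\<in>vertices K L. if v \<in> A then s else r)"

definition Rbar :: "nat \<Rightarrow> nat \<Rightarrow> nat \<Rightarrow> nat \<Rightarrow> nat \<Rightarrow> nat \<Rightarrow> config set" where
  "Rbar K L a b r s = {droplet K L r s (block K L i j a b) | i j. i < K \<and> j < L}"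

text \<open>
  The bar occupies the rows \<open>i + k, \<dots>, i + k + h - 1\<close> of the column just to the right
  (\<open>j + a\<close>) or just to the left (\<open>j + L - 1\<close>, that is \<open>j - 1\<close> modulo \<open>L\<close>) of the rectangle;
  \<open>k + h \<le> b\<close> says that it does not overhang the side it is attached to. When \<open>b = K\<close> the
  rectangle is a full vertical strip and the choice of \<open>i\<close> lets the bar start in any row.
\<close>

definition Bbar :: "nat \<Rightarrow> nat \<Rightarrow> nat \<Rightarrow> nat \<Rightarrow> nat \<Rightarrow> nat \<Rightarrow> nat \<Rightarrow> config set" where
  "Bbar K L h a b r s =
     {droplet K L r s (block K L i j a b \<union> block K L (i + k) c 1 h) | i j k c.
        i < K \<and> j < L \<and> k + h \<le> b \<and> (c = j + a \<or> c = j + L - 1)}"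

definition Rtilde :: "nat \<Rightarrow> nat \<Rightarrow> nat \<Rightarrow> nat \<Rightarrow> nat \<Rightarrow> nat \<Rightarrow> config set" where
  "Rtilde K L a b r s = Rbar K L a b s r"

definition Btilde :: "nat \<Rightarrow> nat \<Rightarrow> nat \<Rightarrow> nat \<Rightarrow> nat \<Rightarrow> nat \<Rightarrow> nat \<Rightarrow> config set" where
  "Btilde K L h a b r s = Bbar K L h a b s r"

definition Pbar :: "nat \<Rightarrow> nat \<Rightarrow> nat \<Rightarrow> nat \<Rightarrow> config set" where
  "Pbar K L r s = Bbar K L (K - 1) 1 K r s"

definition Ptilde :: "nat \<Rightarrow> nat \<Rightarrow> nat \<Rightarrow> nat \<Rightarrow> config set" where
  "Ptilde K L r s = Btilde K L (K - 1) 1 K r s"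

text \<open>\<open>Qbar\<close> and \<open>Qtilde\<close> presuppose \<open>K \<ge> 3\<close>: their bars have length \<open>K - 2\<close>, which must not be zero.\<close>

definition Qbar :: "nat \<Rightarrow> nat \<Rightarrow> nat \<Rightarrow> nat \<Rightarrow> config set" where
  "Qbar K L r s = Rbar K L 2 (K - 1) r s \<union> Bbar K L (K - 2) 1 K r s"

definition Qtilde :: "nat \<Rightarrow> nat \<Rightarrow> nat \<Rightarrow> nat \<Rightarrow> config set" where
  "Qtilde K L r s = Rtilde K L 2 (K - 1) r s \<union> Btilde K L (K - 2) 1 K r s"

definition Hbar :: "nat \<Rightarrow> nat \<Rightarrow> nat \<Rightarrow> nat \<Rightarrow> nat \<Rightarrow> config set" where
  "Hbar K L i r s = Bbar K L i 1 K r s \<union> (\<Union>h\<in>{i + 1..K - 2}. Bbar K L h 1 (K - 1) r s)"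

definition Htilde :: "nat \<Rightarrow> nat \<Rightarrow> nat \<Rightarrow> nat \<Rightarrow> nat \<Rightarrow> config set" where
  "Htilde K L i r s = Btilde K L i 1 K r s \<union> (\<Union>h\<in>{i + 1..K - 2}. Btilde K L h 1 (K - 1) r s)"

definition Wgate :: "nat \<Rightarrow> nat \<Rightarrow> nat \<Rightarrow> nat \<Rightarrow> nat \<Rightarrow> nat \<Rightarrow> config set" where
  "Wgate K L j h r s = Bbar K L h j K r s"


section \<open>Consistency of the encoding\<close>

lemma edges_oriented:
  assumes "3 \<le> K" "3 \<le> L" "(v, w) \<in> edges K L"
  shows "v \<noteq> w" "(w, v) \<notin> edges K L"
proof -
  have succ: "i \<noteq> Suc i mod n" "i \<noteq> Suc (Suc i mod n) mod n" if "3 \<le> n" "i < n" for i n :: nat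
    using that by (cases "Suc i = n"; cases "Suc (Suc i) = n"; simp)+
  show "v \<noteq> w"
    using assms(3)
    by (auto simp: edges_def vertices_def dest: succ[OF assms(1)] succ[OF assms(2)])
  show "(w, v) \<notin> edges K L"
    using assms(3)
    by (auto simp: edges_def vertices_def dest: succ[OF assms(1)] succ[OF assms(2)])
qed

lemma finite_vertices: "finite (vertices K L)"
  by (simp add: vertices_def)

lemma finite_edges: "finite (edges K L)"
  by (simp add: edges_def finite_vertices)

lemma const_config_in_configs:
  "s \<in> {1..q} \<Longrightarrow> const_config K L s \<in> configs q K L"
  by (auto simp: const_config_def configs_def)

lemma edges_subset:
  assumes "(v, w) \<in> edges K L"
  shows "v \<in> vertices K L" "w \<in> vertices K L"
  using assms by (auto simp: edges_def vertices_def)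

lemma hamiltonian_const: "hamiltonian K L (const_config K L s) = - int (card (edges K L))"
proof -
  have "(\<Sum>(v, w)\<in>edges K L. of_bool (const_config K L s v = const_config K L s w)) =
        (\<Sum>e\<in>edges K L. 1 :: int)"
    by (rule sum.cong) (auto simp: const_config_def dest: edges_subset)
  then show ?thesis by (simp add: hamiltonian_def)
qed

lemma hamiltonian_min_iff:
  "hamiltonian K L \<sigma> \<ge> - int (card (edges K L))"
  "hamiltonian K L \<sigma> = - int (card (edges K L)) \<longleftrightarrow> (\<forall>(v, w)\<in>edges K L. \<sigma> v = \<sigma> w)"
proof -
  let ?f = "\<lambda>(v, w). 1 - of_bool (\<sigma> v = \<sigma> w) :: int"
  have "hamiltonian K L \<sigma> + int (card (edges K L)) = sum ?f (edges K L)"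
    by (simp add: hamiltonian_def sum_subtractf case_prod_unfold)
  moreover have "sum ?f (edges K L) \<ge> 0"
    by (rule sum_nonneg) auto
  moreover have "sum ?f (edges K L) = 0 \<longleftrightarrow> (\<forall>e\<in>edges K L. ?f e = 0)"
    by (rule sum_nonneg_eq_0_iff) (auto simp: finite_edges)
  moreover have "(\<forall>e\<in>edges K L. ?f e = 0) \<longleftrightarrow> (\<forall>(v, w)\<in>edges K L. \<sigma> v = \<sigma> w)"
    by (auto simp: of_bool_def split: if_splits)
  ultimately show "hamiltonian K L \<sigma> \<ge> - int (card (edges K L))"
    "hamiltonian K L \<sigma> = - int (card (edges K L)) \<longleftrightarrow> (\<forall>(v, w)\<in>edges K L. \<sigma> v = \<sigma> w)"
    by linarith+
qed

lemma stable_configs_eq: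
  assumes "1 \<le> q" "1 \<le> K" "1 \<le> L"
  shows "stable_configs q K L = const_config K L ` {1..q}"
proof (intro equalityI subsetI)
  fix \<sigma> assume "\<sigma> \<in> const_config K L ` {1..q}"
  then show "\<sigma> \<in> stable_configs q K L"
    by (auto simp: stable_configs_def const_config_in_configs hamiltonian_const hamiltonian_min_iff(1))
next
  fix \<sigma> assume \<sigma>: "\<sigma> \<in> stable_configs q K L"
  have "hamiltonian K L \<sigma> \<le> hamiltonian K L (const_config K L 1)"
    using \<sigma> assms by (auto simp: stable_configs_def const_config_in_configs)
  then have "hamiltonian K L \<sigma> = - int (card (edges K L))"
    using hamiltonian_min_iff(1)[of K L \<sigma>] by (simp add: hamiltonian_const)
  then have E: "\<sigma> v = \<sigma> w" if "(v, w) \<in> edges K L" for v w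
    using that by (auto simp: hamiltonian_min_iff(2))
  have row: "\<sigma> (i, j) = \<sigma> (i, 0)" if "i < K" "j < L" for i j
    using that
  proof (induction j)
    case (Suc j)
    have "((i, j), (i, Suc j)) \<in> edges K L"
      unfolding edges_def vertices_def using Suc.prems
      by (intro UnI2 image_eqI[of _ _ "(i, j)"]) auto
    from E[OF this] Suc show ?case by simp
  qed simp
  have col: "\<sigma> (i, 0) = \<sigma> (0, 0)" if "i < K" for i
    using that
  proof (induction i)
    case (Suc i)
    have "((i, 0), (Suc i, 0)) \<in> edges K L"
      unfolding edges_def vertices_def using Suc.prems assms(3)
      by (intro UnI1 image_eqI[of _ _ "(i, 0)"]) auto
    from E[OF this] Suc show ?case by simp
  qed simp
  have \<sigma>X: "\<sigma> \<in> configs q K L" using \<sigma> by (simp add: stable_configs_def)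
  have "\<sigma> v = const_config K L (\<sigma> (0, 0)) v" for v
  proof (cases "v \<in> vertices K L")
    case True
    then obtain i j where "v = (i, j)" "i < K" "j < L" by (auto simp: vertices_def)
    then have "\<sigma> v = \<sigma> (0, 0)" using row[of i j] col[of i] by simp
    with True show ?thesis by (simp add: const_config_def)
  next
    case False
    then have "\<sigma> v = undefined"
      using \<sigma>X unfolding configs_def by (rule PiE_arb[rotated])
    with False show ?thesis by (simp add: const_config_def)
  qed
  then have "\<sigma> = const_config K L (\<sigma> (0, 0))" by (rule ext)
  moreover have "\<sigma> (0, 0) \<in> {1..q}"
    using \<sigma>X assms(2,3) PiE_mem[of \<sigma> "vertices K L" "\<lambda>_. {1..q}" "(0, 0)"]
    by (simp add: configs_def vertices_def)
  ultimately show "\<sigma> \<in> const_config K L ` {1..q}" by (rule image_eqI)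
qed


section \<open>Odd \<open>K\<close> with at least three spins\<close>

text \<open>
  The communication height between stable configurations lies \<open>2 K + 2\<close> above the ground energy. For
  odd \<open>K\<close> this is the energy of \<open>(K + 1) / 2\<close> isolated sites in a homogeneous background. If there is
  a third spin \<open>t\<close>, a path can grow \<open>t\<close> until two columns of \<open>r\<close> are left, break these up into
  isolated sites while staying exactly at the communication height, turn the sites into \<open>s\<close> at no
  cost and grow \<open>s\<close> again. It is optimal and never enters the valley of \<open>t\<close>, but meets no
  configuration made of \<open>r\<close> and \<open>s\<close> alone (both present). The smallest instance,
  \<open>q = 3\<close> on the \<open>3 \<times> 4\<close> torus, is worked out below (lemma \<open>gate_fails_3_3_4\<close>).
\<close>

abbreviation (input) "configs34 \<equiv> configs 3 3 4"
abbreviation (input) "energy34 \<equiv> hamiltonian 3 4"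
abbreviation (input) "height34 \<equiv> comm_height 3 3 4"

definition low_step :: "int \<Rightarrow> config \<Rightarrow> config \<Rightarrow> bool" where
  "low_step h \<sigma> \<sigma>' \<longleftrightarrow> \<sigma> \<in> configs34 \<and> \<sigma>' \<in> configs34 \<and> energy34 \<sigma> \<le> h \<and> energy34 \<sigma>' \<le> h \<and>
     card (disagreements 3 4 \<sigma> \<sigma>') = 1"

lemma disagreements_sym: "disagreements K L \<sigma> \<sigma>' = disagreements K L \<sigma>' \<sigma>"
  by (auto simp: disagreements_def)

lemma low_step_sym: "low_step h \<sigma> \<sigma>' \<Longrightarrow> low_step h \<sigma>' \<sigma>"
  by (simp add: low_step_def disagreements_sym[of _ _ \<sigma>'])

lemma connectivity_pos:
  assumes "card (disagreements 3 4 \<sigma> \<sigma>') = 1"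
  shows "connectivity 3 3 4 \<sigma> \<sigma>' > 0"
proof -
  have "\<sigma> \<noteq> \<sigma>'" using assms by (auto simp: disagreements_def)
  then show ?thesis
    using assms by (simp add: connectivity_def connectivity_off_diag_def vertices_def)
qed

lemma connectivity_step:
  assumes "connectivity 3 3 4 \<sigma> \<sigma>' > 0"
  shows "\<sigma> = \<sigma>' \<or> card (disagreements 3 4 \<sigma> \<sigma>') = 1"
  using assms by (auto simp: connectivity_def connectivity_off_diag_def split: if_splits)

lemma finite_heights: "finite (path_height 3 4 ` paths 3 3 4 \<sigma> \<tau>)"
proof (rule finite_subset)
  show "path_height 3 4 ` paths 3 3 4 \<sigma> \<tau> \<subseteq> energy34 ` configs34"
  proof
    fix h assume "h \<in> path_height 3 4 ` paths 3 3 4 \<sigma> \<tau>"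
    then obtain \<omega> where \<omega>: "\<omega> \<noteq> []" "set \<omega> \<subseteq> configs34" "h = Max (energy34 ` set \<omega>)"
      by (auto simp: paths_def path_height_def)
    then have "h \<in> energy34 ` set \<omega>" using Max_in[of "energy34 ` set \<omega>"] by simp
    then show "h \<in> energy34 ` configs34" using \<omega>(2) by blast
  qed
  show "finite (energy34 ` configs34)"
    by (simp add: configs_def finite_PiE finite_vertices)
qed

lemma Phi_le:
  assumes "\<omega> \<in> paths 3 3 4 \<sigma> \<tau>" "\<And>\<xi>. \<xi> \<in> set \<omega> \<Longrightarrow> energy34 \<xi> \<le> h"
  shows "height34 \<sigma> \<tau> \<le> h"
proof -
  have "height34 \<sigma> \<tau> \<le> path_height 3 4 \<omega>"
    unfolding comm_height_def using assms(1) by (intro Min_le finite_heights imageI)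
  also have "\<dots> \<le> h"
    unfolding path_height_def using assms by (subst Max_le_iff) (auto simp: paths_def)
  finally show ?thesis .
qed

lemma path_if_low:
  assumes "(low_step h)\<^sup>*\<^sup>* \<sigma> \<tau>" "\<sigma> \<in> configs34" "energy34 \<sigma> \<le> h"
  shows "\<exists>\<omega>\<in>paths 3 3 4 \<sigma> \<tau>. \<forall>\<xi>\<in>set \<omega>. energy34 \<xi> \<le> h"
  using assms
proof (induction rule: converse_rtranclp_induct)
  case base
  then show ?case by (intro bexI[of _ "[\<tau>]"]) (auto simp: paths_def)
next
  case (step \<sigma> \<rho>)
  then obtain \<omega> where \<omega>: "\<omega> \<in> paths 3 3 4 \<rho> \<tau>" "\<forall>\<xi>\<in>set \<omega>. energy34 \<xi> \<le> h"
    by (auto simp: low_step_def)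
  have "connectivity 3 3 4 \<sigma> \<rho> > 0"
    using step.hyps(1) by (simp add: low_step_def connectivity_pos)
  then have "\<sigma> # \<omega> \<in> paths 3 3 4 \<sigma> \<tau>"
    using \<omega>(1) step.prems by (auto simp: paths_def nth_Cons hd_conv_nth split: nat.split)
  then show ?case using \<omega>(2) step.prems by (intro bexI[of _ "\<sigma> # \<omega>"]) auto
qed

lemma low_if_path:
  assumes "\<omega> \<in> paths 3 3 4 \<sigma> \<tau>" "\<forall>\<xi>\<in>set \<omega>. energy34 \<xi> \<le> h"
  shows "(low_step h)\<^sup>*\<^sup>* \<sigma> \<tau>"
  using assms
proof (induction \<omega> arbitrary: \<sigma>)
  case Nil
  then show ?case by (simp add: paths_def)
next
  case (Cons \<xi> \<omega>)
  show ?case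
  proof (cases \<omega>)
    case Nil
    then show ?thesis using Cons.prems by (auto simp: paths_def)
  next
    case (Cons \<rho> \<omega>')
    have P: "\<sigma> = \<xi>" "\<sigma> \<in> configs34" "\<rho> \<in> configs34" "energy34 \<sigma> \<le> h" "energy34 \<rho> \<le> h"
      using Cons.prems Cons by (auto simp: paths_def)
    have C: "connectivity 3 3 4 ((\<xi> # \<omega>) ! i) ((\<xi> # \<omega>) ! Suc i) > 0" if "Suc i < length (\<xi> # \<omega>)" for i
      using Cons.prems(1) that unfolding paths_def by blast
    have "\<omega> \<in> paths 3 3 4 \<rho> \<tau>"
      using Cons.prems(1) Cons C[of "Suc i" for i] by (auto simp: paths_def)
    then have "(low_step h)\<^sup>*\<^sup>* \<rho> \<tau>" using Cons.IH Cons.prems(2) by simp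
    moreover have "\<sigma> = \<rho> \<or> low_step h \<sigma> \<rho>"
      using connectivity_step[of \<sigma> \<rho>] C[of 0] P Cons by (auto simp: low_step_def)
    ultimately show ?thesis by (auto intro: converse_rtranclp_into_rtranclp)
  qed
qed

lemma hamiltonian_nonpos: "energy34 \<sigma> \<le> 0"
  unfolding hamiltonian_def by (simp add: sum_nonneg case_prod_unfold)

lemma paths_nonempty:
  assumes "\<sigma> \<in> configs34" "\<tau> \<in> configs34"
  shows "paths 3 3 4 \<sigma> \<tau> \<noteq> {}"
proof -
  have "(low_step 0)\<^sup>*\<^sup>* \<sigma> \<tau>"
    using assms(1)
  proof (induction "card (disagreements 3 4 \<sigma> \<tau>)" arbitrary: \<sigma>)
    case 0
    have "finite (disagreements 3 4 \<sigma> \<tau>)" by (simp add: disagreements_def finite_vertices)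
    then have "disagreements 3 4 \<sigma> \<tau> = {}" using 0(1) by simp
    then have "\<sigma> v = \<tau> v" if "v \<in> vertices 3 4" for v
      using that unfolding disagreements_def by blast
    then have "\<sigma> = \<tau>" using 0(2) assms(2) unfolding configs_def by (intro PiE_ext) auto
    then show ?case by simp
  next
    case (Suc n)
    then obtain v where v: "v \<in> disagreements 3 4 \<sigma> \<tau>"
      by (metis card.empty equals0I nat.distinct(1))
    define \<rho> where "\<rho> = \<sigma>(v := \<tau> v)"
    have V: "v \<in> vertices 3 4" "\<sigma> v \<noteq> \<tau> v" using v by (auto simp: disagreements_def)
    have "\<rho> \<in> configs34"
      using Suc.prems assms(2) V unfolding \<rho>_def configs_def by (auto simp: PiE_iff extensional_def)
    moreover have "disagreements 3 4 \<sigma> \<rho> = {v}"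
      using V by (auto simp: disagreements_def \<rho>_def)
    moreover have "disagreements 3 4 \<rho> \<tau> = disagreements 3 4 \<sigma> \<tau> - {v}"
      using V by (auto simp: disagreements_def \<rho>_def)
    moreover have "card (disagreements 3 4 \<sigma> \<tau> - {v}) = n"
      using Suc.hyps(2) v by simp
    ultimately have "(low_step 0)\<^sup>*\<^sup>* \<rho> \<tau>" "low_step 0 \<sigma> \<rho>"
      using Suc.hyps(1)[of \<rho>] Suc.prems by (auto simp: low_step_def hamiltonian_nonpos)
    then show ?case by (meson converse_rtranclp_into_rtranclp)
  qed
  from path_if_low[OF this assms(1) hamiltonian_nonpos] show ?thesis by blast
qed

lemma low_if_Phi:
  assumes "\<sigma> \<in> configs34" "\<tau> \<in> configs34" "height34 \<sigma> \<tau> \<le> h"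
  shows "(low_step h)\<^sup>*\<^sup>* \<sigma> \<tau>" "energy34 \<tau> \<le> h"
proof -
  have "height34 \<sigma> \<tau> \<in> path_height 3 4 ` paths 3 3 4 \<sigma> \<tau>"
    unfolding comm_height_def using paths_nonempty[OF assms(1,2)]
    by (intro Min_in finite_heights) simp
  then obtain \<omega> where \<omega>: "\<omega> \<in> paths 3 3 4 \<sigma> \<tau>" "Max (energy34 ` set \<omega>) \<le> h"
    using assms(3) by (auto simp: path_height_def)
  then have le: "\<forall>\<xi>\<in>set \<omega>. energy34 \<xi> \<le> h" by (auto simp: paths_def)
  then show "(low_step h)\<^sup>*\<^sup>* \<sigma> \<tau>" using low_if_path \<omega>(1) by blast
  show "energy34 \<tau> \<le> h" using le \<omega>(1) by (auto simp: paths_def)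
qed

text \<open>Permuting the spins preserves the energy and the paths.\<close>

definition relabel :: "(nat \<Rightarrow> nat) \<Rightarrow> config \<Rightarrow> config" where
  "relabel p \<sigma> = (\<lambda>v\<in>vertices 3 4. p (\<sigma> v))"

lemma low_relabel:
  assumes p: "inj_on p {1..3}" "p ` {1..3} \<subseteq> {1..3}"
    and low: "(low_step h)\<^sup>*\<^sup>* \<sigma> \<tau>"
  shows "(low_step h)\<^sup>*\<^sup>* (relabel p \<sigma>) (relabel p \<tau>)"
  using low
proof (induction rule: rtranclp_induct)
  case (step \<rho> \<tau>)
  have mem: "\<xi> v \<in> {1..3}" if "\<xi> \<in> configs34" "v \<in> vertices 3 4" for \<xi> v
    using that unfolding configs_def by (rule PiE_mem)
  have E: "energy34 (relabel p \<xi>) = energy34 \<xi>" if "\<xi> \<in> configs34" for \<xi>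
  proof -
    have "(\<Sum>(v, w)\<in>edges 3 4. of_bool (relabel p \<xi> v = relabel p \<xi> w) :: int) =
          (\<Sum>(v, w)\<in>edges 3 4. of_bool (\<xi> v = \<xi> w))"
    proof (rule sum.cong)
      fix e assume "e \<in> edges 3 4"
      then obtain v w where e: "e = (v, w)" "v \<in> vertices 3 4" "w \<in> vertices 3 4"
        by (cases e) (auto dest: edges_subset)
      then have "p (\<xi> v) = p (\<xi> w) \<longleftrightarrow> \<xi> v = \<xi> w"
        using mem that by (intro inj_on_eq_iff[OF p(1)]) auto
      then show "(case e of (v, w) \<Rightarrow> of_bool (relabel p \<xi> v = relabel p \<xi> w)) =
            ((case e of (v, w) \<Rightarrow> of_bool (\<xi> v = \<xi> w)) :: int)"
        using e by (simp add: relabel_def)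
    qed simp
    then show ?thesis by (simp add: hamiltonian_def)
  qed
  have R: "relabel p \<xi> \<in> configs34" if "\<xi> \<in> configs34" for \<xi>
    unfolding configs_def relabel_def using mem[OF that] p(2)
    by (intro restrict_PiE_iff[THEN iffD2]) blast
  have L: "\<rho> \<in> configs34" "\<tau> \<in> configs34" "energy34 \<rho> \<le> h" "energy34 \<tau> \<le> h" "card (disagreements 3 4 \<rho> \<tau>) = 1"
    using step.hyps(2) by (auto simp: low_step_def)
  have "disagreements 3 4 (relabel p \<rho>) (relabel p \<tau>) = disagreements 3 4 \<rho> \<tau>"
    unfolding disagreements_def
    using inj_on_eq_iff[OF p(1) mem[OF L(1)] mem[OF L(2)]] by (auto simp: relabel_def)
  then have "low_step h (relabel p \<rho>) (relabel p \<tau>)"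
    using L by (simp add: low_step_def E R)
  with step.IH show ?case by simp
qed simp

text \<open>
  Configurations on the \<open>3 \<times> 4\<close> torus, listed row by row.
\<close>

definition cfg :: "nat list \<Rightarrow> config" where
  "cfg xs = (\<lambda>(i, j)\<in>vertices 3 4. xs ! (4 * i + j))"

lemma vertices_3_4:
  "vertices 3 4 = {(0,0), (0,1), (0,2), (0,3), (1,0), (1,1), (1,2), (1,3), (2,0), (2,1), (2,2), (2,3)}"
proof -
  have "{0..<3} = {0, 1, 2::nat}" "{0..<4} = {0, 1, 2, 3::nat}" by auto
  then show ?thesis by (simp add: vertices_def insert_Times_insert)
qed

lemma edges_3_4:
  "edges 3 4 =
    {((0,0),(1,0)), ((0,1),(1,1)), ((0,2),(1,2)), ((0,3),(1,3)),
     ((1,0),(2,0)), ((1,1),(2,1)), ((1,2),(2,2)), ((1,3),(2,3)),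
     ((2,0),(0,0)), ((2,1),(0,1)), ((2,2),(0,2)), ((2,3),(0,3)),
     ((0,0),(0,1)), ((0,1),(0,2)), ((0,2),(0,3)), ((0,3),(0,0)),
     ((1,0),(1,1)), ((1,1),(1,2)), ((1,2),(1,3)), ((1,3),(1,0)),
     ((2,0),(2,1)), ((2,1),(2,2)), ((2,2),(2,3)), ((2,3),(2,0))}"
  unfolding edges_def vertices_3_4 by code_simp

lemma cfg_apply: "i < 3 \<Longrightarrow> j < 4 \<Longrightarrow> cfg xs (i, j) = xs ! (4 * i + j)"
  by (simp add: cfg_def vertices_def)

lemma hamiltonian_cfg:
  "energy34 (cfg [a, b, c, d, e, f, g, h, i, j, k, l]) = - (
     of_bool (a = e) + of_bool (b = f) + of_bool (c = g) + of_bool (d = h) +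
     of_bool (e = i) + of_bool (f = j) + of_bool (g = k) + of_bool (h = l) +
     of_bool (i = a) + of_bool (j = b) + of_bool (k = c) + of_bool (l = d) +
     of_bool (a = b) + of_bool (b = c) + of_bool (c = d) + of_bool (d = a) +
     of_bool (e = f) + of_bool (f = g) + of_bool (g = h) + of_bool (h = e) +
     of_bool (i = j) + of_bool (j = k) + of_bool (k = l) + of_bool (l = i))"
  unfolding hamiltonian_def edges_3_4 by (simp add: cfg_apply del: One_nat_def)

definition list_energy :: "nat list \<Rightarrow> int" where
  "list_energy xs = - (\<Sum>n\<leftarrow>[0..<12].
     of_bool (xs ! n = xs ! ((n + 4) mod 12)) + of_bool (xs ! n = xs ! (4 * (n div 4) + Suc n mod 4)))"

lemma hamiltonian_list:
  assumes "length xs = 12"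
  shows "energy34 (cfg xs) = list_energy xs"
proof -
  obtain a b c d e f g h i j k l where "xs = [a, b, c, d, e, f, g, h, i, j, k, l]"
    using assms by (auto simp: numeral_eq_Suc length_Suc_conv)
  moreover have "[0..<12] = [0, 1, 2, 3, 4, 5, 6, 7, 8, 9, 10, 11]" by code_simp
  ultimately show ?thesis
    by (simp add: hamiltonian_cfg list_energy_def del: upt_rec_numeral)
qed

lemma cfg_in_configs:
  assumes "length xs = 12" "set xs \<subseteq> {1..3}"
  shows "cfg xs \<in> configs34"
  unfolding configs_def cfg_def
proof (intro restrict_PiE_iff[THEN iffD2] ballI)
  fix v assume "v \<in> vertices 3 4"
  then obtain i j where "v = (i, j)" "4 * i + j < 12" by (auto simp: vertices_def)
  then show "(case v of (i, j) \<Rightarrow> xs ! (4 * i + j)) \<in> {1..3}"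
    using assms by (metis case_prod_conv nth_mem subsetD)
qed

lemma cfg_update:
  assumes "length xs = 12" "n < 12" "xs ! n \<noteq> c"
  shows "disagreements 3 4 (cfg xs) (cfg (xs[n := c])) = {(n div 4, n mod 4)}"
proof -
  have "4 * i + j = n \<longleftrightarrow> i = n div 4 \<and> j = n mod 4" if "j < 4" for i j
    using that by auto
  then show ?thesis
    using assms unfolding disagreements_def cfg_def
    by (auto simp: vertices_def nth_list_update split: if_splits)
qed

fun flip_steps :: "nat list \<Rightarrow> (nat \<times> nat) list \<Rightarrow> nat list list" where
  "flip_steps xs [] = [xs]"
| "flip_steps xs ((n, c) # fs) = xs # flip_steps (xs[n := c]) fs"

fun valid_flips :: "nat list \<Rightarrow> (nat \<times> nat) list \<Rightarrow> bool" where
  "valid_flips xs [] \<longleftrightarrow> True"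
| "valid_flips xs ((n, c) # fs) \<longleftrightarrow>
     n < 12 \<and> xs ! n \<noteq> c \<and> c \<in> {1, 2, 3} \<and> valid_flips (xs[n := c]) fs"

lemma flip_steps_path:
  assumes "length xs = 12" "set xs \<subseteq> {1..3}" "valid_flips xs fs"
  shows "map cfg (flip_steps xs fs) \<in> paths 3 3 4 (cfg xs) (cfg (last (flip_steps xs fs)))"
  using assms
proof (induction xs fs rule: flip_steps.induct)
  case (1 xs)
  then show ?case by (simp add: paths_def cfg_in_configs)
next
  case (2 xs n c fs)
  let ?ys = "xs[n := c]"
  have "set ?ys \<subseteq> {1..3}" using 2(3,4) set_update_subset_insert[of xs n c] by auto
  then have IH: "map cfg (flip_steps ?ys fs) \<in> paths 3 3 4 (cfg ?ys) (cfg (last (flip_steps ?ys fs)))"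
    using 2 by simp
  moreover have "connectivity 3 3 4 (cfg xs) (cfg ?ys) > 0"
    using 2(2,4) by (intro connectivity_pos) (simp add: cfg_update)
  moreover have "flip_steps ?ys fs \<noteq> []" by (cases fs) auto
  ultimately show ?case
    using 2(2,3) by (auto simp: paths_def nth_Cons hd_conv_nth cfg_in_configs split: nat.split)
qed

abbreviation (input) "all1 \<equiv> cfg [1,1,1,1,1,1,1,1,1,1,1,1]"
abbreviation (input) "all2 \<equiv> cfg [2,2,2,2,2,2,2,2,2,2,2,2]"
abbreviation (input) "all3 \<equiv> cfg [3,3,3,3,3,3,3,3,3,3,3,3]"

lemma const_config_cfg:
  "const_config 3 4 1 = all1" "const_config 3 4 2 = all2" "const_config 3 4 3 = all3"
  by (auto simp: const_config_def cfg_def vertices_3_4 fun_eq_iff)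

lemma cfg_neighbour:
  assumes xs: "length xs = 12" and "\<sigma> \<in> configs34" "card (disagreements 3 4 \<sigma> (cfg xs)) = 1"
  shows "\<exists>n\<in>set [0..<12]. \<exists>c\<in>{1, 2, 3}. c \<noteq> xs ! n \<and> \<sigma> = cfg (xs[n := c])"
proof -
  obtain i j where v: "disagreements 3 4 \<sigma> (cfg xs) = {(i, j)}"
    using assms(3) by (metis card_1_singletonE surj_pair)
  let ?n = "4 * i + j"
  have ij: "i < 3" "j < 4" "\<sigma> (i, j) \<noteq> xs ! ?n"
  proof -
    have "(i, j) \<in> disagreements 3 4 \<sigma> (cfg xs)" using v by simp
    then show "i < 3" "j < 4" "\<sigma> (i, j) \<noteq> xs ! ?n"
      by (auto simp: disagreements_def vertices_def cfg_def)
  qed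
  have "\<sigma> (i, j) \<in> {1..3}"
    using assms(2) ij(1,2) PiE_mem[of \<sigma> "vertices 3 4" "\<lambda>_. {1..3}" "(i, j)"]
    by (simp add: configs_def vertices_def)
  moreover have "\<sigma> = cfg (xs[?n := \<sigma> (i, j)])"
  proof
    fix w
    show "\<sigma> w = cfg (xs[?n := \<sigma> (i, j)]) w"
    proof (cases "w \<in> vertices 3 4")
      case True
      then obtain k l where w: "w = (k, l)" "k < 3" "l < 4" by (auto simp: vertices_def)
      have eq: "4 * i + j = 4 * k + l \<longleftrightarrow> (i, j) = (k, l)"
      proof -
        have "(4 * i + j) div 4 = i" "(4 * i + j) mod 4 = j"
          "(4 * k + l) div 4 = k" "(4 * k + l) mod 4 = l"
          using ij(2) w(3) by auto
        then show ?thesis by (metis prod.inject)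
      qed
      show ?thesis
      proof (cases "w = (i, j)")
        case True
        then show ?thesis using ij xs by (simp add: cfg_apply)
      next
        case False
        then have "w \<notin> disagreements 3 4 \<sigma> (cfg xs)" using v by simp
        then have "\<sigma> w = cfg xs w" using True by (simp add: disagreements_def)
        then show ?thesis using False eq w by (auto simp: cfg_apply nth_list_update)
      qed
    next
      case False
      then have "\<sigma> w = undefined"
        using assms(2) unfolding configs_def by (rule PiE_arb[rotated])
      with False show ?thesis by (simp add: cfg_def)
    qed
  qed
  moreover have "?n < 12" using ij by simp
  ultimately show ?thesis
    using ij(3) by (intro bexI[of _ ?n] bexI[of _ "\<sigma> (i, j)"]) auto
qed

lemma strip_isolated:
  assumes "length xs = 12" "cfg xs \<noteq> all3"
    and "\<forall>n\<in>{0, 1, 2, 3, 4, 5, 6, 7, 8, 9, 10, 11}. \<forall>c\<in>{1, 2, 3}. c \<noteq> xs ! n \<longrightarrow> - 16 \<le> list_energy (xs[n := c])"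
  shows "\<not> (low_step (- 17))\<^sup>*\<^sup>* all3 (cfg xs)"
proof
  assume "(low_step (- 17))\<^sup>*\<^sup>* all3 (cfg xs)"
  then obtain \<sigma> where "low_step (- 17) \<sigma> (cfg xs)"
    using assms(2) by (metis rtranclp.cases)
  then have "\<sigma> \<in> configs34" "card (disagreements 3 4 \<sigma> (cfg xs)) = 1" "energy34 \<sigma> \<le> - 17"
    by (auto simp: low_step_def)
  moreover have "set [0..<12] = {0, 1, 2, 3, 4, 5, 6, 7, 8, 9, 10, 11}" by code_simp
  ultimately obtain n c where "n \<in> {0, 1, 2, 3, 4, 5, 6, 7, 8, 9, 10, 11}" "c \<in> {1, 2, 3}"
    "c \<noteq> xs ! n" "\<sigma> = cfg (xs[n := c])"
    using cfg_neighbour[OF assms(1)] by metis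
  with assms(1,3) have "- 16 \<le> energy34 \<sigma>" by (simp only: hamiltonian_list length_list_update) blast
  with \<open>energy34 \<sigma> \<le> - 17\<close> show False by simp
qed

text \<open>
  A path from \<open>r\<close> to \<open>s\<close> that grows a third spin \<open>t\<close> until two diagonal sites of spin \<open>r\<close> are left,
  turns them into \<open>s\<close> one at a time and shrinks \<open>t\<close> again. Between the two strips it stays at
  the communication height, hence outside the valley of \<open>t\<close>.
\<close>

definition detour :: "nat list list" where
  "detour = flip_steps [1,1,1,1,1,1,1,1,1,1,1,1]
     [(0, 3), (1, 3), (4, 3), (5, 3), (8, 3), (9, 3),
      (2, 3), (3, 3), (6, 3), (11, 3),
      (7, 2), (10, 2),
      (6, 2), (2, 2), (3, 2), (11, 2),
      (0, 2), (1, 2), (4, 2), (5, 2), (8, 2), (9, 2)]"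

lemma detour_path: "map cfg detour \<in> paths 3 3 4 all1 all2"
proof -
  have "map cfg detour \<in> paths 3 3 4 all1 (cfg (last detour))"
    unfolding detour_def by (rule flip_steps_path) simp_all
  moreover have "last detour = [2,2,2,2,2,2,2,2,2,2,2,2]"
    by (simp add: detour_def)
  ultimately show ?thesis by simp
qed

lemma detour_length: "\<forall>xs\<in>set detour. length xs = 12"
  by code_simp

lemma detour_low:
  "\<forall>xs\<in>set detour. energy34 (cfg xs) \<le> - 16"
proof -
  have "\<forall>xs\<in>set detour. list_energy xs \<le> - 16"
    by code_simp
  then show ?thesis by (simp add: hamiltonian_list detour_length)
qed

lemma detour_third:
  "\<forall>xs\<in>set detour. 3 \<in> set xs \<or> energy34 (cfg xs) \<noteq> - 16"
proof -
  have "\<forall>xs\<in>set detour. 3 \<in> set xs \<or> list_energy xs \<noteq> - 16"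
    by code_simp
  then show ?thesis by (simp add: hamiltonian_list detour_length)
qed

lemma detour_below:
  "\<forall>xs\<in>set detour. energy34 (cfg xs) \<le> - 17 \<longrightarrow> xs \<in> set
     [[1,1,1,1,1,1,1,1,1,1,1,1], [3,1,1,1,1,1,1,1,1,1,1,1], [3,3,1,1,1,1,1,1,1,1,1,1],
      [3,3,1,1,3,3,1,1,3,3,1,1], [3,3,2,2,3,3,2,2,3,3,2,2],
      [2,2,2,2,2,2,2,2,3,3,2,2], [2,2,2,2,2,2,2,2,2,3,2,2], [2,2,2,2,2,2,2,2,2,2,2,2]]"
proof -
  have "\<forall>xs\<in>set detour. list_energy xs \<le> - 17 \<longrightarrow> xs \<in> set
     [[1,1,1,1,1,1,1,1,1,1,1,1], [3,1,1,1,1,1,1,1,1,1,1,1], [3,3,1,1,1,1,1,1,1,1,1,1],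
      [3,3,1,1,3,3,1,1,3,3,1,1], [3,3,2,2,3,3,2,2,3,3,2,2],
      [2,2,2,2,2,2,2,2,3,3,2,2], [2,2,2,2,2,2,2,2,2,3,2,2], [2,2,2,2,2,2,2,2,2,2,2,2]]"
    by code_simp
  then show ?thesis by (simp add: hamiltonian_list detour_length)
qed

lemma detour_set: "\<forall>xs\<in>set detour. set xs \<subseteq> {1..3}"
  by code_simp

lemma low_step_update:
  assumes "length xs = 12" "set xs \<subseteq> {1..3}" "n < 12" "c \<in> {1..3}" "xs ! n \<noteq> c"
    "energy34 (cfg xs) \<le> h" "energy34 (cfg (xs[n := c])) \<le> h"
  shows "low_step h (cfg xs) (cfg (xs[n := c]))"
proof -
  have "set (xs[n := c]) \<subseteq> {1..3}"
    using assms(2,4) set_update_subset_insert[of xs n c] by blast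
  then show ?thesis
    using assms by (simp add: low_step_def cfg_update cfg_in_configs)
qed

lemma relabel_const: "relabel p (const_config 3 4 c) = const_config 3 4 (p c)"
  by (auto simp: relabel_def const_config_def)

lemma low_up: "r a b \<Longrightarrow> \<not> r\<^sup>*\<^sup>* c b \<Longrightarrow> \<not> r\<^sup>*\<^sup>* c a"
  by (meson rtranclp.rtrancl_into_rtrancl)

lemma gate_fails_3_3_4:
  "\<not> restricted_gate 3 3 4 (const_config 3 4 1) (const_config 3 4 2) (Pbar 3 4 1 2)"
proof
  assume "restricted_gate 3 3 4 (const_config 3 4 1) (const_config 3 4 2) (Pbar 3 4 1 2)"
  then have G: "restricted_gate 3 3 4 all1 all2 (Pbar 3 4 1 2)"
    by (simp only: const_config_cfg)
  have E: "energy34 \<xi> = height34 all1 all2" if "\<xi> \<in> Pbar 3 4 1 2" for \<xi>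
  proof -
    have "\<xi> \<in> minimal_saddles 3 3 4 all1 all2"
      using G that unfolding restricted_gate_def by blast
    then show ?thesis
      by (auto simp: minimal_saddles_def optimal_paths_def path_height_def)
  qed
  have "cfg [2,2,1,1, 2,2,1,1, 2,1,1,1] \<in> Pbar 3 4 1 2"
  proof -
    have block: "block K L i j a b =
        (\<lambda>(y, x). ((i + y) mod K, (j + x) mod L)) ` ({..<b} \<times> {..<a})" for K L i j a b
      by (auto simp: block_def)
    have "{..<1} = {0::nat}" "{..<2} = {0, 1::nat}" "{..<3} = {0, 1, 2::nat}" by auto
    then have 1: "block 3 4 0 0 1 3 = {(0,0), (1,0), (2,0)}"
      and 2: "block 3 4 0 1 1 2 = {(0,1), (1,1)}"
      unfolding block by (simp_all only:) simp_all
    have "cfg [2,2,1,1, 2,2,1,1, 2,1,1,1] v =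
        droplet 3 4 1 2 (block 3 4 0 0 1 3 \<union> block 3 4 (0 + 0) 1 1 2) v" for v
    proof (cases "v \<in> vertices 3 4")
      case True
      then show ?thesis
        unfolding add_0 1 2 droplet_def restrict_apply'[OF True]
        by (simp only: vertices_3_4) (elim insertE emptyE; simp add: cfg_apply)
    qed (simp add: cfg_def droplet_def)
    then have "cfg [2,2,1,1, 2,2,1,1, 2,1,1,1] =
        droplet 3 4 1 2 (block 3 4 0 0 1 3 \<union> block 3 4 (0 + 0) 1 1 2)" by (rule ext)
    then show ?thesis unfolding Pbar_def Bbar_def by (intro CollectI exI conjI) auto
  qed
  from E[OF this] have height: "height34 all1 all2 = - 16" by (simp add: hamiltonian_cfg)

  have no_low: "\<not> (low_step (- 17))\<^sup>*\<^sup>* all1 all2"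
  proof
    assume "(low_step (- 17))\<^sup>*\<^sup>* all1 all2"
    then obtain \<omega> where "\<omega> \<in> paths 3 3 4 all1 all2" "\<forall>\<xi>\<in>set \<omega>. energy34 \<xi> \<le> - 17"
      using path_if_low cfg_in_configs by (fastforce simp: hamiltonian_cfg)
    then show False using Phi_le[of \<omega> all1 all2 "- 17"] height by simp
  qed
  have no_tr: "\<not> (low_step (- 17))\<^sup>*\<^sup>* all3 all1"
  proof
    let ?p = "\<lambda>c::nat. if c = 3 then 1 else if c = 1 then 2 else 3"
    assume "(low_step (- 17))\<^sup>*\<^sup>* all3 all1"
    then have "(low_step (- 17))\<^sup>*\<^sup>* (relabel ?p all3) (relabel ?p all1)"
      by (intro low_relabel) (auto simp: inj_on_def)
    then show False
      using no_low unfolding const_config_cfg[symmetric] relabel_const by simp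
  qed
  have no_ts: "\<not> (low_step (- 17))\<^sup>*\<^sup>* all3 all2"
  proof
    let ?p = "\<lambda>c::nat. 4 - c"
    assume "(low_step (- 17))\<^sup>*\<^sup>* all3 all2"
    then have "(low_step (- 17))\<^sup>*\<^sup>* (relabel ?p all3) (relabel ?p all2)"
      by (intro low_relabel) (auto simp: inj_on_def)
    then show False
      using no_low unfolding const_config_cfg[symmetric] relabel_const by simp
  qed
  have r1: "\<not> (low_step (- 17))\<^sup>*\<^sup>* all3 (cfg [3,1,1,1,1,1,1,1,1,1,1,1])"
    using low_step_update[of "[3,1,1,1,1,1,1,1,1,1,1,1]" 0 1 "- 17"]
    by (intro low_up[OF _ no_tr]) (simp add: hamiltonian_cfg)
  have r2: "\<not> (low_step (- 17))\<^sup>*\<^sup>* all3 (cfg [3,3,1,1,1,1,1,1,1,1,1,1])"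
    using low_step_update[of "[3,3,1,1,1,1,1,1,1,1,1,1]" 1 1 "- 17"]
    by (intro low_up[OF _ r1]) (simp add: hamiltonian_cfg)
  have s1: "\<not> (low_step (- 17))\<^sup>*\<^sup>* all3 (cfg [2,2,2,2,2,2,2,2,2,3,2,2])"
    using low_step_update[of "[2,2,2,2,2,2,2,2,2,3,2,2]" 9 2 "- 17"]
    by (intro low_up[OF _ no_ts]) (simp add: hamiltonian_cfg)
  have s2: "\<not> (low_step (- 17))\<^sup>*\<^sup>* all3 (cfg [2,2,2,2,2,2,2,2,3,3,2,2])"
    using low_step_update[of "[2,2,2,2,2,2,2,2,3,3,2,2]" 8 2 "- 17"]
    by (intro low_up[OF _ s1]) (simp add: hamiltonian_cfg)
  have neq: "cfg xs \<noteq> all3" if "xs ! 2 \<noteq> 3" for xs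
  proof
    assume "cfg xs = all3"
    then have "cfg xs (0, 2) = all3 (0, 2)" by simp
    then show False using that by (simp add: cfg_apply numeral_2_eq_2)
  qed
  have t1: "\<not> (low_step (- 17))\<^sup>*\<^sup>* all3 (cfg [3,3,1,1,3,3,1,1,3,3,1,1])"
    by (rule strip_isolated[OF _ neq]) code_simp+
  have t2: "\<not> (low_step (- 17))\<^sup>*\<^sup>* all3 (cfg [3,3,2,2,3,3,2,2,3,3,2,2])"
    by (rule strip_isolated[OF _ neq]) code_simp+

  have avoid_t: "cfg xs \<notin> valley 3 3 4 all1 all2 all3" if xs: "xs \<in> set detour" for xs
  proof
    assume "cfg xs \<in> valley 3 3 4 all1 all2 all3"
    then have "height34 all3 (cfg xs) < height34 all1 all2" by (simp only: valley_def mem_Collect_eq)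
    then have "height34 all3 (cfg xs) \<le> - 17" unfolding height by simp
    moreover have "all3 \<in> configs34" by (rule cfg_in_configs) auto
    moreover have "cfg xs \<in> configs34"
      using xs detour_length detour_set by (intro cfg_in_configs) blast+
    ultimately have "(low_step (- 17))\<^sup>*\<^sup>* all3 (cfg xs)" "energy34 (cfg xs) \<le> - 17"
      using low_if_Phi by blast+
    moreover from this(2) xs detour_below
    have "\<not> (low_step (- 17))\<^sup>*\<^sup>* all3 (cfg xs)"
      using no_tr r1 r2 t1 t2 s2 s1 no_ts by auto
    ultimately show False by blast
  qed
  have stable: "stable_configs 3 3 4 = {all1, all2, all3}"
  proof -
    have "{1..3} = {1, 2, 3::nat}" by auto
    then show ?thesis
      using stable_configs_eq[of 3 3 4] unfolding const_config_cfg[symmetric] by simp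
  qed
  have "path_height 3 4 (map cfg detour) = height34 all1 all2"
  proof (rule antisym)
    show "path_height 3 4 (map cfg detour) \<le> height34 all1 all2"
      unfolding height path_height_def using detour_low detour_path
      by (subst Max_le_iff) (auto simp: paths_def)
    show "height34 all1 all2 \<le> path_height 3 4 (map cfg detour)"
      unfolding comm_height_def using detour_path by (intro Min_le finite_heights imageI)
  qed
  then have "map cfg detour \<in> restricted_paths 3 3 4 all1 all2"
    using detour_path avoid_t by (auto simp: restricted_paths_def optimal_paths_def stable)
  with G have "set (map cfg detour) \<inter> Pbar 3 4 1 2 \<noteq> {}"
    unfolding restricted_gate_def by blast
  then obtain xs where xs: "xs \<in> set detour" "cfg xs \<in> Pbar 3 4 1 2" by auto
  have "3 \<in> set xs" using E[OF xs(2)] height detour_third xs(1) by metis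
  then obtain n where n: "n < 12" "xs ! n = 3"
    using xs(1) detour_length by (auto simp: in_set_conv_nth)
  have "cfg xs (n div 4, n mod 4) = 3"
    using n by (subst cfg_apply) auto
  moreover have "cfg xs (n div 4, n mod 4) \<in> {1, 2}"
    using xs(2) n(1) by (auto simp: Pbar_def Bbar_def droplet_def vertices_def)
  ultimately show False by simp
qed

end

theory Submission
  imports Defs
begin

text \<open>
  Up to a constant the energy of a configuration is the number of its disagreeing bonds, and a row or
  column that is not constant contains at least two of them. In these terms the communication height
  between two stable configurations is \<open>2 K + 2\<close>. At this level a configuration with constant columns
  of two colours is very rigid: its rows use up \<open>2 K\<close> bonds, and what remains forces it to be a strip of
  columns with at most one bar at its side (\<open>strip_shape\<close>). The area of \<open>s\<close> then determines width
  and bar, and as it changes by at most one in each step, a path among such configurations passes through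
  every area. This is the reason for the gates \<open>P\<close> and \<open>W\<close>. In the other two kinds of gates, area alone
  does not suffice, because the strips may be entered at a larger area, when the first column of \<open>s\<close> is
  completed: the site that is added then faces the gap between the ends of the bar next to it
  (\<open>first_column\<close>). The droplets from which this is possible belong to the gate, except for the
  rectangles in the case of the gates \<open>H\<close>, but those can only be reached through the gate
  (\<open>rectangle_neighbour\<close>).

  It remains to see that a path cannot evade these configurations. With a third colour \<open>t\<close> it may
  run through strips of \<open>r\<close> and \<open>t\<close> to configurations whose only constant columns have colour \<open>t\<close>, and
  try to reach strips of \<open>t\<close> and \<open>s\<close> from there. A configuration of this kind below \<open>2 K + 2\<close>
  lies in the valley of \<open>t\<close> (\<open>low_if_only_colour\<close>), so a restricted path keeps exactly \<open>2 K + 2\<close>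
  disagreeing bonds all the time. This confines the other colours to two neighbouring columns and
  leaves so few flips that the perimeter of \<open>r\<close> keeps its value modulo 4 (\<open>trapped_step\<close>). For
  even \<open>K\<close> this value is 2, so \<open>r\<close> never disappears and the path can only return to strips of \<open>r\<close> and \<open>t\<close>.
  All this is put together in \<open>crossing\<close>.

  For minimality every droplet of a gate is grown from nothing and then further until it covers the
  torus, with a perimeter of at most \<open>2 K + 2\<close> and without meeting the gate elsewhere. The gates with
  tildes follow by reversing paths, which exchanges \<open>r\<close> and \<open>s\<close>.
\<close>

section \<open>Colourings of a cycle\<close>

definition changes :: "nat \<Rightarrow> (nat \<Rightarrow> 'a) \<Rightarrow> nat" where
  "changes n f = (\<Sum>i<n. of_bool (f i \<noteq> f (Suc i mod n)))"

definition pred_mod :: "nat \<Rightarrow> nat \<Rightarrow> nat" where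
  "pred_mod n i = (i + n - 1) mod n"

lemma pred_mod_less: "0 < n \<Longrightarrow> pred_mod n i < n"
  by (simp add: pred_mod_def)

lemma Suc_mod_less: "i < n \<Longrightarrow> Suc i mod n < n"
  by simp

lemma pred_mod_if: "i < n \<Longrightarrow> pred_mod n i = (if i = 0 then n - 1 else i - 1)"
proof -
  assume "i < n"
  have "(i + n - 1) mod n = i - 1" if "i \<noteq> 0"
  proof -
    have "i + n - 1 = (i - 1) + n" using that by linarith
    then have "(i + n - 1) mod n = (i - 1) mod n" by (simp only: mod_add_self2)
    with \<open>i < n\<close> show ?thesis by simp
  qed
  with \<open>i < n\<close> show ?thesis by (auto simp: pred_mod_def)
qed

lemma Suc_mod_if: "i < n \<Longrightarrow> Suc i mod n = (if Suc i = n then 0 else Suc i)"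
  by simp

lemma Suc_pred_mod: "i < n \<Longrightarrow> Suc (pred_mod n i) mod n = i"
  by (simp add: pred_mod_if)

lemma pred_Suc_mod: "i < n \<Longrightarrow> pred_mod n (Suc i mod n) = i"
  by (auto simp: pred_mod_if Suc_mod_if)

lemma Suc_mod_eq_iff: "i < n \<Longrightarrow> k < n \<Longrightarrow> Suc k mod n = i \<longleftrightarrow> k = pred_mod n i"
  using Suc_pred_mod pred_Suc_mod by metis

lemma pred_mod_eq_iff: "i < n \<Longrightarrow> k < n \<Longrightarrow> pred_mod n k = i \<longleftrightarrow> k = Suc i mod n"
  using Suc_pred_mod pred_Suc_mod by metis

lemma cyclic_neighbours_distinct:
  assumes "3 \<le> n" "i < n"
  shows "Suc i mod n \<noteq> i" "pred_mod n i \<noteq> i" "Suc i mod n \<noteq> pred_mod n i"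
  using assms by (auto simp: pred_mod_if Suc_mod_if)

lemma bij_Suc_mod: "bij_betw (\<lambda>i. Suc i mod n) {..<n} {..<n}"
  by (rule bij_betw_byWitness[where f' = "pred_mod n"])
    (auto simp: Suc_pred_mod pred_Suc_mod pred_mod_less)

lemma cyclic_induct:
  assumes "a < n" "P a" "\<And>i. i < n \<Longrightarrow> P i \<Longrightarrow> P (Suc i mod n)" "k < n"
  shows "P k"
proof -
  have *: "P ((a + x) mod n)" for x
  proof (induction x)
    case (Suc x)
    then show ?case using assms(3)[of "(a + x) mod n"] assms(1) by (simp add: mod_Suc_eq)
  qed (simp add: assms)
  have "(a + (n - a + k)) mod n = k" using assms by (simp add: add.assoc[symmetric])
  with *[of "n - a + k"] show ?thesis by simp
qed

lemma cyclic_induct_down: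
  assumes "a < n" "P a" "\<And>i. i < n \<Longrightarrow> P i \<Longrightarrow> P (pred_mod n i)" "k < n"
  shows "P k"
proof (rule ccontr)
  assume "\<not> P k"
  then have "\<not> P a"
    using assms(1,3,4) Suc_mod_less pred_Suc_mod
    by (intro cyclic_induct[of k n "\<lambda>i. \<not> P i" a]) metis+
  with assms(2) show False by simp
qed

lemma cyclic_exit:
  assumes "a < n" "P a" "b < n" "\<not> P b"
  obtains i where "i < n" "P i" "\<not> P (Suc i mod n)"
  using cyclic_induct[of a n P b] assms by blast

lemma obtain_outside:
  fixes C :: "nat set"
  assumes "finite C" "card C < n"
  obtains e where "e < n" "e \<notin> C"
proof -
  have "\<not> {..<n} \<subseteq> C" using card_mono[OF assms(1), of "{..<n}"] assms(2) by auto
  then show ?thesis using that by auto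
qed

lemma obtain_third:
  assumes "3 \<le> n"
  obtains e :: nat where "e < n" "e \<noteq> a" "e \<noteq> b"
proof -
  have "card {a, b} < n" using assms by (cases "a = b") simp_all
  then show ?thesis using obtain_outside[of "{a, b}" n] that by auto
qed

lemma changes_card: "changes n f = card {i. i < n \<and> f i \<noteq> f (Suc i mod n)}"
proof -
  have "changes n f = card ({..<n} \<inter> {i. f i \<noteq> f (Suc i mod n)})"
    unfolding changes_def by simp
  also have "{..<n} \<inter> {i. f i \<noteq> f (Suc i mod n)} = {i. i < n \<and> f i \<noteq> f (Suc i mod n)}" by auto
  finally show ?thesis .
qed

lemma changes_cong:
  assumes "\<And>i k. i < n \<Longrightarrow> k < n \<Longrightarrow> f i = f k \<longleftrightarrow> g i = g k"
  shows "changes n f = changes n g"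
  unfolding changes_def using assms by (intro sum.cong) auto

lemma changes_zero_iff: "changes n f = 0 \<longleftrightarrow> (\<forall>i<n. \<forall>k<n. f i = f k)"
proof
  assume "changes n f = 0"
  then have *: "f i = f (Suc i mod n)" if "i < n" for i
  proof -
    have "finite {i. i < n \<and> f i \<noteq> f (Suc i mod n)}" by simp
    then have "{i. i < n \<and> f i \<noteq> f (Suc i mod n)} = {}"
      using \<open>changes n f = 0\<close> unfolding changes_card by (metis card_0_eq)
    with that show ?thesis by blast
  qed
  show "\<forall>i<n. \<forall>k<n. f i = f k"
  proof (intro allI impI)
    fix i k assume "i < n" "k < n"
    show "f i = f k"
    proof (rule cyclic_induct[of i n "\<lambda>k. f i = f k" k])
      fix j assume "j < n" "f i = f j"
      with *[of j] show "f i = f (Suc j mod n)" by metis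
    qed (use \<open>i < n\<close> \<open>k < n\<close> in simp_all)
  qed
next
  assume "\<forall>i<n. \<forall>k<n. f i = f k"
  then have "{i. i < n \<and> f i \<noteq> f (Suc i mod n)} = {}" using Suc_mod_less by blast
  then show "changes n f = 0" unfolding changes_card by (simp only: card.empty)
qed

text \<open>
  Walking around the cycle, every colour that occurs is left somewhere, and at different places
  for different colours.
\<close>

lemma changes_ge_colours:
  assumes "a < n" "b < n" "f a \<noteq> f b"
  shows "card (f ` {..<n}) \<le> changes n f"
proof -
  have "\<exists>i. i < n \<and> f i = c \<and> f (Suc i mod n) \<noteq> c" if "c \<in> f ` {..<n}" for c
  proof -
    obtain i where i: "i < n" "f i = c" using \<open>c \<in> f ` {..<n}\<close> by auto
    obtain k where k: "k < n" "f k \<noteq> c" using assms by metis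
    show ?thesis
      using cyclic_exit[of i n "\<lambda>i. f i = c" k] i k by blast
  qed
  then obtain e where e: "\<And>c. c \<in> f ` {..<n} \<Longrightarrow> e c < n \<and> f (e c) = c \<and> f (Suc (e c) mod n) \<noteq> c"
    by metis
  have "inj_on e (f ` {..<n})" using e by (metis inj_onI)
  moreover have "e ` (f ` {..<n}) \<subseteq> {i. i < n \<and> f i \<noteq> f (Suc i mod n)}"
    using e by force
  ultimately show ?thesis
    unfolding changes_card by (intro card_inj_on_le[of e]) auto
qed

lemma changes_ge_2:
  assumes "a < n" "b < n" "f a \<noteq> f b"
  shows "2 \<le> changes n f"
proof -
  have "card {f a, f b} \<le> card (f ` {..<n})" using assms(1,2) by (intro card_mono) auto
  with changes_ge_colours[of a n b f] assms show ?thesis by simp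
qed

lemma changes_ge_3:
  assumes "a < n" "b < n" "c < n" "f a \<noteq> f b" "f a \<noteq> f c" "f b \<noteq> f c"
  shows "3 \<le> changes n f"
proof -
  have "card {f a, f b, f c} \<le> card (f ` {..<n})" using assms(1-3) by (intro card_mono) auto
  with changes_ge_colours[of a n b f] assms show ?thesis by simp
qed

definition entries :: "nat \<Rightarrow> (nat \<Rightarrow> bool) \<Rightarrow> nat set" where
  "entries n P = {i. i < n \<and> \<not> P i \<and> P (Suc i mod n)}"

lemma finite_entries: "finite (entries n P)"
  by (simp add: entries_def)

lemma changes_entries: "changes n P = 2 * card (entries n P)"
proof -
  let ?E = "{i. i < n \<and> P i \<and> \<not> P (Suc i mod n)}"
  have "(\<Sum>i<n. of_bool (P (Suc i mod n)) :: int) = (\<Sum>i<n. of_bool (P i))"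
    by (rule sum.reindex_bij_betw[OF bij_Suc_mod, of "\<lambda>i. of_bool (P i)"])
  then have "(\<Sum>i<n. of_bool (P (Suc i mod n)) - of_bool (P i) :: int) = 0"
    by (simp add: sum_subtractf)
  also have "(\<Sum>i<n. of_bool (P (Suc i mod n)) - of_bool (P i) :: int) =
      (\<Sum>i<n. of_bool (i \<in> entries n P) - of_bool (i \<in> ?E))"
    by (rule sum.cong) (auto simp: entries_def)
  also have "\<dots> = int (card (entries n P)) - int (card ?E)"
  proof -
    have "{..<n} \<inter> entries n P = entries n P" "{..<n} \<inter> {i. i \<in> ?E} = ?E" by (auto simp: entries_def)
    then show ?thesis by (simp add: sum_subtractf del: mem_Collect_eq)
  qed
  finally have "card ?E = card (entries n P)" by simp
  moreover have "{i. i < n \<and> P i \<noteq> P (Suc i mod n)} = entries n P \<union> ?E"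
    by (auto simp: entries_def)
  moreover have "entries n P \<inter> ?E = {}" by (auto simp: entries_def)
  ultimately show ?thesis
    unfolding changes_card by (simp add: card_Un_disjoint finite_entries)
qed

lemma changes_ge_entries:
  "2 * card (entries n (\<lambda>i. f i \<noteq> t)) \<le> changes n f"
proof -
  have "changes n (\<lambda>i. f i \<noteq> t) \<le> changes n f"
    unfolding changes_def by (rule sum_mono) auto
  then show ?thesis by (simp add: changes_entries)
qed

definition arc :: "nat \<Rightarrow> nat \<Rightarrow> nat \<Rightarrow> nat set" where
  "arc n p l = {(p + x) mod n | x. x < l}"

lemma arc_image: "arc n p l = (\<lambda>x. (p + x) mod n) ` {..<l}"
  by (auto simp: arc_def)

lemma inj_on_arc: "inj_on (\<lambda>x. (p + x) mod n) {..<n :: nat}"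
proof -
  have "(p + x) mod n \<noteq> (p + y) mod n" if xy: "x \<in> {..<n}" "y \<in> {..<n}" "x < y" for x y :: nat
  proof
    assume "(p + x) mod n = (p + y) mod n"
    then have "n dvd (p + y) - (p + x)" using xy mod_eq_dvd_iff_nat[of "p + x" "p + y" n] by simp
    then show False using xy by (auto dest: dvd_imp_le)
  qed
  then show ?thesis by (intro linorder_inj_onI) auto
qed

lemma card_arc: "l \<le> n \<Longrightarrow> card (arc n p l) = l"
  unfolding arc_image using inj_on_subset[OF inj_on_arc, of "{..<l}" n p] by (simp add: card_image)

lemma finite_arc: "finite (arc n p l)"
  by (simp add: arc_image)

lemma arc_subset: "0 < n \<Longrightarrow> arc n p l \<subseteq> {..<n}"
  by (auto simp: arc_def)

lemma arc_full: "0 < n \<Longrightarrow> arc n p n = {..<n}"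
  using arc_subset[of n p n] card_arc[of n n p] by (intro card_subset_eq) auto

lemma arc_Suc: "arc n p (Suc l) = insert ((p + l) mod n) (arc n p l)"
  by (auto simp: arc_image lessThan_Suc)

lemma arc_0: "arc n p 0 = {}"
  by (simp add: arc_def)

lemma arc_mod: "arc n (p mod n) l = arc n p l"
  by (simp add: arc_def mod_add_left_eq)

lemma arc_new: "l < n \<Longrightarrow> (p + l) mod n \<notin> arc n p l"
  using inj_onD[OF inj_on_arc[of p n], of l] by (fastforce simp: arc_def)

lemma arc_mem_iff:
  assumes "l \<le> n" "x < n"
  shows "(p + x) mod n \<in> arc n p l \<longleftrightarrow> x < l"
  using inj_onD[OF inj_on_arc[of p n], of x] assms by (auto simp: arc_def)

lemma arc_shift:
  assumes "k + l \<le> m"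
  shows "arc n (p + k) l \<subseteq> arc n p m"
proof
  fix y assume "y \<in> arc n (p + k) l"
  then obtain x where "x < l" "y = (p + (k + x)) mod n" by (auto simp: arc_def add.assoc)
  then show "y \<in> arc n p m" using assms by (auto simp: arc_def)
qed

text \<open>
  Once left, the set cannot be met again before its single entry.
\<close>

lemma single_entry_arc:
  assumes "card (entries n P) = 1"
  obtains p l where "p < n" "1 \<le> l" "l < n" "{i. i < n \<and> P i} = arc n p l"
proof -
  obtain e where e: "entries n P = {e}" using assms by (rule card_1_singletonE)
  then have e': "e < n" "\<not> P e" "P (Suc e mod n)" by (auto simp: entries_def)
  define p where "p = Suc e mod n"
  have p: "p < n" "P p" using e' by (auto simp: p_def)
  have pn: "(p + (n - 1)) mod n = e"
    using e'(1) by (cases "Suc e = n") (auto simp: p_def)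
  let ?Q = "\<lambda>x. \<not> P ((p + x) mod n)"
  define l where "l = (LEAST x. ?Q x)"
  have "?Q (n - 1)" using pn e' by simp
  then have l: "?Q l" "l \<le> n - 1"
    unfolding l_def by (rule LeastI[of ?Q], rule Least_le[of ?Q])
  have l': "\<not> ?Q x" if "x < l" for x
    using that not_less_Least[of x ?Q] unfolding l_def by blast
  have out: "?Q x" if "l \<le> x" "x < n" for x
    using that
  proof (induction x rule: dec_induct)
    case base
    then show ?case using l by simp
  next
    case (step x)
    show ?case
    proof (rule ccontr)
      assume "\<not> ?Q (Suc x)"
      then have "(p + x) mod n \<in> entries n P"
        using step p by (auto simp: entries_def mod_Suc_eq)
      then have "(p + x) mod n = (p + (n - 1)) mod n" using e pn by simp
      then have "x = n - 1" using inj_onD[OF inj_on_arc[of p n], of x "n - 1"] step by auto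
      with step show False by simp
    qed
  qed
  have "l \<noteq> 0" using l(1) p by (metis add_0_right mod_less)
  moreover have "{i. i < n \<and> P i} = arc n p l"
  proof (intro equalityI subsetI)
    fix i assume i: "i \<in> {i. i < n \<and> P i}"
    then have "i \<in> arc n p n" using arc_full[of n p] by auto
    then obtain x where "x < n" "i = (p + x) mod n" by (auto simp: arc_def)
    moreover from this have "x < l" using out[of x] i by (cases "x < l") auto
    ultimately show "i \<in> arc n p l" by (auto simp: arc_def)
  next
    fix i assume "i \<in> arc n p l"
    then show "i \<in> {i. i < n \<and> P i}" using l' p by (auto simp: arc_def)
  qed
  ultimately show ?thesis using that[of p l] p(1) l(2) by auto
qed

lemma changes_2_arc:
  assumes "changes n f = 2" "a < n" "f a = s" "b < n" "f b \<noteq> s"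
  obtains p l where "p < n" "1 \<le> l" "l < n" "{i. i < n \<and> f i = s} = arc n p l"
proof -
  have "changes n (\<lambda>i. f i = s) \<le> changes n f"
    unfolding changes_def by (rule sum_mono) auto
  moreover have "2 \<le> changes n (\<lambda>i. f i = s)" using assms by (intro changes_ge_2[of a n b]) auto
  ultimately have "card (entries n (\<lambda>i. f i = s)) = 1"
    using assms(1) by (simp add: changes_entries)
  from single_entry_arc[OF this] show ?thesis using that by blast
qed

text \<open>Only the two bonds at \<open>i\<close> are affected when the colour of \<open>i\<close> is changed.\<close>

lemma changes_update:
  assumes "3 \<le> n" "i < n" "y \<noteq> f i"
  shows "changes n (f(i := y)) + of_bool (f (Suc i mod n) = y) + of_bool (f (pred_mod n i) = y) =
    changes n f + of_bool (f (Suc i mod n) = f i) + of_bool (f (pred_mod n i) = f i)"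
proof -
  let ?A = "{..<n} - {i} - {pred_mod n i}"
  note d = cyclic_neighbours_distinct[OF assms(1,2)]
  have split: "changes n g = of_bool (g i \<noteq> g (Suc i mod n)) + (of_bool (g (pred_mod n i) \<noteq> g i) +
      (\<Sum>k\<in>?A. of_bool (g k \<noteq> g (Suc k mod n))))" for g :: "nat \<Rightarrow> 'a"
    unfolding changes_def using assms d pred_mod_less[of n i] Suc_pred_mod[of i n]
    by (subst sum.remove[of _ i]; (subst sum.remove[of _ "pred_mod n i"])?) auto
  have "(\<Sum>k\<in>?A. of_bool ((f(i := y)) k \<noteq> (f(i := y)) (Suc k mod n)) :: nat) =
      (\<Sum>k\<in>?A. of_bool (f k \<noteq> f (Suc k mod n)))"
    using assms by (intro sum.cong refl) (auto simp: Suc_mod_eq_iff simp del: fun_upd_apply simp add: fun_upd_apply)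
  then show ?thesis
    using assms(3) d unfolding split[of f] split[of "f(i := y)"] by auto
qed

section \<open>Counting disagreeing bonds\<close>

text \<open>
  Sorting the bonds into rows and columns reduces questions about them to cycles. The colours may be
  of any type: for the indicator of a set of sites one obtains the perimeter of the set.
\<close>

definition disagree :: "nat \<Rightarrow> nat \<Rightarrow> (nat \<times> nat \<Rightarrow> 'a) \<Rightarrow> nat" where
  "disagree K L \<sigma> = (\<Sum>i<K. changes L (\<lambda>j. \<sigma> (i, j))) + (\<Sum>j<L. changes K (\<lambda>i. \<sigma> (i, j)))"

definition nbrs :: "nat \<Rightarrow> nat \<Rightarrow> (nat \<times> nat \<Rightarrow> 'a) \<Rightarrow> nat \<Rightarrow> nat \<Rightarrow> 'a \<Rightarrow> nat" where
  "nbrs K L \<sigma> i j c =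
     of_bool (\<sigma> (Suc i mod K, j) = c) + of_bool (\<sigma> (pred_mod K i, j) = c) +
     of_bool (\<sigma> (i, Suc j mod L) = c) + of_bool (\<sigma> (i, pred_mod L j) = c)"

definition full_col :: "nat \<Rightarrow> (nat \<times> nat \<Rightarrow> 'a) \<Rightarrow> nat \<Rightarrow> 'a \<Rightarrow> bool" where
  "full_col K \<sigma> j a \<longleftrightarrow> (\<forall>i<K. \<sigma> (i, j) = a)"

definition has_col :: "nat \<Rightarrow> nat \<Rightarrow> (nat \<times> nat \<Rightarrow> 'a) \<Rightarrow> 'a \<Rightarrow> bool" where
  "has_col K L \<sigma> a \<longleftrightarrow> (\<exists>j<L. full_col K \<sigma> j a)"

lemma mem_vertices [simp]: "(i, j) \<in> vertices K L \<longleftrightarrow> i < K \<and> j < L"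
  by (simp add: vertices_def)

lemma disagree_cong:
  assumes "\<And>v w. v \<in> vertices K L \<Longrightarrow> w \<in> vertices K L \<Longrightarrow> \<sigma> v = \<sigma> w \<longleftrightarrow> \<tau> v = \<tau> w"
  shows "disagree K L \<sigma> = disagree K L \<tau>"
proof -
  have "changes L (\<lambda>j. \<sigma> (i, j)) = changes L (\<lambda>j. \<tau> (i, j))" if "i < K" for i
    using assms that by (intro changes_cong) auto
  moreover have "changes K (\<lambda>i. \<sigma> (i, j)) = changes K (\<lambda>i. \<tau> (i, j))" if "j < L" for j
    using assms that by (intro changes_cong) auto
  ultimately show ?thesis by (simp add: disagree_def)
qed

lemma hamiltonian_disagree:
  assumes "2 \<le> K"
  shows "hamiltonian K L \<sigma> = int (disagree K L \<sigma>) - 2 * int (K * L)"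
proof -
  let ?V = "vertices K L" and ?agree = "\<lambda>(v, w). of_bool (\<sigma> v = \<sigma> w) :: int"
  let ?f = "\<lambda>(i, j). ((i, j), (Suc i mod K, j))" and ?g = "\<lambda>(i, j). ((i, j), (i, Suc j mod L))"
  have "?f ` ?V \<inter> ?g ` ?V = {}"
    using assms by (auto simp: Suc_mod_if split: if_splits)
  then have "sum ?agree (edges K L) = sum ?agree (?f ` ?V) + sum ?agree (?g ` ?V)"
    unfolding edges_def by (intro sum.union_disjoint finite_imageI finite_vertices)
  also have "sum ?agree (?f ` ?V) = (\<Sum>(i, j)\<in>?V. of_bool (\<sigma> (i, j) = \<sigma> (Suc i mod K, j)))"
    by (subst sum.reindex) (auto intro!: inj_onI sum.cong)
  also have "\<dots> = (\<Sum>(i, j)\<in>?V. 1 - of_bool (\<sigma> (i, j) \<noteq> \<sigma> (Suc i mod K, j)))"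
    by (intro sum.cong) auto
  also have "\<dots> = int (K * L) - int (\<Sum>j<L. changes K (\<lambda>i. \<sigma> (i, j)))"
    unfolding vertices_def changes_def
    by (simp add: sum.cartesian_product[symmetric] sum_subtractf atLeast0LessThan sum.swap[of _ "{..<K}"]
        del: sum_of_bool_eq)
  also have "sum ?agree (?g ` ?V) = (\<Sum>(i, j)\<in>?V. of_bool (\<sigma> (i, j) = \<sigma> (i, Suc j mod L)))"
    by (subst sum.reindex) (auto intro!: inj_onI sum.cong)
  also have "\<dots> = (\<Sum>(i, j)\<in>?V. 1 - of_bool (\<sigma> (i, j) \<noteq> \<sigma> (i, Suc j mod L)))"
    by (intro sum.cong) auto
  also have "\<dots> = int (K * L) - int (\<Sum>i<K. changes L (\<lambda>j. \<sigma> (i, j)))"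
    unfolding vertices_def changes_def
    by (simp add: sum.cartesian_product[symmetric] sum_subtractf atLeast0LessThan)
  finally show ?thesis
    by (simp add: hamiltonian_def disagree_def)
qed

lemma disagree_update:
  assumes "3 \<le> K" "3 \<le> L" "i < K" "j < L" "y \<noteq> \<sigma> (i, j)"
  shows "disagree K L (\<sigma>((i, j) := y)) + nbrs K L \<sigma> i j y = disagree K L \<sigma> + nbrs K L \<sigma> i j (\<sigma> (i, j))"
proof -
  let ?\<tau> = "\<sigma>((i, j) := y)"
  have row: "(\<Sum>k<K. changes L (\<lambda>l. \<tau> (k, l))) =
      changes L (\<lambda>l. \<tau> (i, l)) + (\<Sum>k\<in>{..<K} - {i}. changes L (\<lambda>l. \<tau> (k, l)))" for \<tau> :: "nat \<times> nat \<Rightarrow> 'a"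
    using assms by (intro sum.remove) auto
  have col: "(\<Sum>l<L. changes K (\<lambda>k. \<tau> (k, l))) =
      changes K (\<lambda>k. \<tau> (k, j)) + (\<Sum>l\<in>{..<L} - {j}. changes K (\<lambda>k. \<tau> (k, l)))" for \<tau> :: "nat \<times> nat \<Rightarrow> 'a"
    using assms by (intro sum.remove) auto
  have "(\<Sum>k\<in>{..<K} - {i}. changes L (\<lambda>l. ?\<tau> (k, l))) = (\<Sum>k\<in>{..<K} - {i}. changes L (\<lambda>l. \<sigma> (k, l)))"
    by (intro sum.cong) auto
  moreover have "(\<Sum>l\<in>{..<L} - {j}. changes K (\<lambda>k. ?\<tau> (k, l))) = (\<Sum>l\<in>{..<L} - {j}. changes K (\<lambda>k. \<sigma> (k, l)))"
    by (intro sum.cong) auto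
  moreover have "(\<lambda>l. ?\<tau> (i, l)) = (\<lambda>l. \<sigma> (i, l))(j := y)" "(\<lambda>k. ?\<tau> (k, j)) = (\<lambda>k. \<sigma> (k, j))(i := y)"
    by auto
  ultimately show ?thesis
    unfolding disagree_def row[of ?\<tau>] row[of \<sigma>] col[of ?\<tau>] col[of \<sigma>] nbrs_def
    using changes_update[of L j y "\<lambda>l. \<sigma> (i, l)"] changes_update[of K i y "\<lambda>k. \<sigma> (k, j)"] assms
    by simp
qed

lemma nbrs_le_4: "nbrs K L \<sigma> i j c \<le> 4"
  by (simp add: nbrs_def)

lemma nbrs_disjoint: "a \<noteq> b \<Longrightarrow> nbrs K L \<sigma> i j a + nbrs K L \<sigma> i j b \<le> 4"
  by (auto simp: nbrs_def)

lemma full_colD: "full_col K \<sigma> j a \<Longrightarrow> i < K \<Longrightarrow> \<sigma> (i, j) = a"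
  by (simp add: full_col_def)

text \<open>
  The four neighbours of a site are distinct, and columns are shorter than rows: already the two ends
  of a strip of rows would take \<open>2 L \<ge> 2 K + 2\<close> bonds.
\<close>

locale torus =
  fixes K L :: nat
  assumes K: "3 \<le> K" and KL: "K < L"
begin

lemma L: "4 \<le> L"
  using K KL by simp

abbreviation "dis \<equiv> disagree K L"
abbreviation "has \<equiv> has_col K L"
abbreviation "full \<equiv> full_col K"
abbreviation "nb \<equiv> nbrs K L"

lemma dis_update:
  assumes "i < K" "j < L" "y \<noteq> \<sigma> (i, j)"
  shows "dis (\<sigma>((i, j) := y)) + nb \<sigma> i j y = dis \<sigma> + nb \<sigma> i j (\<sigma> (i, j))"
  using disagree_update[of K L i j y \<sigma>] assms K L by simp

lemma full_unique: "full \<sigma> j a \<Longrightarrow> full \<sigma> j b \<Longrightarrow> a = b"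
  using K unfolding full_col_def by (metis less_le_trans zero_less_numeral)

lemma has_colI: "j < L \<Longrightarrow> full \<sigma> j a \<Longrightarrow> has \<sigma> a"
  by (auto simp: has_col_def)

lemma changes_col_ge_2: "\<forall>a. \<not> full \<sigma> j a \<Longrightarrow> 2 \<le> changes K (\<lambda>i. \<sigma> (i, j))"
proof -
  assume "\<forall>a. \<not> full \<sigma> j a"
  then obtain i where "i < K" "\<sigma> (i, j) \<noteq> \<sigma> (0, j)" unfolding full_col_def by blast
  then show ?thesis using K by (intro changes_ge_2[of i K 0]) auto
qed

lemma changes_col_zero: "full \<sigma> j a \<Longrightarrow> changes K (\<lambda>i. \<sigma> (i, j)) = 0"
  by (simp add: changes_zero_iff full_col_def)

lemma changes_row_ge_2: "j < L \<Longrightarrow> l < L \<Longrightarrow> \<sigma> (i, j) \<noteq> \<sigma> (i, l) \<Longrightarrow> 2 \<le> changes L (\<lambda>j. \<sigma> (i, j))"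
  using changes_ge_2[of j L l "\<lambda>j. \<sigma> (i, j)"] .

lemma col_le_sum: "j < L \<Longrightarrow> changes K (\<lambda>i. \<sigma> (i, j)) \<le> (\<Sum>j<L. changes K (\<lambda>i. \<sigma> (i, j)))"
  by (rule member_le_sum) auto

lemma rows_ge:
  assumes "\<And>i. i < K \<Longrightarrow> c \<le> changes L (\<lambda>j. \<sigma> (i, j))"
  shows "c * K \<le> (\<Sum>i<K. changes L (\<lambda>j. \<sigma> (i, j)))"
  using sum_bounded_below[of "{..<K}" c "\<lambda>i. changes L (\<lambda>j. \<sigma> (i, j))"] assms
  by (simp add: mult.commute)

text \<open>
  Without a constant column every column costs two bonds, which already exhausts \<open>2 K + 2\<close>.
\<close>

lemma no_constant_column:
  assumes "dis \<sigma> \<le> 2 * K + 2" "\<And>a. \<not> has \<sigma> a"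
  shows "dis \<sigma> = 2 * K + 2" "i < K \<Longrightarrow> j < L \<Longrightarrow> l < L \<Longrightarrow> \<sigma> (i, j) = \<sigma> (i, l)"
proof -
  have "2 * L \<le> (\<Sum>j<L. changes K (\<lambda>i. \<sigma> (i, j)))"
  proof -
    have "\<And>j. j < L \<Longrightarrow> 2 \<le> changes K (\<lambda>i. \<sigma> (i, j))"
      using assms(2) by (intro changes_col_ge_2) (auto simp: has_col_def)
    then show ?thesis
      using sum_bounded_below[of "{..<L}" 2 "\<lambda>j. changes K (\<lambda>i. \<sigma> (i, j))"] by (simp add: mult.commute)
  qed
  then have *: "dis \<sigma> = 2 * K + 2" "(\<Sum>i<K. changes L (\<lambda>j. \<sigma> (i, j))) = 0"
    using assms(1) KL unfolding disagree_def by linarith+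
  then show "dis \<sigma> = 2 * K + 2" by simp
  assume "i < K" "j < L" "l < L"
  moreover from this * have "changes L (\<lambda>j. \<sigma> (i, j)) = 0" by simp
  ultimately show "\<sigma> (i, j) = \<sigma> (i, l)" unfolding changes_zero_iff by blast
qed

section \<open>Configurations with constant columns of two colours\<close>

text \<open>
  Every row then has at least two changes. If all columns are constant, all rows look alike and a
  third change would occur \<open>K\<close> times. Otherwise a column that is not constant takes the two bonds that
  are left.
\<close>

lemma two_columns:
  assumes d: "dis \<sigma> \<le> 2 * K + 2" and ab: "has \<sigma> a" "has \<sigma> b" "a \<noteq> b"
  shows "\<And>i. i < K \<Longrightarrow> changes L (\<lambda>j. \<sigma> (i, j)) = 2"
    and "\<And>i j. i < K \<Longrightarrow> j < L \<Longrightarrow> \<sigma> (i, j) = a \<or> \<sigma> (i, j) = b"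
    and "(\<forall>j<L. full \<sigma> j a \<or> full \<sigma> j b) \<or>
      (dis \<sigma> = 2 * K + 2 \<and> (\<exists>m<L. changes K (\<lambda>i. \<sigma> (i, m)) = 2 \<and>
         (\<forall>j<L. j \<noteq> m \<longrightarrow> full \<sigma> j a \<or> full \<sigma> j b)))"
proof -
  let ?R = "\<Sum>i<K. changes L (\<lambda>j. \<sigma> (i, j))" and ?C = "\<Sum>j<L. changes K (\<lambda>i. \<sigma> (i, j))"
  obtain ja jb where j: "ja < L" "full \<sigma> ja a" "jb < L" "full \<sigma> jb b"
    using ab by (auto simp: has_col_def)
  have R2: "2 \<le> changes L (\<lambda>j. \<sigma> (i, j))" if "i < K" for i
    using j full_colD[OF j(2) that] full_colD[OF j(4) that] ab(3)
    by (intro changes_row_ge_2[of ja jb]) auto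
  then have R: "2 * K \<le> ?R" using rows_ge[of 2 \<sigma>] by simp
  have sumR: "?R = changes L (\<lambda>j. \<sigma> (i, j)) + (\<Sum>i\<in>{..<K} - {i}. changes L (\<lambda>j. \<sigma> (i, j)))" if "i < K" for i
    using that by (intro sum.remove) auto
  show rows: "changes L (\<lambda>j. \<sigma> (i, j)) = 2" if i: "i < K" for i
  proof (cases "?C = 0")
    case True
    then have "changes K (\<lambda>i. \<sigma> (i, j)) = 0" if "j < L" for j using that by simp
    then have eq: "\<sigma> (i', j) = \<sigma> (i, j)" if "j < L" "i' < K" for i' j
      using that i unfolding changes_zero_iff by blast
    have "changes L (\<lambda>j. \<sigma> (i', j)) = changes L (\<lambda>j. \<sigma> (i, j))" if "i' < K" for i'
      using eq that by (intro changes_cong) simp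
    then have "?R = K * changes L (\<lambda>j. \<sigma> (i, j))" by simp
    moreover have "?R \<le> 2 * K + 2" using d by (simp add: disagree_def)
    moreover have "K * 3 \<le> K * changes L (\<lambda>j. \<sigma> (i, j))" if "changes L (\<lambda>j. \<sigma> (i, j)) \<noteq> 2"
      using R2[OF i] that by (intro mult_le_mono) auto
    ultimately show ?thesis using K by linarith
  next
    case False
    then obtain j where "j < L" "changes K (\<lambda>i. \<sigma> (i, j)) \<noteq> 0" by auto
    then have "2 \<le> changes K (\<lambda>i. \<sigma> (i, j))" using changes_col_ge_2 changes_col_zero by metis
    with \<open>j < L\<close> have "2 \<le> ?C" using col_le_sum[of j \<sigma>] by linarith
    then have "?R \<le> 2 * K" using d by (simp add: disagree_def)
    moreover have "2 * (K - 1) \<le> (\<Sum>i\<in>{..<K} - {i}. changes L (\<lambda>j. \<sigma> (i, j)))"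
      using sum_bounded_below[of "{..<K} - {i}" 2 "\<lambda>i. changes L (\<lambda>j. \<sigma> (i, j))"] R2 i by simp
    ultimately show ?thesis using sumR[OF i] R2[OF i] K by linarith
  qed
  show vals: "\<sigma> (i, j) = a \<or> \<sigma> (i, j) = b" if "i < K" "j < L" for i j
  proof (rule ccontr)
    assume "\<not> ?thesis"
    then have "3 \<le> changes L (\<lambda>j. \<sigma> (i, j))"
      using j full_colD[OF j(2) that(1)] full_colD[OF j(4) that(1)] ab(3) that
      by (intro changes_ge_3[of ja L jb j]) auto
    with rows[OF that(1)] show False by simp
  qed
  have const: "full \<sigma> j a \<or> full \<sigma> j b" if "full \<sigma> j c" "j < L" for j c
    using that vals[of 0 j] K full_colD[OF that(1), of 0] by auto
  show "(\<forall>j<L. full \<sigma> j a \<or> full \<sigma> j b) \<or>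
      (dis \<sigma> = 2 * K + 2 \<and> (\<exists>m<L. changes K (\<lambda>i. \<sigma> (i, m)) = 2 \<and>
         (\<forall>j<L. j \<noteq> m \<longrightarrow> full \<sigma> j a \<or> full \<sigma> j b)))"
  proof (cases "\<forall>j<L. full \<sigma> j a \<or> full \<sigma> j b")
    case False
    then obtain m where m: "m < L" "\<forall>c. \<not> full \<sigma> m c" using const by blast
    have C: "?C \<le> 2" using d R by (simp add: disagree_def)
    have "?C = changes K (\<lambda>i. \<sigma> (i, m)) + (\<Sum>j\<in>{..<L} - {m}. changes K (\<lambda>i. \<sigma> (i, j)))"
      using m by (intro sum.remove) auto
    with C changes_col_ge_2[OF m(2)] have 2: "changes K (\<lambda>i. \<sigma> (i, m)) = 2" "?C = 2"
      "(\<Sum>j\<in>{..<L} - {m}. changes K (\<lambda>i. \<sigma> (i, j))) = 0" by linarith+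
    have "full \<sigma> j a \<or> full \<sigma> j b" if "j < L" "j \<noteq> m" for j
    proof -
      have "changes K (\<lambda>i. \<sigma> (i, j)) = 0" using 2(3) that by simp
      moreover have "0 < K" using K by simp
      ultimately have "full \<sigma> j (\<sigma> (0, j))" unfolding changes_zero_iff full_col_def by blast
      with that const show ?thesis by blast
    qed
    moreover have "dis \<sigma> = 2 * K + 2" using R d 2 by (simp add: disagree_def)
    ultimately show ?thesis using m 2 by blast
  qed simp
qed

lemma two_columns_only:
  assumes "dis \<sigma> \<le> 2 * K + 2" "has \<sigma> a" "has \<sigma> b" "a \<noteq> b" "has \<sigma> c"
  shows "c = a \<or> c = b"
proof -
  obtain j where "j < L" "full \<sigma> j c" using assms(5) by (auto simp: has_col_def)
  then show ?thesis using two_columns(2)[OF assms(1-4), of 0 j] K full_colD[of K \<sigma> j c 0] by auto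
qed

end

definition cells :: "nat \<Rightarrow> nat \<Rightarrow> config \<Rightarrow> nat \<Rightarrow> (nat \<times> nat) set" where
  "cells K L \<sigma> s = {v \<in> vertices K L. \<sigma> v = s}"

lemma block_arc: "block K L i j a b = arc K i b \<times> arc L j a"
  by (auto simp: block_def arc_def)

lemma arc_1: "arc n p 1 = {p mod n}"
  by (auto simp: arc_def)

lemma arc_entry:
  assumes "x < n" "x \<notin> arc n p l" "Suc x mod n \<in> arc n p l" "p < n"
  shows "x = pred_mod n p"
proof -
  obtain y where y: "y < l" "Suc x mod n = (p + y) mod n" using assms(3) by (auto simp: arc_def)
  show ?thesis
  proof (cases y)
    case 0
    then show ?thesis using y assms by (metis add_0_right mod_less pred_Suc_mod)
  next
    case (Suc z)
    then have "Suc x mod n = Suc ((p + z) mod n) mod n" using y by (simp add: mod_Suc_eq)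
    then have "x = (p + z) mod n" using assms(1,4) by (metis pred_Suc_mod mod_less_divisor gr_implies_not0 neq0_conv)
    then show ?thesis using assms(2) Suc y by (auto simp: arc_def)
  qed
qed

lemma arc_leave:
  assumes "x \<in> arc n p l" "Suc x mod n \<notin> arc n p l"
  shows "Suc x mod n = (p + l) mod n"
proof -
  obtain y where y: "y < l" "x = (p + y) mod n" using assms(1) by (auto simp: arc_def)
  then have "Suc x mod n = (p + Suc y) mod n" by (simp add: mod_Suc_eq)
  with assms(2) have "\<not> Suc y < l" by (auto simp: arc_def)
  with y have "Suc y = l" by simp
  with \<open>Suc x mod n = (p + Suc y) mod n\<close> show ?thesis by simp
qed

context torus
begin

definition columns :: "nat set \<Rightarrow> (nat \<times> nat) set" where
  "columns C = {..<K} \<times> C"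

lemma card_columns: "finite C \<Longrightarrow> card (columns C) = K * card C"
  by (simp add: columns_def)

text \<open>
  In a column that is not constant some rows show \<open>r\<close> and some \<open>s\<close>. As all rows have exactly two
  changes, its two neighbouring columns differ, and its part of colour \<open>s\<close> is a bar at the side of the
  strip.
\<close>

lemma strip_shape:
  assumes d: "dis \<sigma> \<le> 2 * K + 2" and rs: "has \<sigma> r" "has \<sigma> s" "r \<noteq> s"
  obtains (strip) p m where "p < L" "1 \<le> m" "m < L" "{j. j < L \<and> full \<sigma> j s} = arc L p m"
      "cells K L \<sigma> s = columns (arc L p m)"
      "dis \<sigma> = 2 * K"
    | (bar) p m k h c where "p < L" "1 \<le> m" "m < L" "{j. j < L \<and> full \<sigma> j s} = arc L p m"
      "dis \<sigma> = 2 * K + 2" "k < K" "1 \<le> h" "h < K" "c < L" "c \<notin> arc L p m"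
      "c = (p + m) mod L \<or> c = pred_mod L p"
      "cells K L \<sigma> s = columns (arc L p m) \<union> arc K k h \<times> {c}"
proof -
  obtain jr js where j: "jr < L" "full \<sigma> jr r" "js < L" "full \<sigma> js s"
    using rs by (auto simp: has_col_def)
  note two = two_columns[OF d rs]
  have rowarc: "\<exists>p m. p < L \<and> 1 \<le> m \<and> m < L \<and> {j. j < L \<and> \<sigma> (i, j) = s} = arc L p m" if "i < K" for i
    using changes_2_arc[OF two(1)[OF that], of js s jr] j full_colD[OF j(2) that] full_colD[OF j(4) that] rs(3)
    by metis
  from two(3) show ?thesis
  proof (elim disjE exE conjE)
    assume const: "\<forall>j<L. full \<sigma> j r \<or> full \<sigma> j s"
    have f: "full \<sigma> j s \<longleftrightarrow> \<sigma> (i, j) = s" if "i < K" "j < L" for i j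
      using const that rs(3) by (auto dest: full_colD)
    obtain p m where pm: "p < L" "1 \<le> m" "m < L" "{j. j < L \<and> \<sigma> (0, j) = s} = arc L p m"
      using rowarc[of 0] K by auto
    have "{j. j < L \<and> full \<sigma> j s} = arc L p m" unfolding pm(4)[symmetric] using f[of 0] K by auto
    moreover have "cells K L \<sigma> s = columns {j. j < L \<and> full \<sigma> j s}"
    proof -
      have "(i, j) \<in> cells K L \<sigma> s \<longleftrightarrow> (i, j) \<in> columns {j. j < L \<and> full \<sigma> j s}" for i j
        using f[of i j] by (auto simp: cells_def columns_def)
      then show ?thesis by auto
    qed
    moreover have "dis \<sigma> = 2 * K"
    proof -
      have "changes K (\<lambda>i. \<sigma> (i, j)) = 0" if "j < L" for j
        using const that changes_col_zero[of \<sigma> j r] changes_col_zero[of \<sigma> j s] by auto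
      then show ?thesis by (simp add: disagree_def two(1))
    qed
    ultimately show ?thesis using pm by (intro strip) simp_all
  next
    fix c assume c: "dis \<sigma> = 2 * K + 2" "c < L" "changes K (\<lambda>i. \<sigma> (i, c)) = 2"
      "\<forall>j<L. j \<noteq> c \<longrightarrow> full \<sigma> j r \<or> full \<sigma> j s"
    have f: "full \<sigma> j s \<longleftrightarrow> \<sigma> (i, j) = s" if "i < K" "j < L" "j \<noteq> c" for i j
      using c(4) that rs(3) by (auto dest: full_colD)
    have nf: "\<not> full \<sigma> c a" for a using c(3) changes_col_zero[of \<sigma> c a] by auto
    obtain u where u: "u < K" "\<sigma> (u, c) = s"
      using nf[of r] two(2)[OF _ c(2)] by (auto simp: full_col_def)
    obtain ir where ir: "ir < K" "\<sigma> (ir, c) \<noteq> s"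
      using nf[of s] by (auto simp: full_col_def)
    then have "\<sigma> (ir, c) = r" using two(2)[OF ir(1) c(2)] by simp
    obtain p m where pm: "p < L" "1 \<le> m" "m < L" "{j. j < L \<and> \<sigma> (ir, j) = s} = arc L p m"
      using rowarc[OF ir(1)] by auto
    have C: "{j. j < L \<and> full \<sigma> j s} = arc L p m"
    proof -
      have "full \<sigma> j s \<longleftrightarrow> \<sigma> (ir, j) = s" if "j < L" for j
        using f[OF ir(1) that] nf ir by (cases "j = c") auto
      then show ?thesis unfolding pm(4)[symmetric] by auto
    qed
    have notin: "c \<notin> arc L p m" unfolding C[symmetric] using nf by simp
    obtain k h where kh: "k < K" "1 \<le> h" "h < K" "{i. i < K \<and> \<sigma> (i, c) = s} = arc K k h"
      using changes_2_arc[OF c(3) u ir] by blast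
    have cells: "cells K L \<sigma> s = columns (arc L p m) \<union> arc K k h \<times> {c}"
    proof -
      have "(i, j) \<in> cells K L \<sigma> s \<longleftrightarrow> (i, j) \<in> columns (arc L p m) \<union> arc K k h \<times> {c}" for i j
      proof (cases "j = c")
        case True
        have "(i, c) \<in> cells K L \<sigma> s \<longleftrightarrow> i \<in> {i. i < K \<and> \<sigma> (i, c) = s}"
          using c(2) by (simp add: cells_def)
        then show ?thesis unfolding True kh(4) using notin by (simp add: columns_def)
      next
        case False
        then have "(i, j) \<in> columns (arc L p m) \<union> arc K k h \<times> {c} \<longleftrightarrow> i < K \<and> j \<in> {j. j < L \<and> full \<sigma> j s}"
          unfolding C by (auto simp: columns_def)
        also have "\<dots> \<longleftrightarrow> (i, j) \<in> cells K L \<sigma> s"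
          using f[OF _ _ False] by (auto simp: cells_def)
        finally show ?thesis by simp
      qed
      then show ?thesis by auto
    qed
    have "c = (p + m) mod L \<or> c = pred_mod L p"
    proof -
      let ?f = "\<lambda>j. \<sigma> (ir, j)"
      let ?g = "?f(c := s)"
      have "changes L ?g = changes L (\<lambda>j. \<sigma> (u, j))"
      proof -
        have "?g j = \<sigma> (u, j)" if "j < L" for j
          using f[OF ir(1) that] f[OF u(1) that] u two(2)[OF ir(1) that] two(2)[OF u(1) that] by auto
        then show ?thesis by (intro changes_cong) simp
      qed
      then have "changes L ?g = 2" "changes L ?f = 2" using two(1) ir u by simp_all
      then have "of_bool (?f (Suc c mod L) = s) + of_bool (?f (pred_mod L c) = s) =
          (of_bool (?f (Suc c mod L) = r) + of_bool (?f (pred_mod L c) = r) :: nat)"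
        using changes_update[of L c s ?f] c(2) L ir \<open>\<sigma> (ir, c) = r\<close> by simp
      then have "?f (Suc c mod L) = s \<or> ?f (pred_mod L c) = s"
        using two(2)[OF ir(1), of "Suc c mod L"] c(2) rs(3)
        by (auto split: if_splits simp: of_bool_def)
      then have "Suc c mod L \<in> arc L p m \<or> pred_mod L c \<in> arc L p m"
        unfolding pm(4)[symmetric] using c(2) pred_mod_less[of L c] by auto
      then show ?thesis
      proof
        assume "Suc c mod L \<in> arc L p m"
        with arc_entry[OF c(2) notin _ pm(1)] show ?thesis by simp
      next
        assume "pred_mod L c \<in> arc L p m"
        with arc_leave[of "pred_mod L c" L p m] notin show ?thesis
          using c(2) by (simp add: Suc_pred_mod)
      qed
    qed
    then show ?thesis using bar[OF pm(1-3) C c(1) kh(1-3) c(2) notin] cells by simp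
  qed
qed

lemma card_strip_bar:
  assumes "p < L" "m < L" "h < K" "c \<notin> arc L p m"
  shows "card (columns (arc L p m) \<union> arc K k h \<times> {c}) = m * K + h"
proof -
  have "card (columns (arc L p m) \<union> arc K k h \<times> {c}) = card (columns (arc L p m)) + card (arc K k h \<times> {c})"
    using assms by (intro card_Un_disjoint) (auto simp: columns_def finite_arc)
  then show ?thesis
    using assms by (simp add: card_columns finite_arc card_arc card_cartesian_product)
qed

lemma configs_two_colours:
  assumes "\<sigma> \<in> configs q K L" "\<And>v. v \<in> vertices K L \<Longrightarrow> \<sigma> v = r \<or> \<sigma> v = s" "A \<inter> vertices K L = cells K L \<sigma> s"
  shows "\<sigma> = droplet K L r s A"
proof
  fix v
  show "\<sigma> v = droplet K L r s A v"
  proof (cases "v \<in> vertices K L")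
    case True
    then have "v \<in> A \<longleftrightarrow> \<sigma> v = s" using assms(3) by (auto simp: cells_def)
    then show ?thesis using True assms(2)[OF True] by (auto simp: droplet_def)
  next
    case False
    then have "\<sigma> v = undefined" using assms(1) unfolding configs_def by (rule PiE_arb[rotated])
    with False show ?thesis by (simp add: droplet_def)
  qed
qed

text \<open>Since the bar has fewer than \<open>K\<close> sites, the area determines the width of the strip.\<close>

lemma strip_bar_by_area:
  assumes \<sigma>: "\<sigma> \<in> configs q K L" and d: "dis \<sigma> \<le> 2 * K + 2" and rs: "has \<sigma> r" "has \<sigma> s" "r \<noteq> s"
    and a: "card (cells K L \<sigma> s) = j * K + h" "1 \<le> h" "h < K"
  shows "\<sigma> \<in> Bbar K L h j K r s"
  using d rs
proof (cases rule: strip_shape)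
  case (strip p m)
  then have "m * K = j * K + h" using a by (simp add: card_columns finite_arc card_arc mult.commute)
  then have "(j * K + h) mod K = 0" by (metis mod_mult_self2_is_0)
  then show ?thesis using a by simp
next
  case (bar p m k h' c)
  have "m * K + h' = j * K + h" using card_strip_bar[of p m h' c k] bar a by simp
  then have "(m * K + h') mod K = (j * K + h) mod K" "(m * K + h') div K = (j * K + h) div K" by simp_all
  then have eq: "h' = h" "m = j" using bar a by simp_all
  let ?c = "if c = (p + m) mod L then p + m else p + L - 1"
  have c: "?c mod L = c" using bar(11) bar(9) by (auto simp: pred_mod_def)
  have "columns (arc L p m) \<union> arc K k h' \<times> {c} = block K L k p j K \<union> block K L (k + 0) ?c 1 h"
    using K eq c by (simp add: block_arc arc_full arc_1 columns_def del: One_nat_def)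
  moreover have "\<sigma> = droplet K L r s (columns (arc L p m) \<union> arc K k h' \<times> {c})"
  proof (rule configs_two_colours[OF \<sigma>])
    show "(columns (arc L p m) \<union> arc K k h' \<times> {c}) \<inter> vertices K L = cells K L \<sigma> s"
      unfolding bar(12)[symmetric] by (auto simp: cells_def)
    fix v assume "v \<in> vertices K L"
    then show "\<sigma> v = r \<or> \<sigma> v = s" using two_columns(2)[OF d rs] by (cases v) simp
  qed
  ultimately show ?thesis
    unfolding Bbar_def using bar(1,6) a(3)
    by (intro CollectI exI[of _ k] exI[of _ p] exI[of _ 0] exI[of _ ?c] conjI)
      (simp_all add: eq del: One_nat_def)
qed

end

section \<open>Single spin flips and paths\<close>

definition flip :: "nat \<Rightarrow> nat \<Rightarrow> nat \<Rightarrow> config \<Rightarrow> config \<Rightarrow> bool" where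
  "flip q K L \<sigma> \<sigma>' \<longleftrightarrow> \<sigma> \<in> configs q K L \<and>
     (\<exists>i j y. i < K \<and> j < L \<and> y \<in> {1..q} \<and> y \<noteq> \<sigma> (i, j) \<and> \<sigma>' = \<sigma>((i, j) := y))"

lemma config_value: "\<sigma> \<in> configs q K L \<Longrightarrow> i < K \<Longrightarrow> j < L \<Longrightarrow> \<sigma> (i, j) \<in> {1..q}"
  using PiE_mem[of \<sigma> "vertices K L" "\<lambda>_. {1..q}" "(i, j)"] by (simp add: configs_def)

lemma flip_configs: "flip q K L \<sigma> \<sigma>' \<Longrightarrow> \<sigma> \<in> configs q K L \<and> \<sigma>' \<in> configs q K L"
  by (auto simp: flip_def configs_def PiE_iff extensional_def)

lemma flip_sym: "flip q K L \<sigma> \<sigma>' \<Longrightarrow> flip q K L \<sigma>' \<sigma>"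
proof -
  assume f: "flip q K L \<sigma> \<sigma>'"
  then obtain i j y where *: "\<sigma> \<in> configs q K L" "i < K" "j < L" "y \<noteq> \<sigma> (i, j)" "\<sigma>' = \<sigma>((i, j) := y)"
    by (auto simp: flip_def)
  then have "\<sigma> = \<sigma>'((i, j) := \<sigma> (i, j))" "\<sigma> (i, j) \<in> {1..q}" "\<sigma> (i, j) \<noteq> \<sigma>' (i, j)"
    using config_value by auto
  then show ?thesis using flip_configs[OF f] *(2,3) unfolding flip_def by blast
qed

lemma flip_disagreements:
  assumes "\<sigma> \<in> configs q K L" "\<sigma>' \<in> configs q K L"
  shows "flip q K L \<sigma> \<sigma>' \<longleftrightarrow> card (disagreements K L \<sigma> \<sigma>') = 1"
proof
  assume "flip q K L \<sigma> \<sigma>'"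
  then obtain i j y where "i < K" "j < L" "y \<noteq> \<sigma> (i, j)" "\<sigma>' = \<sigma>((i, j) := y)"
    by (auto simp: flip_def)
  then have "disagreements K L \<sigma> \<sigma>' = {(i, j)}" by (auto simp: disagreements_def)
  then show "card (disagreements K L \<sigma> \<sigma>') = 1" by simp
next
  assume "card (disagreements K L \<sigma> \<sigma>') = 1"
  then obtain v where v: "disagreements K L \<sigma> \<sigma>' = {v}" by (rule card_1_singletonE)
  obtain i j where ij: "v = (i, j)" by (cases v)
  have "(i, j) \<in> disagreements K L \<sigma> \<sigma>'" using v ij by simp
  then have *: "i < K" "j < L" "\<sigma>' (i, j) \<noteq> \<sigma> (i, j)" by (auto simp: disagreements_def)
  have "\<sigma>' w = (\<sigma>((i, j) := \<sigma>' (i, j))) w" for w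
  proof (cases "w \<in> vertices K L \<and> w \<noteq> (i, j)")
    case True
    then have "w \<notin> disagreements K L \<sigma> \<sigma>'" using v ij by simp
    with True show ?thesis by (auto simp: disagreements_def)
  next
    case False
    show ?thesis
    proof (cases "w = (i, j)")
      case notv: False
      with False have "w \<notin> vertices K L" by simp
      then have "\<sigma> w = undefined" "\<sigma>' w = undefined"
        using assms unfolding configs_def by (auto intro: PiE_arb)
      then show ?thesis using notv by simp
    qed simp
  qed
  then have "\<sigma>' = \<sigma>((i, j) := \<sigma>' (i, j))" by (rule ext)
  then show "flip q K L \<sigma> \<sigma>'" using * assms config_value unfolding flip_def by blast
qed

lemma connectivity_flip:
  assumes "flip q K L \<sigma> \<sigma>'"
  shows "connectivity q K L \<sigma> \<sigma>' > 0"
proof -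
  obtain i j y where *: "i < K" "j < L" "y \<in> {1..q}" "y \<noteq> \<sigma> (i, j)" "\<sigma>' = \<sigma>((i, j) := y)"
    using assms by (auto simp: flip_def)
  then have "\<sigma> \<noteq> \<sigma>'" by (metis fun_upd_same)
  moreover have "card (disagreements K L \<sigma> \<sigma>') = 1"
    using assms flip_configs[OF assms] flip_disagreements by blast
  ultimately show ?thesis
    using * by (simp add: connectivity_def connectivity_off_diag_def vertices_def)
qed

lemma flip_if_connectivity:
  assumes "connectivity q K L \<sigma> \<sigma>' > 0" "\<sigma> \<in> configs q K L" "\<sigma>' \<in> configs q K L"
  shows "\<sigma> = \<sigma>' \<or> flip q K L \<sigma> \<sigma>'"
  using assms flip_disagreements[of \<sigma> q K L \<sigma>']
  by (auto simp: connectivity_def connectivity_off_diag_def split: if_splits)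

lemma path_crossing:
  assumes "\<omega> \<in> paths q K L \<sigma> \<tau>" "P \<sigma>" "\<not> P \<tau>"
  obtains \<xi> \<xi>' where "\<xi> \<in> set \<omega>" "\<xi>' \<in> set \<omega>" "P \<xi>" "\<not> P \<xi>'" "flip q K L \<xi> \<xi>'"
proof -
  have \<omega>: "\<omega> \<noteq> []" "set \<omega> \<subseteq> configs q K L" "hd \<omega> = \<sigma>" "last \<omega> = \<tau>"
    "\<And>i. Suc i < length \<omega> \<Longrightarrow> connectivity q K L (\<omega> ! i) (\<omega> ! Suc i) > 0"
    using assms(1) by (auto simp: paths_def)
  have "P (\<omega> ! i)" if "\<And>i. Suc i < length \<omega> \<Longrightarrow> P (\<omega> ! i) \<Longrightarrow> P (\<omega> ! Suc i)" "i < length \<omega>" for i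
    using that(2)
  proof (induction i)
    case 0
    then show ?case using \<omega> assms(2) by (simp add: hd_conv_nth)
  qed (use that(1) in simp)
  from this[of "length \<omega> - 1"] obtain i where i: "Suc i < length \<omega>" "P (\<omega> ! i)" "\<not> P (\<omega> ! Suc i)"
    using \<omega>(1,4) assms(3) by (auto simp: last_conv_nth)
  then have m: "\<omega> ! i \<in> set \<omega>" "\<omega> ! Suc i \<in> set \<omega>" by simp_all
  then have "flip q K L (\<omega> ! i) (\<omega> ! Suc i)"
    using flip_if_connectivity[OF \<omega>(5)[OF i(1)]] \<omega>(2) i by (metis subsetD)
  then show ?thesis using that m i by blast
qed

lemma path_of_flips:
  assumes "(\<lambda>x y. flip q K L x y \<and> P y)\<^sup>*\<^sup>* \<sigma> \<tau>" "\<sigma> \<in> configs q K L" "P \<sigma>"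
  obtains \<omega> where "\<omega> \<in> paths q K L \<sigma> \<tau>" "\<And>\<xi>. \<xi> \<in> set \<omega> \<Longrightarrow> P \<xi>"
proof -
  from assms have "\<exists>\<omega>\<in>paths q K L \<sigma> \<tau>. \<forall>\<xi>\<in>set \<omega>. P \<xi>"
  proof (induction rule: converse_rtranclp_induct)
    case base
    then show ?case by (intro bexI[of _ "[\<tau>]"]) (auto simp: paths_def)
  next
    case (step \<sigma> \<rho>)
    then obtain \<omega> where \<omega>: "\<omega> \<in> paths q K L \<rho> \<tau>" "\<forall>\<xi>\<in>set \<omega>. P \<xi>"
      using flip_configs by blast
    have "connectivity q K L \<sigma> \<rho> > 0" using step.hyps(1) connectivity_flip by blast
    then have "\<sigma> # \<omega> \<in> paths q K L \<sigma> \<tau>"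
      using \<omega>(1) step.prems by (auto simp: paths_def nth_Cons hd_conv_nth split: nat.split)
    then show ?case using \<omega>(2) step.prems by (intro bexI[of _ "\<sigma> # \<omega>"]) auto
  qed
  then show ?thesis using that by blast
qed


lemma paths_iff:
  "\<omega> \<in> paths q K L \<sigma> \<sigma>' \<longleftrightarrow> \<omega> \<noteq> [] \<and> set \<omega> \<subseteq> configs q K L \<and> hd \<omega> = \<sigma> \<and> last \<omega> = \<sigma>' \<and>
     successively (\<lambda>x y. connectivity q K L x y > 0) \<omega>"
  by (auto simp: paths_def successively_conv_nth)

text \<open>
  The configuration where the paths meet is kept only once: the chain need not be able to stay where
  it is.
\<close>

lemma path_append:
  assumes "\<omega> \<in> paths q K L \<sigma> \<rho>" "\<omega>' \<in> paths q K L \<rho> \<tau>"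
  shows "butlast \<omega> @ \<omega>' \<in> paths q K L \<sigma> \<tau>"
proof (cases "butlast \<omega> = []")
  case True
  then have "\<sigma> = \<rho>" using assms(1) by (cases \<omega>) (auto simp: paths_iff split: if_splits)
  with assms(2) True show ?thesis by simp
next
  case False
  have \<omega>: "\<omega> = butlast \<omega> @ [\<rho>]" using assms(1) by (auto simp: paths_iff)
  have "successively (\<lambda>x y. connectivity q K L x y > 0) (butlast \<omega> @ [\<rho>])"
    using assms(1) \<omega> by (simp add: paths_iff)
  then have "successively (\<lambda>x y. connectivity q K L x y > 0) (butlast \<omega> @ \<omega>')"
    using assms(2) False by (auto simp: paths_iff successively_append_iff)
  moreover have "hd (butlast \<omega>) = \<sigma>" using \<omega> False assms(1) by (metis hd_append2 paths_iff)
  moreover have "set (butlast \<omega>) \<subseteq> configs q K L"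
    using assms(1) by (auto simp: paths_iff dest: in_set_butlastD)
  ultimately show ?thesis using assms(2) False by (auto simp: paths_iff)
qed

lemma connectivity_sym:
  assumes "connectivity q K L \<sigma> \<sigma>' > 0"
  shows "connectivity q K L \<sigma>' \<sigma> > 0"
  using assms disagreements_sym[of K L \<sigma> \<sigma>']
  by (auto simp: connectivity_def connectivity_off_diag_def split: if_splits)

lemma path_rev: "\<omega> \<in> paths q K L \<sigma> \<sigma>' \<Longrightarrow> rev \<omega> \<in> paths q K L \<sigma>' \<sigma>"
  using connectivity_sym
  by (auto simp: paths_iff hd_rev last_rev elim!: successively_mono)

lemma finite_path_heights: "finite (path_height K L ` paths q K L \<sigma> \<tau>)"
proof (rule finite_subset)
  show "path_height K L ` paths q K L \<sigma> \<tau> \<subseteq> hamiltonian K L ` configs q K L"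
  proof
    fix h assume "h \<in> path_height K L ` paths q K L \<sigma> \<tau>"
    then obtain \<omega> where \<omega>: "\<omega> \<noteq> []" "set \<omega> \<subseteq> configs q K L" "h = Max (hamiltonian K L ` set \<omega>)"
      by (auto simp: paths_def path_height_def)
    then have "h \<in> hamiltonian K L ` set \<omega>" using Max_in[of "hamiltonian K L ` set \<omega>"] by simp
    then show "h \<in> hamiltonian K L ` configs q K L" using \<omega>(2) by blast
  qed
  show "finite (hamiltonian K L ` configs q K L)"
    by (simp add: configs_def finite_PiE finite_vertices)
qed

lemma path_height_le_iff:
  "\<omega> \<in> paths q K L \<sigma> \<tau> \<Longrightarrow> path_height K L \<omega> \<le> h \<longleftrightarrow> (\<forall>\<xi>\<in>set \<omega>. hamiltonian K L \<xi> \<le> h)"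
  unfolding path_height_def by (subst Max_le_iff) (auto simp: paths_def)

lemma comm_height_le:
  "\<omega> \<in> paths q K L \<sigma> \<tau> \<Longrightarrow> comm_height q K L \<sigma> \<tau> \<le> path_height K L \<omega>"
  unfolding comm_height_def by (intro Min_le finite_path_heights imageI)

context torus
begin

lemma full_update_other: "k \<noteq> j \<Longrightarrow> full (\<sigma>((i, j) := y)) k u \<longleftrightarrow> full \<sigma> k u"
  by (simp add: full_col_def)

lemma not_full_update:
  assumes "i < K" "full \<sigma> j a" "y \<noteq> \<sigma> (i, j)"
  shows "\<not> full (\<sigma>((i, j) := y)) j u"
proof
  assume f: "full (\<sigma>((i, j) := y)) j u"
  have i': "Suc i mod K < K" "Suc i mod K \<noteq> i" using cyclic_neighbours_distinct[of K i] K assms(1) by auto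
  then have "u = a" using full_colD[OF f i'(1)] full_colD[OF assms(2) i'(1)] by simp
  with full_colD[OF f assms(1)] full_colD[OF assms(2,1)] assms(3) show False by simp
qed

lemma full_const: "j < L \<Longrightarrow> full (const_config K L a) j a"
  by (simp add: full_col_def const_config_def)

lemma has_const: "has (const_config K L a) b \<longleftrightarrow> b = a"
proof
  assume "has (const_config K L a) b"
  then obtain j where "j < L" "full (const_config K L a) j b" by (auto simp: has_col_def)
  then show "b = a" using full_unique[OF _ full_const] by simp
next
  assume "b = a"
  moreover have "0 < L" using L by simp
  ultimately show "has (const_config K L a) b" using has_colI[OF _ full_const] by simp
qed

text \<open>
  A flip changes a single column and cannot turn a constant column into another constant one.
\<close>

lemma lose_column:
  assumes d: "dis \<sigma> \<le> 2 * K + 2" and ab: "has \<sigma> a" "has \<sigma> b" "a \<noteq> b"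
    and ij: "i < K" "y \<noteq> \<sigma> (i, j)" and lost: "\<not> has (\<sigma>((i, j) := y)) b"
  shows "full \<sigma> j b" "has (\<sigma>((i, j) := y)) a" "\<And>u. has (\<sigma>((i, j) := y)) u \<Longrightarrow> u = a"
proof -
  let ?\<sigma> = "\<sigma>((i, j) := y)"
  obtain ja jb where j: "ja < L" "full \<sigma> ja a" "jb < L" "full \<sigma> jb b"
    using ab by (auto simp: has_col_def)
  have "jb = j"
  proof (rule ccontr)
    assume "jb \<noteq> j"
    then have "full ?\<sigma> jb b" using j by (simp add: full_update_other)
    with lost j(3) show False by (auto simp: has_col_def)
  qed
  then show b: "full \<sigma> j b" using j by simp
  then have "ja \<noteq> j" using full_unique[OF j(2)] ab(3) by auto
  then have "full ?\<sigma> ja a" using j(2) by (simp add: full_update_other)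
  then show "has ?\<sigma> a" using j by (auto simp: has_col_def)
  fix u assume u: "has ?\<sigma> u"
  then obtain k where k: "k < L" "full ?\<sigma> k u" by (auto simp: has_col_def)
  then have "k \<noteq> j" using not_full_update[OF ij(1) b ij(2)] by auto
  then have "has \<sigma> u" using k full_update_other has_colI by metis
  then have "u = a \<or> u = b" using two_columns_only[OF d ab] by simp
  with u lost show "u = a" by auto
qed

section \<open>The communication height\<close>

text \<open>
  The valley of \<open>t\<close>, formulated by the level \<open>2 K + 2\<close>: that this is the communication height is
  itself a consequence of what follows.
\<close>

definition low :: "nat \<Rightarrow> nat \<Rightarrow> config \<Rightarrow> bool" where
  "low q t \<sigma> \<longleftrightarrow> dis \<sigma> \<le> 2 * K + 1 \<and>
     (\<lambda>x y. flip q K L x y \<and> dis y \<le> 2 * K + 1)\<^sup>*\<^sup>* \<sigma> (const_config K L t)"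

lemma low_flip:
  "flip q K L \<sigma> \<sigma>' \<Longrightarrow> dis \<sigma> \<le> 2 * K + 1 \<Longrightarrow> low q t \<sigma>' \<Longrightarrow> low q t \<sigma>"
  unfolding low_def by (auto intro: converse_rtranclp_into_rtranclp)

text \<open>
  A column next to a column of \<open>t\<close> contains \<open>t\<close> as well, for otherwise every row and that column
  have two changes. It can thus be filled with \<open>t\<close> site by site, each new site having two
  neighbours \<open>t\<close>.
\<close>

lemma low_if_only_colour:
  assumes "\<sigma> \<in> configs q K L" "dis \<sigma> \<le> 2 * K + 1" "has \<sigma> t" "\<And>u. has \<sigma> u \<Longrightarrow> u = t"
  shows "low q t \<sigma>"
  using assms
proof (induction "card {v \<in> vertices K L. \<sigma> v \<noteq> t}" arbitrary: \<sigma> rule: less_induct)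
  case less
  obtain j0 where j0: "j0 < L" "full \<sigma> j0 t" using less.prems(3) by (auto simp: has_col_def)
  show ?case
  proof (cases "\<forall>j<L. full \<sigma> j t")
    case True
    have "\<sigma> v = const_config K L t v" for v
    proof (cases "v \<in> vertices K L")
      case False
      then have "\<sigma> v = undefined" using less.prems(1) unfolding configs_def by (rule PiE_arb[rotated])
      with False show ?thesis by (simp add: const_config_def)
    qed (use True in \<open>auto simp: const_config_def full_col_def vertices_def\<close>)
    then have "\<sigma> = const_config K L t" by (rule ext)
    then show ?thesis using less.prems(2) by (simp add: low_def)
  next
    case False
    then obtain j1 where "j1 < L" "\<not> full \<sigma> j1 t" by blast
    from cyclic_exit[of j0 L "\<lambda>j. full \<sigma> j t" j1, OF j0 this]
    obtain j where j: "j < L" "full \<sigma> j t" "\<not> full \<sigma> (Suc j mod L) t" by blast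
    define c where "c = Suc j mod L"
    have c: "c < L" "c \<noteq> j" "pred_mod L c = j" "\<not> full \<sigma> c t"
      using j cyclic_neighbours_distinct[of L j] L by (auto simp: c_def pred_Suc_mod)
    have nf: "\<not> full \<sigma> c a" for a using c less.prems(4) has_colI by metis
    have "\<exists>i<K. \<sigma> (i, c) = t"
    proof (rule ccontr)
      assume "\<not> ?thesis"
      then have "2 \<le> changes L (\<lambda>j. \<sigma> (i, j))" if "i < K" for i
        using that j c full_colD[OF j(2) that] by (intro changes_row_ge_2[of j c]) auto
      then have "2 * K \<le> (\<Sum>i<K. changes L (\<lambda>j. \<sigma> (i, j)))" by (rule rows_ge)
      moreover have "2 \<le> (\<Sum>j<L. changes K (\<lambda>i. \<sigma> (i, j)))"
        using changes_col_ge_2[of \<sigma> c] nf col_le_sum[OF c(1), of \<sigma>] by auto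
      ultimately show False using less.prems(2) by (simp add: disagree_def)
    qed
    moreover have "\<exists>i<K. \<sigma> (i, c) \<noteq> t" using c(4) by (auto simp: full_col_def)
    ultimately obtain i0 i1 where "i0 < K" "\<sigma> (i0, c) = t" "i1 < K" "\<sigma> (i1, c) \<noteq> t" by blast
    from cyclic_exit[of i0 K "\<lambda>i. \<sigma> (i, c) = t" i1, OF this]
    obtain i where i: "i < K" "\<sigma> (i, c) = t" "\<sigma> (Suc i mod K, c) \<noteq> t" by blast
    define k where "k = Suc i mod K"
    have k: "k < K" "pred_mod K k = i" "\<sigma> (k, c) \<noteq> t" using i by (auto simp: k_def pred_Suc_mod)
    let ?\<sigma> = "\<sigma>((k, c) := t)"
    have "t \<in> {1..q}" using config_value[OF less.prems(1) i(1) c(1)] i(2) by simp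
    then have f: "flip q K L \<sigma> ?\<sigma>" using less.prems(1) k c by (auto simp: flip_def)
    have "2 \<le> nb \<sigma> k c t" using i k c full_colD[OF j(2) k(1)] by (simp add: nbrs_def)
    then have "nb \<sigma> k c (\<sigma> (k, c)) \<le> nb \<sigma> k c t" using nbrs_disjoint[OF k(3), of K L \<sigma> k c] by linarith
    then have "dis ?\<sigma> \<le> dis \<sigma>" using dis_update[OF k(1) c(1), of t \<sigma>] k(3) by simp
    then have d: "dis ?\<sigma> \<le> 2 * K + 1" using less.prems(2) by simp
    have "low q t ?\<sigma>"
    proof (rule less.hyps)
      have "{v \<in> vertices K L. ?\<sigma> v \<noteq> t} \<subset> {v \<in> vertices K L. \<sigma> v \<noteq> t}"
      proof (rule psubsetI)
        have "(k, c) \<in> {v \<in> vertices K L. \<sigma> v \<noteq> t}" "(k, c) \<notin> {v \<in> vertices K L. ?\<sigma> v \<noteq> t}"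
          using k(1,3) c(1) by simp_all
        then show "{v \<in> vertices K L. ?\<sigma> v \<noteq> t} \<noteq> {v \<in> vertices K L. \<sigma> v \<noteq> t}" by blast
      qed auto
      then show "card {v \<in> vertices K L. ?\<sigma> v \<noteq> t} < card {v \<in> vertices K L. \<sigma> v \<noteq> t}"
        by (intro psubset_card_mono) (simp_all add: finite_vertices)
      show "has ?\<sigma> t" using c(2) j(2) by (intro has_colI[OF j(1)]) (simp add: full_update_other)
      fix u assume "has ?\<sigma> u"
      then obtain l where l: "l < L" "full ?\<sigma> l u" by (auto simp: has_col_def)
      show "u = t"
      proof (cases "l = c")
        case True
        with l full_colD[of K ?\<sigma> c u k] k show ?thesis by simp
      next
        case False
        with l have "has \<sigma> u" using full_update_other has_colI by metis
        then show ?thesis by (rule less.prems(4))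
      qed
    qed (use d flip_configs[OF f] in auto)
    then show ?thesis using low_flip[OF f] less.prems(2) by blast
  qed
qed

text \<open>
  Below \<open>2 K + 2\<close> the background \<open>r\<close> can only be left as far as a single column of another colour:
  widening it costs two more bonds.
\<close>

lemma no_low_path:
  assumes \<omega>: "\<omega> \<in> paths q K L (const_config K L r) (const_config K L s)" and "r \<noteq> s"
    and low: "\<And>\<xi>. \<xi> \<in> set \<omega> \<Longrightarrow> dis \<xi> \<le> 2 * K + 1"
  shows False
proof -
  define P where "P = (\<lambda>\<sigma>. has \<sigma> r \<and> ((\<forall>u. has \<sigma> u \<longrightarrow> u = r) \<or>
    (\<exists>u. u \<noteq> r \<and> (\<exists>m<L. full \<sigma> m u \<and> (\<forall>j<L. j \<noteq> m \<longrightarrow> full \<sigma> j r)))))"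
  have "P (const_config K L r)" "\<not> P (const_config K L s)"
    using \<open>r \<noteq> s\<close> by (auto simp: P_def has_const)
  from path_crossing[of \<omega> q K L _ _ P, OF \<omega> this] obtain \<sigma> \<sigma>'
    where \<sigma>: "\<sigma> \<in> set \<omega>" "\<sigma>' \<in> set \<omega>" "P \<sigma>" "\<not> P \<sigma>'" "flip q K L \<sigma> \<sigma>'" by blast
  obtain i j y where ij: "i < K" "j < L" "y \<noteq> \<sigma> (i, j)" "\<sigma>' = \<sigma>((i, j) := y)"
    using \<sigma>(5) by (auto simp: flip_def)
  have d: "dis \<sigma> \<le> 2 * K + 1" "dis \<sigma>' \<le> 2 * K + 1" using low \<sigma> by auto
  have strip: "P \<tau>" if r: "\<And>j. j < L \<Longrightarrow> j \<noteq> m \<Longrightarrow> full \<tau> j r" and m: "m < L" for \<tau> m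
  proof -
    have "Suc m mod L < L" "Suc m mod L \<noteq> m"
      using cyclic_neighbours_distinct(1)[of L m] L m by auto
    then have "has \<tau> r" using r has_colI by metis
    moreover have "full \<tau> m u" if u: "has \<tau> u" "u \<noteq> r" for u
    proof -
      obtain l where l: "l < L" "full \<tau> l u" using u(1) by (auto simp: has_col_def)
      have "l = m" using full_unique[OF l(2) r[OF l(1)]] u(2) by blast
      with l show ?thesis by simp
    qed
    ultimately show ?thesis unfolding P_def using m r by blast
  qed
  have "has \<sigma> r" using \<sigma>(3) by (simp add: P_def)
  show False
  proof (cases "\<forall>u. has \<sigma> u \<longrightarrow> u = r")
    case True
    obtain u where u: "has \<sigma>' u" using no_constant_column(1)[of \<sigma>'] d(2) by fastforce
    have new: "k = j" if "k < L" "full \<sigma>' k u" "u \<noteq> r" for k u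
      using that True full_update_other[of k j \<sigma> i y u] ij(4) has_colI by metis
    show False
    proof (cases "has \<sigma>' r")
      case True
      then obtain u where u: "has \<sigma>' u" "u \<noteq> r" using \<sigma>(4) unfolding P_def by blast
      have "dis \<sigma>' \<le> 2 * K + 2" "dis \<sigma>' \<noteq> 2 * K + 2" using d(2) by simp_all
      with two_columns(3)[of \<sigma>' r u] True u
      have "\<forall>k<L. full \<sigma>' k r \<or> full \<sigma>' k u" by auto
      then show False using new[OF _ _ u(2)] strip[of j \<sigma>'] ij(2) \<sigma>(4) by blast
    next
      case False
      with u obtain k where k: "k < L" "full \<sigma>' k u" "u \<noteq> r" by (auto simp: has_col_def)
      obtain l where l: "l < L" "full \<sigma> l r" using \<open>has \<sigma> r\<close> by (auto simp: has_col_def)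
      then have "l = j" using False full_update_other[of l j \<sigma> i y r] ij(4) has_colI by metis
      with l new[OF k] k not_full_update[OF ij(1), of \<sigma> j r y u] ij(3,4) show False by simp
    qed
  next
    case False
    then obtain u m where um: "u \<noteq> r" "m < L" "full \<sigma> m u" "\<And>j. j < L \<Longrightarrow> j \<noteq> m \<Longrightarrow> full \<sigma> j r"
      using \<sigma>(3) by (auto simp: P_def)
    show False
    proof (cases "j = m")
      case True
      then show False using strip[of m \<sigma>'] um(2,4) full_update_other \<sigma>(4) ij(4) by metis
    next
      case False
      have r: "\<sigma> (i', j') = r" if "i' < K" "j' < L" "j' \<noteq> m" for i' j'
        using full_colD[OF um(4)] that by blast
      have n: "Suc i mod K < K" "pred_mod K i < K" "Suc j mod L < L" "pred_mod L j < L"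
        "Suc j mod L \<noteq> m \<or> pred_mod L j \<noteq> m"
        using ij pred_mod_less[of K i] pred_mod_less[of L j] cyclic_neighbours_distinct[of L j] L by auto
      then have "3 \<le> nb \<sigma> i j r" using ij False unfolding nbrs_def by (auto simp: r)
      moreover have "y \<noteq> r" using ij(3) r[OF ij(1,2) False] by simp
      ultimately have "nb \<sigma> i j y + 2 \<le> nb \<sigma> i j r" using nbrs_disjoint[of r y K L \<sigma> i j] by linarith
      then have "dis \<sigma> + 2 \<le> dis \<sigma>'"
        using dis_update[of i j y \<sigma>] ij r[OF ij(1,2) False] by simp
      moreover have "2 * K \<le> dis \<sigma>"
      proof -
        have "2 \<le> changes L (\<lambda>j. \<sigma> (i, j))" if "i < K" for i
          using r[OF that ij(2) False] full_colD[OF um(3) that] um(1,2) ij(2)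
          by (intro changes_row_ge_2[of j m]) auto
        then have "2 * K \<le> (\<Sum>i<K. changes L (\<lambda>j. \<sigma> (i, j)))" by (rule rows_ge)
        then show ?thesis by (simp add: disagree_def)
      qed
      ultimately show False using d(2) by simp
    qed
  qed
qed

section \<open>A third colour as background\<close>

text \<open>
  The last obstacle: from strips of \<open>r\<close> and \<open>t\<close> a path can pass to configurations whose only
  constant columns have colour \<open>t\<close>. As long as it stays outside the valley of \<open>t\<close> it then has
  exactly \<open>2 K + 2\<close> disagreeing bonds, and this confines the remaining colours to two neighbouring
  columns. Here is what the flips preserve there. Clusters of different colours other than \<open>t\<close>
  do not touch each other; no two consecutive rows are entirely \<open>t\<close>; and the perimeter of \<open>r\<close> keeps its value
  modulo 4. For even \<open>K\<close> this value is 2, so that \<open>r\<close> cannot disappear.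
\<close>

definition trapped :: "nat \<Rightarrow> nat \<Rightarrow> config \<Rightarrow> bool" where
  "trapped t r \<sigma> \<longleftrightarrow>
     (\<exists>c<L. \<forall>i<K. \<forall>j<L. j \<noteq> c \<and> j \<noteq> Suc c mod L \<longrightarrow> \<sigma> (i, j) = t) \<and>
     dis \<sigma> = 2 * K + 2 \<and> (\<forall>u. has \<sigma> u \<longrightarrow> u = t) \<and>
     (\<forall>i<K. \<forall>j<L. \<sigma> (i, j) \<noteq> t \<and> \<sigma> (Suc i mod K, j) \<noteq> t \<longrightarrow> \<sigma> (Suc i mod K, j) = \<sigma> (i, j)) \<and>
     (\<forall>i<K. \<forall>j<L. \<sigma> (i, j) \<noteq> t \<and> \<sigma> (i, Suc j mod L) \<noteq> t \<longrightarrow> \<sigma> (i, Suc j mod L) = \<sigma> (i, j)) \<and>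
     (\<forall>i<K. \<exists>j<L. \<sigma> (i, j) \<noteq> t \<or> \<sigma> (Suc i mod K, j) \<noteq> t) \<and>
     dis (\<lambda>v. \<sigma> v = r) mod 4 = 2"

text \<open>
  A row with other colours costs two horizontal bonds, and so does, vertically, each place where a
  column passes from \<open>t\<close> to another colour. The latter happens below every empty row, and the bound
  \<open>2 K + 2\<close> leaves room for only one more such place. A site \<open>t\<close> with other colours above, below and
  beside it is this place; going upwards from it, neither of the two columns can then ever reach \<open>t\<close>
  before the other one, so that the second column never does.
\<close>

lemma no_notch:
  assumes cd: "c < L" "d < L" "c \<noteq> d"
    and conf: "\<And>i j. i < K \<Longrightarrow> j < L \<Longrightarrow> j \<noteq> c \<Longrightarrow> j \<noteq> d \<Longrightarrow> \<sigma> (i, j) = t"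
    and d: "dis \<sigma> \<le> 2 * K + 2" and only: "\<And>u. has \<sigma> u \<Longrightarrow> u = t"
    and mono: "\<And>i. i < K \<Longrightarrow> \<sigma> (i, d) \<noteq> t \<Longrightarrow> \<sigma> (Suc i mod K, d) \<noteq> t \<Longrightarrow> \<sigma> (Suc i mod K, d) = \<sigma> (i, d)"
    and rows: "\<And>i. i < K \<Longrightarrow> \<exists>j<L. \<sigma> (i, j) \<noteq> t \<or> \<sigma> (Suc i mod K, j) \<noteq> t"
    and notch: "a < K" "\<sigma> (a, c) = t" "\<sigma> (Suc a mod K, c) \<noteq> t" "\<sigma> (pred_mod K a, c) \<noteq> t" "\<sigma> (a, d) \<noteq> t"
  shows False
proof -
  define N where "N = (\<lambda>i j. \<sigma> (i, j) \<noteq> t)"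
  let ?Ec = "entries K (\<lambda>i. N i c)" and ?Ed = "entries K (\<lambda>i. N i d)"
  define S where "S = {i. i < K \<and> (N i c \<or> N i d)}"
  define Emp where "Emp = {..<K} - S"
  have fin: "finite S" "finite Emp" by (simp_all add: S_def Emp_def)
  have "card S + card ?Ec + card ?Ed \<le> K + 1"
  proof -
    obtain e where e: "e < L" "e \<noteq> c" "e \<noteq> d"
      using obtain_third[of L c d] L by auto
    have "2 \<le> changes L (\<lambda>j. \<sigma> (i, j))" if "i \<in> S" for i
    proof -
      have "i < K" "\<sigma> (i, c) \<noteq> t \<or> \<sigma> (i, d) \<noteq> t" using that by (auto simp: S_def N_def)
      then show ?thesis
        using changes_row_ge_2[of c e \<sigma> i] changes_row_ge_2[of d e \<sigma> i] conf[OF _ e] cd e by auto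
    qed
    then have "2 * card S \<le> (\<Sum>i\<in>S. changes L (\<lambda>j. \<sigma> (i, j)))"
      using sum_bounded_below[of S 2 "\<lambda>i. changes L (\<lambda>j. \<sigma> (i, j))"] by (simp add: mult.commute)
    also have "\<dots> \<le> (\<Sum>i<K. changes L (\<lambda>j. \<sigma> (i, j)))"
      by (rule sum_mono2) (auto simp: S_def)
    finally have R: "2 * card S \<le> (\<Sum>i<K. changes L (\<lambda>j. \<sigma> (i, j)))" .
    have "changes K (\<lambda>i. \<sigma> (i, c)) + changes K (\<lambda>i. \<sigma> (i, d)) = (\<Sum>j\<in>{c, d}. changes K (\<lambda>i. \<sigma> (i, j)))"
      using cd by simp
    also have "\<dots> \<le> (\<Sum>j<L. changes K (\<lambda>i. \<sigma> (i, j)))"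
      by (rule sum_mono2) (use cd in auto)
    finally have "2 * card ?Ec + 2 * card ?Ed \<le> (\<Sum>j<L. changes K (\<lambda>i. \<sigma> (i, j)))"
      using changes_ge_entries[of K "\<lambda>i. \<sigma> (i, c)" t] changes_ge_entries[of K "\<lambda>i. \<sigma> (i, d)" t]
      unfolding N_def by linarith
    with R d show ?thesis by (simp add: disagree_def)
  qed
  moreover have "card S \<le> K"
    using card_mono[of "{..<K}" S] by (auto simp: S_def)
  moreover have "card Emp = K - card S"
    unfolding Emp_def by (subst card_Diff_subset[OF fin(1)]) (auto simp: S_def)
  ultimately have le: "card ?Ec + card ?Ed \<le> card Emp + 1" by linarith
  have a: "a \<in> ?Ec" "a \<notin> Emp" using notch by (auto simp: entries_def N_def Emp_def S_def)
  have "Emp \<subseteq> ?Ec \<union> ?Ed"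
  proof
    fix i assume "i \<in> Emp"
    then have i: "i < K" "\<not> N i c" "\<not> N i d" by (auto simp: Emp_def S_def)
    obtain j where j: "j < L" "\<sigma> (i, j) \<noteq> t \<or> \<sigma> (Suc i mod K, j) \<noteq> t" using rows[OF i(1)] by blast
    have "j = c \<or> j = d" using conf[OF i(1) j(1)] conf[OF Suc_mod_less[OF i(1)] j(1)] j(2) by blast
    with i j show "i \<in> ?Ec \<union> ?Ed" by (auto simp: entries_def N_def)
  qed
  with a have sub: "insert a Emp \<subseteq> ?Ec \<union> ?Ed" by simp
  have ci: "card (insert a Emp) = card Emp + 1" using a fin by simp
  have cu: "card (?Ec \<union> ?Ed) + card (?Ec \<inter> ?Ed) = card ?Ec + card ?Ed"
    by (rule card_Un_Int[symmetric]) (rule finite_entries)+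
  have "card (insert a Emp) \<le> card (?Ec \<union> ?Ed)"
    using sub by (intro card_mono) (auto simp: finite_entries)
  with ci cu le have z: "card (?Ec \<inter> ?Ed) = 0" "card (?Ec \<union> ?Ed) \<le> card (insert a Emp)" by linarith+
  then have disj: "?Ec \<inter> ?Ed = {}" by (simp add: finite_entries)
  have eq: "insert a Emp = ?Ec \<union> ?Ed"
    using sub z(2) by (intro card_seteq) (auto simp: finite_entries)
  define P where "P = (\<lambda>i. N i d \<and> (N i c \<or> i = a))"
  have "P i" if "i < K" for i
  proof (rule cyclic_induct_down[of a K P i])
    show "P a" using notch by (simp add: P_def N_def)
    fix i assume i: "i < K" "P i"
    define k where "k = pred_mod K i"
    have k: "k < K" "Suc k mod K = i" using i pred_mod_less[of K i] by (auto simp: k_def Suc_pred_mod)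
    have E: "k = a \<or> (\<not> N k c \<and> \<not> N k d)" if "k \<in> ?Ec \<union> ?Ed"
    proof -
      have "k \<in> insert a Emp" using that eq by simp
      then show ?thesis using k by (auto simp: Emp_def S_def)
    qed
    show "P (pred_mod K i)" unfolding k_def[symmetric]
    proof (cases "i = a")
      case True
      then have "N k c" using notch by (simp add: N_def k_def)
      moreover have "N k d"
      proof (rule ccontr)
        assume "\<not> N k d"
        then have "k \<in> ?Ed" using k i by (simp add: entries_def P_def)
        then have "k = a" using E \<open>N k c\<close> by blast
        then show False using \<open>N k c\<close> notch by (simp add: N_def)
      qed
      ultimately show "P k" by (simp add: P_def)
    next
      case False
      then have N: "N i c" "N i d" using i by (auto simp: P_def)
      have "N k d"
      proof (rule ccontr)
        assume "\<not> N k d"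
        then have *: "k \<in> ?Ed" using k N by (simp add: entries_def)
        then have "\<not> N k c" using E notch \<open>\<not> N k d\<close> by (auto simp: N_def)
        then have "k \<in> ?Ec" using k N by (simp add: entries_def)
        with * disj show False by blast
      qed
      moreover have "k = a" if "\<not> N k c"
      proof -
        have "k \<in> ?Ec" using that k N by (simp add: entries_def)
        with E \<open>N k d\<close> show ?thesis by blast
      qed
      ultimately show "P k" by (auto simp: P_def)
    qed
  qed (use notch that in auto)
  then have Nd: "\<sigma> (i, d) \<noteq> t" if "i < K" for i using that by (simp add: P_def N_def)
  have "0 < K" using K by simp
  have "\<sigma> (i, d) = \<sigma> (0, d)" if "i < K" for i
  proof (rule cyclic_induct[of 0 K "\<lambda>i. \<sigma> (i, d) = \<sigma> (0, d)" i])
    fix k assume "k < K" "\<sigma> (k, d) = \<sigma> (0, d)"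
    then show "\<sigma> (Suc k mod K, d) = \<sigma> (0, d)"
      using mono[of k] Nd[of k] Nd[of "Suc k mod K"] Suc_mod_less[of k K] by metis
  qed (fact that refl \<open>0 < K\<close>)+
  then have "full \<sigma> d (\<sigma> (0, d))" unfolding full_col_def by blast
  then have "\<sigma> (0, d) = t" by (rule only[OF has_colI[OF cd(2)]])
  with Nd[OF \<open>0 < K\<close>] show False by blast
qed


lemma trappedI:
  assumes c: "c < L" and out: "\<And>i j. i < K \<Longrightarrow> j < L \<Longrightarrow> j \<noteq> c \<Longrightarrow> j \<noteq> Suc c mod L \<Longrightarrow> \<sigma> (i, j) = t"
    and d: "dis \<sigma> = 2 * K + 2" and only: "\<And>u. has \<sigma> u \<Longrightarrow> u = t"
    and vert: "\<And>i j. i < K \<Longrightarrow> j < L \<Longrightarrow> \<sigma> (i, j) \<noteq> t \<Longrightarrow> \<sigma> (Suc i mod K, j) \<noteq> t \<Longrightarrow> \<sigma> (Suc i mod K, j) = \<sigma> (i, j)"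
    and horiz: "\<And>i j. i < K \<Longrightarrow> j < L \<Longrightarrow> \<sigma> (i, j) \<noteq> t \<Longrightarrow> \<sigma> (i, Suc j mod L) \<noteq> t \<Longrightarrow> \<sigma> (i, Suc j mod L) = \<sigma> (i, j)"
    and rows: "\<And>i. i < K \<Longrightarrow> \<exists>j<L. \<sigma> (i, j) \<noteq> t \<or> \<sigma> (Suc i mod K, j) \<noteq> t"
    and per: "dis (\<lambda>v. \<sigma> v = r) mod 4 = 2"
  shows "trapped t r \<sigma>"
  unfolding trapped_def
proof (intro conjI)
  show "\<exists>c<L. \<forall>i<K. \<forall>j<L. j \<noteq> c \<and> j \<noteq> Suc c mod L \<longrightarrow> \<sigma> (i, j) = t"
    using c out by (intro exI[of _ c]) simp
  show "\<forall>i<K. \<exists>j<L. \<sigma> (i, j) \<noteq> t \<or> \<sigma> (Suc i mod K, j) \<noteq> t" using rows by blast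
  show "\<forall>i<K. \<forall>j<L. \<sigma> (i, j) \<noteq> t \<and> \<sigma> (Suc i mod K, j) \<noteq> t \<longrightarrow> \<sigma> (Suc i mod K, j) = \<sigma> (i, j)"
    by (intro allI impI) (elim conjE, rule vert)
  show "\<forall>i<K. \<forall>j<L. \<sigma> (i, j) \<noteq> t \<and> \<sigma> (i, Suc j mod L) \<noteq> t \<longrightarrow> \<sigma> (i, Suc j mod L) = \<sigma> (i, j)"
    by (intro allI impI) (elim conjE, rule horiz)
  show "\<forall>u. has \<sigma> u \<longrightarrow> u = t" using only by simp
qed (fact d per)+

text \<open>
  Here \<open>A\<close>, \<open>B\<close>, \<open>C\<close> and \<open>t\<close> are the colours of the four neighbours of a site whose colour \<open>x\<close> is
  replaced by \<open>y\<close> without changing the number of disagreeing bonds. The assumptions exclude flips with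
  exactly one neighbour of either colour, which would change the perimeter of a colour by 2.
\<close>

lemma balanced_flip:
  fixes x y t A B C :: 'a
  defines "n \<equiv> \<lambda>z. of_bool (A = z) + of_bool (B = z) + of_bool (C = z) + of_bool (t = z) :: nat"
  assumes "y \<noteq> x" "x \<noteq> t \<Longrightarrow> A \<noteq> t \<Longrightarrow> A = x" "x \<noteq> t \<Longrightarrow> B \<noteq> t \<Longrightarrow> B = x" "x \<noteq> t \<Longrightarrow> C \<noteq> t \<Longrightarrow> C = x"
    and "\<not> (x = t \<and> A \<noteq> t \<and> B \<noteq> t \<and> C \<noteq> t)" and "n y = n x"
  shows "(x \<noteq> t \<and> y \<noteq> t \<and> A = t \<and> B = t \<and> C = t) \<or> (y = t \<and> x \<noteq> t \<and> n x = 2 \<and> n t = 2) \<or>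
    (x = t \<and> y \<noteq> t \<and> n y = 2 \<and> n t = 2)"
proof (cases "x = t")
  case True
  then show ?thesis using assms
    by (cases "A = t"; cases "B = t"; cases "C = t") (auto simp: of_bool_def split: if_splits)
next
  case False
  then have "A = t \<or> A = x" "B = t \<or> B = x" "C = t \<or> C = x" using assms(3-5) by blast+
  then show ?thesis using assms(2,7) False unfolding n_def
    by (elim disjE) (cases "y = t"; simp)+
qed

text \<open>
  An isolated site that is recoloured changes the perimeter of \<open>r\<close> by 0 or 4, and a site with two
  neighbours of each of the colours involved leaves it unchanged.
\<close>

lemma trapped_step:
  assumes tr: "trapped t r \<sigma>" and "t \<noteq> r" and f: "flip q K L \<sigma> \<sigma>'" and d': "dis \<sigma>' \<le> 2 * K + 2"
    and nlow: "\<not> low q t \<sigma>'"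
  shows "trapped t r \<sigma>' \<or> (has \<sigma>' t \<and> has \<sigma>' r)"
proof -
  obtain c where c: "c < L" and conf0: "\<forall>i<K. \<forall>j<L. j \<noteq> c \<and> j \<noteq> Suc c mod L \<longrightarrow> \<sigma> (i, j) = t"
    using tr unfolding trapped_def by (elim conjE exE) rule
  have conf: "\<sigma> (i, j) = t" if "i < K" "j < L" "j \<noteq> c" "j \<noteq> Suc c mod L" for i j
    using conf0 that by simp
  note tr' = tr[unfolded trapped_def, THEN conjunct2]
  note d = tr'[THEN conjunct1] and only0 = tr'[THEN conjunct2, THEN conjunct1]
  note rest = tr'[THEN conjunct2, THEN conjunct2]
  have only: "u = t" if "has \<sigma> u" for u using only0 that by simp
  have vert: "\<sigma> (Suc i mod K, j) = \<sigma> (i, j)"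
    if "i < K" "j < L" "\<sigma> (i, j) \<noteq> t" "\<sigma> (Suc i mod K, j) \<noteq> t" for i j
    using rest[THEN conjunct1, rule_format, of i j] that by simp
  have horiz: "\<sigma> (i, Suc j mod L) = \<sigma> (i, j)"
    if "i < K" "j < L" "\<sigma> (i, j) \<noteq> t" "\<sigma> (i, Suc j mod L) \<noteq> t" for i j
    using rest[THEN conjunct2, THEN conjunct1, rule_format, of i j] that by simp
  have rows: "\<exists>j<L. \<sigma> (i, j) \<noteq> t \<or> \<sigma> (Suc i mod K, j) \<noteq> t" if "i < K" for i
    using rest[THEN conjunct2, THEN conjunct2, THEN conjunct1, rule_format, OF that] .
  note per = rest[THEN conjunct2, THEN conjunct2, THEN conjunct2]
  obtain i j y where ij: "i < K" "j < L" "y \<noteq> \<sigma> (i, j)" "\<sigma>' = \<sigma>((i, j) := y)"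
    using f by (auto simp: flip_def)
  let ?x = "\<sigma> (i, j)"
  have upd: "dis \<sigma>' + nb \<sigma> i j y = dis \<sigma> + nb \<sigma> i j ?x"
    using dis_update[of i j y \<sigma>] ij by simp
  define up dn where "up = Suc i mod K" and "dn = pred_mod K i"
  have ud: "up < K" "dn < K" "up \<noteq> i" "dn \<noteq> i" "Suc dn mod K = i"
    using ij(1) K cyclic_neighbours_distinct[of K i] pred_mod_less[of K i] Suc_pred_mod[of i K]
    by (auto simp: up_def dn_def)
  have lr: "Suc j mod L < L" "pred_mod L j < L" "Suc j mod L \<noteq> j" "pred_mod L j \<noteq> j" "Suc (pred_mod L j) mod L = j"
    using ij(2) L cyclic_neighbours_distinct[of L j] pred_mod_less[of L j] Suc_pred_mod[of j L] by auto

  \<comment> \<open>The flipped site lies in the two columns: elsewhere at least three neighbours are \<open>t\<close>.\<close>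
  have jc: "j = c \<or> j = Suc c mod L"
  proof (rule ccontr)
    assume n: "\<not> ?thesis"
    then have x: "?x = t" using conf ij by blast
    have "\<sigma> (up, j) = t" "\<sigma> (dn, j) = t" using conf ud ij(2) n by blast+
    moreover have "Suc j mod L \<noteq> c \<and> Suc j mod L \<noteq> Suc c mod L \<or> pred_mod L j \<noteq> c \<and> pred_mod L j \<noteq> Suc c mod L"
      using n c ij(2) L by (auto simp: Suc_mod_if pred_mod_if split: if_splits)
    then have "\<sigma> (i, Suc j mod L) = t \<or> \<sigma> (i, pred_mod L j) = t" using conf ij(1) lr by blast
    ultimately have "3 \<le> nb \<sigma> i j t" by (auto simp: nbrs_def up_def dn_def)
    then have "nb \<sigma> i j y + 2 \<le> nb \<sigma> i j t" using nbrs_disjoint[of t y K L \<sigma> i j] x ij(3) by simp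
    then show False using upd d d' x by simp
  qed
  \<comment> \<open>Of its horizontal neighbours one is \<open>t\<close>; the other one lies in the second column \<open>e\<close>.\<close>
  obtain e where e: "e < L" "e \<noteq> j" and conf': "\<And>i k. i < K \<Longrightarrow> k < L \<Longrightarrow> k \<noteq> j \<Longrightarrow> k \<noteq> e \<Longrightarrow> \<sigma> (i, k) = t"
    and nbe: "\<And>z. nb \<sigma> i j z = of_bool (\<sigma> (up, j) = z) + of_bool (\<sigma> (dn, j) = z) + of_bool (\<sigma> (i, e) = z) + of_bool (t = z)"
    and he: "?x \<noteq> t \<Longrightarrow> \<sigma> (i, e) \<noteq> t \<Longrightarrow> \<sigma> (i, e) = ?x"
    and ho: "{\<sigma> (i, Suc j mod L), \<sigma> (i, pred_mod L j)} = {t, \<sigma> (i, e)}"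
  proof (cases "j = c")
    case True
    have "\<sigma> (i, pred_mod L j) = t"
      using lr cyclic_neighbours_distinct[of L j] L ij(2) True by (intro conf[OF ij(1)]) auto
    then show ?thesis
      using lr horiz[OF ij(1,2)] conf True
      by (intro that[of "Suc j mod L"]) (auto simp: nbrs_def up_def dn_def)
  next
    case False
    then have j: "j = Suc c mod L" using jc by simp
    then have pj: "pred_mod L j = c" using c by (simp add: pred_Suc_mod)
    have "\<sigma> (i, Suc j mod L) = t"
      using lr cyclic_neighbours_distinct[of L j] L ij(2) pj j by (intro conf[OF ij(1)]) auto
    moreover have "\<sigma> (i, c) = ?x" if "?x \<noteq> t" "\<sigma> (i, c) \<noteq> t"
      using horiz[OF ij(1) c that(2)] that(1) j by simp
    ultimately show ?thesis
      using lr conf c False j pj by (intro that[of c]) (auto simp: nbrs_def up_def dn_def)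
  qed
  have hu: "\<sigma> (up, j) = ?x" if "?x \<noteq> t" "\<sigma> (up, j) \<noteq> t"
    using vert[OF ij(1,2)] that by (simp add: up_def)
  have hd: "\<sigma> (dn, j) = ?x" if "?x \<noteq> t" "\<sigma> (dn, j) \<noteq> t"
    using vert[OF ud(2) ij(2)] that ud(5) by simp
  have hast: "has \<sigma>' t"
  proof -
    obtain k where k: "k < L" "k \<noteq> j" "k \<noteq> e"
      using obtain_third[of L j e] L by auto
    then have "full \<sigma>' k t" using conf' unfolding ij(4) by (simp add: full_col_def)
    then show ?thesis by (rule has_colI[OF k(1)])
  qed
  show ?thesis
  proof (cases "\<forall>u. has \<sigma>' u \<longrightarrow> u = t")
    case False
    \<comment> \<open>A constant column of another colour appears; all other sites are then \<open>t\<close> or of this colour.\<close>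
    then obtain u where u: "has \<sigma>' u" "u \<noteq> t" by blast
    then obtain k where k: "k < L" "full \<sigma>' k u" by (auto simp: has_col_def)
    have "k = j"
    proof (rule ccontr)
      assume "k \<noteq> j"
      then have "full \<sigma> k u" using k(2) unfolding ij(4) by (simp add: full_update_other)
      then have "u = t" by (rule only[OF has_colI[OF k(1)]])
      with u show False by simp
    qed
    then have "y = u" "\<sigma> (up, j) = u"
      using full_colD[OF k(2) ij(1)] full_colD[OF k(2) ud(1)] ij(4) ud(3) by simp_all
    then have x: "?x = t" using hu ij(3) u(2) by auto
    show ?thesis
    proof (cases "u = r")
      case False
      have val: "\<sigma>' (k, l) = t \<or> \<sigma>' (k, l) = u" if "k < K" "l < L" for k l
        using two_columns(2)[OF d' hast u(1)] u(2) that by auto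
      have "\<sigma> v \<noteq> r" if "v \<in> vertices K L" for v
      proof (cases "v = (i, j)")
        case False
        obtain k l where "v = (k, l)" by (cases v)
        with False that val[of k l] \<open>u \<noteq> r\<close> \<open>t \<noteq> r\<close> ij(4) show ?thesis by auto
      qed (use x \<open>t \<noteq> r\<close> in simp)
      then have "dis (\<lambda>v. \<sigma> v = r) = dis (\<lambda>v. False)" by (intro disagree_cong) simp
      also have "\<dots> = 0" by (simp add: disagree_def changes_def)
      finally show ?thesis using per by simp
    qed (use hast u in simp)
  next
    case True
    have d2: "dis \<sigma>' = 2 * K + 2"
    proof (rule ccontr)
      assume "\<not> ?thesis"
      then have "dis \<sigma>' \<le> 2 * K + 1" using d' by simp
      then have "low q t \<sigma>'" using low_if_only_colour[of \<sigma>' q t] hast True flip_configs[OF f] by blast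
      with nlow show False by simp
    qed
    have eq: "nb \<sigma> i j y = nb \<sigma> i j ?x" using upd d d2 by simp
    have notch: "\<not> (?x = t \<and> \<sigma> (up, j) \<noteq> t \<and> \<sigma> (dn, j) \<noteq> t \<and> \<sigma> (i, e) \<noteq> t)"
    proof
      assume n: "?x = t \<and> \<sigma> (up, j) \<noteq> t \<and> \<sigma> (dn, j) \<noteq> t \<and> \<sigma> (i, e) \<noteq> t"
      show False
      proof (rule no_notch[of j e \<sigma> t i])
        show "dis \<sigma> \<le> 2 * K + 2" using d by simp
        show "\<sigma> (Suc k mod K, e) = \<sigma> (k, e)" if "k < K" "\<sigma> (k, e) \<noteq> t" "\<sigma> (Suc k mod K, e) \<noteq> t" for k
          using vert[OF that(1) e(1) that(2,3)] .
        show "\<exists>l<L. \<sigma> (k, l) \<noteq> t \<or> \<sigma> (Suc k mod K, l) \<noteq> t" if "k < K" for k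
          using rows[OF that] .
      qed (use n e(2) in \<open>simp_all add: up_def dn_def ij(1,2) e(1) conf' only\<close>)
    qed
    \<comment> \<open>Either the site is isolated, or two of its neighbours have the old and two the new colour.\<close>
    have key: "(?x \<noteq> t \<and> y \<noteq> t \<and> \<sigma> (up, j) = t \<and> \<sigma> (dn, j) = t \<and> \<sigma> (i, e) = t) \<or>
        (y = t \<and> ?x \<noteq> t \<and> nb \<sigma> i j ?x = 2 \<and> nb \<sigma> i j t = 2) \<or>
        (?x = t \<and> y \<noteq> t \<and> nb \<sigma> i j y = 2 \<and> nb \<sigma> i j t = 2)"
      unfolding nbe by (rule balanced_flip[OF ij(3) hu hd he notch eq[unfolded nbe]])
    have around: "\<sigma> (up, j) \<in> {t, y} \<and> \<sigma> (dn, j) \<in> {t, y} \<and> \<sigma> (i, e) \<in> {t, y}" if "y \<noteq> t"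
      using key that unfolding nbe by (auto simp: of_bool_def split: if_splits)
    have some: "\<sigma> (up, j) \<noteq> t \<or> \<sigma> (i, e) \<noteq> t" "\<sigma> (dn, j) \<noteq> t \<or> \<sigma> (i, e) \<noteq> t" if "y = t"
      using key that unfolding nbe by (auto simp: of_bool_def split: if_splits)
    have side: "\<sigma> (i, Suc j mod L) \<in> {t, y} \<and> \<sigma> (i, pred_mod L j) \<in> {t, y}" if "y \<noteq> t"
      using around[OF that] ho by (metis insertI1 insertI2 insert_iff singletonD)
    have out: "\<sigma>' (k, l) = t" if "k < K" "l < L" "l \<noteq> c" "l \<noteq> Suc c mod L" for k l
      using conf[OF that] jc that ij(4) by auto
    have vert': "\<sigma>' (Suc k mod K, l) = \<sigma>' (k, l)"
      if kl: "k < K" "l < L" "\<sigma>' (k, l) \<noteq> t" "\<sigma>' (Suc k mod K, l) \<noteq> t" for k l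
    proof (cases "l = j")
      case True
      consider "k = i" | "k = dn" | "k \<noteq> i" "Suc k mod K \<noteq> i"
        using Suc_mod_eq_iff[OF ij(1) kl(1)] by (auto simp: dn_def)
      then show ?thesis
      proof cases
        case 1
        have "Suc k mod K = up" by (simp add: 1 up_def)
        then show ?thesis using kl(3,4) True 1 ij(4) around ud(3) by auto
      next
        case 2
        have "Suc k mod K = i" by (simp add: 2 ud)
        then show ?thesis using kl(3,4) True 2 ij(4) around ud(4) by auto
      next
        case 3
        then show ?thesis using kl(3,4) True ij(4) vert[OF kl(1,2)] by simp
      qed
    qed (use vert[OF kl(1,2)] kl ij(4) in auto)
    have horiz': "\<sigma>' (k, Suc l mod L) = \<sigma>' (k, l)"
      if kl: "k < K" "l < L" "\<sigma>' (k, l) \<noteq> t" "\<sigma>' (k, Suc l mod L) \<noteq> t" for k l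
    proof (cases "k = i")
      case True
      consider "l = j" | "l = pred_mod L j" | "l \<noteq> j" "Suc l mod L \<noteq> j"
        using Suc_mod_eq_iff[OF ij(2) kl(2)] by auto
      then show ?thesis
      proof cases
        case 1
        then show ?thesis using kl(3,4) True ij(4) side lr(3) by auto
      next
        case 2
        have "Suc l mod L = j" by (simp add: 2 lr)
        then show ?thesis using kl(3,4) True 2 ij(4) side lr(4) by auto
      next
        case 3
        then show ?thesis using kl(3,4) True ij(4) horiz[OF kl(1,2)] by simp
      qed
    qed (use horiz[OF kl(1,2)] kl ij(4) in auto)
    have rows': "\<exists>l<L. \<sigma>' (k, l) \<noteq> t \<or> \<sigma>' (Suc k mod K, l) \<noteq> t" if k: "k < K" for k
    proof -
      obtain l where l: "l < L" "\<sigma> (k, l) \<noteq> t \<or> \<sigma> (Suc k mod K, l) \<noteq> t" using rows[OF k] by blast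
      show ?thesis
      proof (cases "y = t \<and> (k = i \<or> Suc k mod K = i)")
        case False
        then show ?thesis using l ij(4) by (intro exI[of _ l]) auto
      next
        case True
        then have "k = i \<or> k = dn" using Suc_mod_eq_iff[OF ij(1) k] by (auto simp: dn_def)
        then have "\<sigma> (if k = i then up else dn, j) \<noteq> t \<or> \<sigma> (i, e) \<noteq> t" using some True by auto
        then show ?thesis
        proof
          assume "\<sigma> (if k = i then up else dn, j) \<noteq> t"
          then show ?thesis
            using \<open>k = i \<or> k = dn\<close> ij(2,4) ud by (intro exI[of _ j]) (auto simp: up_def[symmetric])
        next
          assume "\<sigma> (i, e) \<noteq> t"
          then show ?thesis
            using \<open>k = i \<or> k = dn\<close> e ij(4) ud by (intro exI[of _ e]) auto
        qed
      qed
    qed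
    have per': "dis (\<lambda>v. \<sigma>' v = r) mod 4 = 2"
    proof (cases "?x = r \<longleftrightarrow> y = r")
      case True
      then have "(\<lambda>v. \<sigma>' v = r) = (\<lambda>v. \<sigma> v = r)" using ij(4) by (simp add: fun_eq_iff)
      then show ?thesis using per by simp
    next
      case False
      let ?f = "\<lambda>v. \<sigma> v = r"
      have "(\<lambda>v. \<sigma>' v = r) = ?f((i, j) := (y = r))" using ij(4) by (simp add: fun_eq_iff)
      then have "dis (\<lambda>v. \<sigma>' v = r) + nb ?f i j (y = r) = dis ?f + nb ?f i j (?x = r)"
        using dis_update[of i j "y = r" ?f] ij(1,2) False by simp
      moreover have "nb ?f i j True = nb \<sigma> i j r" "nb ?f i j False = 4 - nb \<sigma> i j r"
        by (auto simp: nbrs_def)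
      moreover have "nb \<sigma> i j r = 0 \<or> nb \<sigma> i j r = 2"
        using key
      proof (elim disjE)
        assume "?x \<noteq> t \<and> y \<noteq> t \<and> \<sigma> (up, j) = t \<and> \<sigma> (dn, j) = t \<and> \<sigma> (i, e) = t"
        then show ?thesis using \<open>t \<noteq> r\<close> unfolding nbe by auto
      qed (use False \<open>t \<noteq> r\<close> in auto)
      ultimately have "dis (\<lambda>v. \<sigma>' v = r) = dis ?f \<or> dis (\<lambda>v. \<sigma>' v = r) = dis ?f + 4 \<or>
          dis (\<lambda>v. \<sigma>' v = r) + 4 = dis ?f"
        using False by (cases "y = r") auto
      moreover have "m mod 4 = n mod 4" if "m = n \<or> m = n + 4 \<or> m + 4 = n" for m n :: nat
        using that by auto
      ultimately show ?thesis using per by metis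
    qed
    have "trapped t r \<sigma>'"
      using True by (intro trappedI[OF c out d2 _ vert' horiz' rows' per']) simp_all
    then show ?thesis ..
  qed
qed

text \<open>
  When the last column of \<open>b\<close> is lost without exceeding \<open>2 K + 2\<close>, the site lost has two neighbours
  of each colour: it is not next to the bar.
\<close>

lemma lose_last_column:
  assumes d: "dis \<sigma> \<le> 2 * K + 2" and ab: "has \<sigma> a" "has \<sigma> b" "a \<noteq> b"
    and ij: "i < K" "j < L" "y \<noteq> \<sigma> (i, j)" and lost: "\<not> has (\<sigma>((i, j) := y)) b"
    and d': "dis (\<sigma>((i, j) := y)) \<le> 2 * K + 2"
  obtains (strip) "dis \<sigma> = 2 * K" "cells K L \<sigma> b = columns {j}"
    | (bar) k h c where "dis \<sigma> = 2 * K + 2" "dis (\<sigma>((i, j) := y)) = 2 * K + 2"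
      "k < K" "1 \<le> h" "h < K" "c < L" "c \<noteq> j" "c = Suc j mod L \<or> c = pred_mod L j"
      "cells K L \<sigma> b = columns {j} \<union> arc K k h \<times> {c}" "y = a" "i \<notin> arc K k h"
proof -
  have j: "full \<sigma> j b" using lose_column(1)[OF d ab ij(1,3) lost] .
  have single: "m = 1 \<and> p = j" if "p < L" "1 \<le> m" "m < L" "{j. j < L \<and> full \<sigma> j b} = arc L p m" for p m
  proof -
    have kj: "k = j" if "k < L" "full \<sigma> k b" for k
    proof (rule ccontr)
      assume "k \<noteq> j"
      then have "full (\<sigma>((i, j) := y)) k b" using that(2) by (simp add: full_update_other)
      then have "has (\<sigma>((i, j) := y)) b" by (rule has_colI[OF that(1)])
      with lost show False by simp
    qed
    have "{k. k < L \<and> full \<sigma> k b} = {j}"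
    proof (intro equalityI subsetI)
      fix k assume "k \<in> {k. k < L \<and> full \<sigma> k b}"
      then have "k < L" "full \<sigma> k b" by simp_all
      from kj[OF this] show "k \<in> {j}" by simp
    qed (use j ij(2) in simp)
    then have "arc L p m = {j}" unfolding that(4) .
    moreover have "card (arc L p m) = m" using that by (intro card_arc) simp
    ultimately have "m = 1" by simp
    with \<open>arc L p m = {j}\<close> \<open>p < L\<close> show ?thesis by (simp add: arc_1 del: One_nat_def)
  qed
  show ?thesis
    using d ab
  proof (cases rule: strip_shape)
    case (strip p m)
    then show ?thesis using single[of p m] that(1) by (simp add: arc_1 del: One_nat_def)
  next
    case (bar p m k h c)
    have pm: "m = 1" "p = j" using single bar by blast+
    have cells: "cells K L \<sigma> b = columns {j} \<union> arc K k h \<times> {c}"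
      using bar(12) pm ij(2) by (simp add: arc_1 del: One_nat_def)
    have "arc L p m = {j}" using pm ij(2) by (simp add: arc_1 del: One_nat_def)
    then have cj: "c \<noteq> j" "c = Suc j mod L \<or> c = pred_mod L j"
      using bar(10,11) pm by auto
    have x: "\<sigma> (i, j) = b" using j ij(1) by (rule full_colD)
    have upd: "dis (\<sigma>((i, j) := y)) + nb \<sigma> i j y = dis \<sigma> + nb \<sigma> i j b"
      using dis_update[of i j y \<sigma>] ij x by simp
    have v: "\<sigma> (Suc i mod K, j) = b" "\<sigma> (pred_mod K i, j) = b"
      using full_colD[OF j] ij(1) pred_mod_less[of K i] by auto
    have le: "nb \<sigma> i j b \<le> nb \<sigma> i j y" using upd d' bar(5) by simp
    have yb: "y \<noteq> b" using ij(3) x by simp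
    have h: "\<sigma> (i, Suc j mod L) = y" "\<sigma> (i, pred_mod L j) = y"
      using le v yb by (auto simp: nbrs_def of_bool_def split: if_splits)
    have "y = a" using h two_columns(2)[OF d ab ij(1), of "Suc j mod L"] ij(2) yb by auto
    moreover have "nb \<sigma> i j b = nb \<sigma> i j y" using v h yb by (simp add: nbrs_def)
    then have "dis (\<sigma>((i, j) := y)) = 2 * K + 2" using upd bar(5) by simp
    moreover have "i \<notin> arc K k h"
    proof
      assume "i \<in> arc K k h"
      then have "(i, c) \<in> cells K L \<sigma> b" unfolding cells by simp
      then have "\<sigma> (i, c) = b" by (simp add: cells_def)
      with h cj yb show False by auto
    qed
    ultimately show ?thesis using that(2)[of k h c] bar cells cj by blast
  qed
qed

text \<open>
  At the moment when the last column of \<open>r\<close> is broken, \<open>r\<close> and \<open>t\<close> are the only colours, so that the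
  perimeter of \<open>r\<close> is \<open>2 K + 2\<close>. This is 2 modulo 4 because \<open>K\<close> is even.
\<close>

lemma trapped_enter:
  assumes \<sigma>: "\<sigma> \<in> configs q K L" and "even K" and d: "dis \<sigma> \<le> 2 * K + 2"
    and tr: "has \<sigma> t" "has \<sigma> r" "t \<noteq> r"
    and ij: "i < K" "j < L" "y \<noteq> \<sigma> (i, j)" and lost: "\<not> has (\<sigma>((i, j) := y)) r"
    and d': "dis (\<sigma>((i, j) := y)) \<le> 2 * K + 2" and nlow: "\<not> low q t \<sigma>"
  shows "trapped t r (\<sigma>((i, j) := y))"
  using d tr ij lost d'
proof (cases rule: lose_last_column)
  case strip
  \<comment> \<open>A single column of \<open>r\<close> lies in the valley of \<open>t\<close>: it can be emptied site by site.\<close>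
  have full: "full \<sigma> l (if l = j then r else t)" if "l < L" for l
  proof -
    have "\<sigma> (k, l) = (if l = j then r else t)" if "k < K" for k
    proof -
      have "(k, l) \<in> cells K L \<sigma> r \<longleftrightarrow> l = j" using \<open>k < K\<close> strip(2) by (auto simp: columns_def)
      then show ?thesis using two_columns(2)[OF d tr that \<open>l < L\<close>] that \<open>l < L\<close> by (auto simp: cells_def)
    qed
    then show ?thesis by (simp add: full_col_def)
  qed
  have r: "\<sigma> (k, j) = r" if "k < K" for k using full_colD[OF full[OF ij(2)] that] by simp
  have other: "\<sigma> (k, l) = t" if "k < K" "l < L" "l \<noteq> j" for k l
    using full_colD[OF full[OF that(2)] that(1)] that(3) by simp
  let ?\<sigma> = "\<sigma>((i, j) := t)"
  have lr: "Suc j mod L < L" "pred_mod L j < L" "Suc j mod L \<noteq> j" "pred_mod L j \<noteq> j"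
    using ij(2) L cyclic_neighbours_distinct[of L j] pred_mod_less[of L j] by auto
  have "nb \<sigma> i j r = 2" "nb \<sigma> i j t = 2"
    using r other[OF ij(1) lr(1,3)] other[OF ij(1) lr(2,4)] ij(1) pred_mod_less[of K i] tr(3)
    by (auto simp: nbrs_def)
  then have d2: "dis ?\<sigma> = 2 * K"
    using dis_update[of i j t \<sigma>] ij(1,2) r[OF ij(1)] tr(3) strip(1) by simp
  have "t \<in> {1..q}" using config_value[OF \<sigma> ij(1) lr(1)] other[OF ij(1) lr(1,3)] by simp
  then have f: "flip q K L \<sigma> ?\<sigma>" using \<sigma> ij(1,2) r[OF ij(1)] tr(3) by (auto simp: flip_def)
  have "has ?\<sigma> t"
    using full[OF lr(1)] lr(3) by (intro has_colI[OF lr(1)]) (simp add: full_update_other)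
  moreover have "u = t" if u: "has ?\<sigma> u" for u
  proof -
    obtain l where l: "l < L" "full ?\<sigma> l u" using u unfolding has_col_def by blast
    show ?thesis
    proof (cases "l = j")
      case True
      then show ?thesis using full_colD[OF l(2) ij(1)] by simp
    next
      case False
      then show ?thesis using full_colD[OF l(2) ij(1)] other[OF ij(1) l(1)] by simp
    qed
  qed
  moreover have "?\<sigma> \<in> configs q K L" "dis ?\<sigma> \<le> 2 * K + 1" using flip_configs[OF f] d2 by simp_all
  ultimately have "low q t ?\<sigma>" by (intro low_if_only_colour)
  then have "low q t \<sigma>" using low_flip[OF f] strip(1) by simp
  with nlow show ?thesis by simp
next
  case (bar k h c)
  let ?\<sigma> = "\<sigma>((i, j) := y)"
  have val: "?\<sigma> (k, l) = t \<or> ?\<sigma> (k, l) = r" if "k < K" "l < L" for k l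
    using two_columns(2)[OF d tr that] bar(10) by auto
  have out: "?\<sigma> (k, l) = t" if "k < K" "l < L" "l \<noteq> j" "l \<noteq> c" for k l
  proof -
    have "(k, l) \<notin> cells K L \<sigma> r" unfolding bar(9) using that by (auto simp: columns_def)
    then have "\<sigma> (k, l) \<noteq> r" using that by (simp add: cells_def)
    then show ?thesis using two_columns(2)[OF d tr that(1,2)] that by auto
  qed
  have inj: "?\<sigma> (k, j) = r" if "k < K" "k \<noteq> i" for k
  proof -
    have "(k, j) \<in> cells K L \<sigma> r" unfolding bar(9) using that by (auto simp: columns_def)
    then show ?thesis using that by (simp add: cells_def)
  qed
  have "\<exists>c<L. \<forall>k<K. \<forall>l<L. l \<noteq> c \<and> l \<noteq> Suc c mod L \<longrightarrow> ?\<sigma> (k, l) = t"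
  proof (cases "c = Suc j mod L")
    case True
    then show ?thesis using out ij(2) by blast
  next
    case False
    then have "c = pred_mod L j" using bar(8) by simp
    then have "Suc c mod L = j" using ij(2) Suc_pred_mod[of j L] by simp
    then show ?thesis using out bar(6) by blast
  qed
  moreover have "\<forall>u. has ?\<sigma> u \<longrightarrow> u = t" using lose_column(3)[OF d tr ij(1,3) lost] by blast
  moreover have "?\<sigma> (Suc k mod K, l) = ?\<sigma> (k, l)"
    if "k < K" "l < L" "?\<sigma> (k, l) \<noteq> t" "?\<sigma> (Suc k mod K, l) \<noteq> t" for k l
    using val[OF that(1,2)] val[OF Suc_mod_less[OF that(1)] that(2)] that(3,4) by metis
  moreover have "?\<sigma> (k, Suc l mod L) = ?\<sigma> (k, l)"
    if "k < K" "l < L" "?\<sigma> (k, l) \<noteq> t" "?\<sigma> (k, Suc l mod L) \<noteq> t" for k l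
    using val[OF that(1,2)] val[OF that(1) Suc_mod_less[OF that(2)]] that(3,4) by metis
  moreover have "\<exists>l<L. ?\<sigma> (k, l) \<noteq> t \<or> ?\<sigma> (Suc k mod K, l) \<noteq> t" if "k < K" for k
  proof -
    have "Suc k mod K < K" "Suc k mod K \<noteq> k" using that cyclic_neighbours_distinct[of K k] K by auto
    then have "?\<sigma> (k, j) = r \<or> ?\<sigma> (Suc k mod K, j) = r" using inj that by (cases "k = i") blast+
    then show ?thesis using ij(2) tr(3) by metis
  qed
  moreover have "dis (\<lambda>v. ?\<sigma> v = r) mod 4 = 2"
  proof -
    have "dis (\<lambda>v. ?\<sigma> v = r) = dis ?\<sigma>"
    proof (rule disagree_cong)
      fix v w assume "v \<in> vertices K L" "w \<in> vertices K L"
      then have "?\<sigma> v = t \<or> ?\<sigma> v = r" "?\<sigma> w = t \<or> ?\<sigma> w = r" using val by (cases v; cases w; simp)+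
      then show "(?\<sigma> v = r) = (?\<sigma> w = r) \<longleftrightarrow> ?\<sigma> v = ?\<sigma> w" using tr(3) by metis
    qed
    moreover have "(2 * K + 2) mod 4 = 2" using \<open>even K\<close> by presburger
    ultimately show ?thesis using bar(2) by simp
  qed
  ultimately show ?thesis unfolding trapped_def using bar(2) by blast
qed

end

section \<open>Crossing from \<open>r\<close> to \<open>s\<close>\<close>

lemma arc_remove_last: "l < n \<Longrightarrow> arc n p (Suc l) - {(p + l) mod n} = arc n p l"
  using arc_new[of l n p] by (auto simp: arc_Suc)

lemma arc_Suc_first: "arc n p (Suc l) = insert (p mod n) (arc n (Suc p) l)"
proof -
  have "{..<Suc l} = insert 0 (Suc ` {..<l})" by (auto simp: less_Suc_eq_0_disj)
  then show ?thesis by (simp add: arc_image image_image)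
qed

lemma arc_remove_first:
  assumes "l < n"
  shows "arc n p (Suc l) - {p mod n} = arc n (Suc p) l"
proof -
  have "p mod n \<notin> arc n (Suc p) l"
  proof
    assume "p mod n \<in> arc n (Suc p) l"
    then have "insert (p mod n) (arc n (Suc p) l) = arc n (Suc p) l" by auto
    then have "card (arc n p (Suc l)) = card (arc n (Suc p) l)" by (simp add: arc_Suc_first)
    then show False using assms by (simp add: card_arc)
  qed
  then show ?thesis by (auto simp: arc_Suc_first)
qed

lemma arc_all_but_one: "i < n \<Longrightarrow> arc n (Suc i mod n) (n - 1) = {..<n} - {i}"
proof -
  assume "i < n"
  then have "arc n (Suc i mod n) (Suc (n - 1)) = {..<n}" using arc_full[of n "Suc i mod n"] by simp
  moreover have "(Suc i mod n + (n - 1)) mod n = i"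
    using \<open>i < n\<close> by (cases "Suc i = n") auto
  ultimately show ?thesis
    using arc_remove_last[of "n - 1" n "Suc i mod n"] \<open>i < n\<close> by simp
qed

lemma arc_before:
  assumes "i < n" "k < n" "i \<notin> arc n k h"
  obtains k' where "k = (Suc i mod n + k') mod n" "k' + h \<le> n - 1"
proof -
  have "k \<in> arc n (Suc i mod n) n" using assms by (simp add: arc_full)
  then obtain k' where k': "k' < n" "k = (Suc i mod n + k') mod n" by (auto simp: arc_def)
  have "k' + h \<le> n - 1"
  proof (rule ccontr)
    assume "\<not> ?thesis"
    then have x: "n - 1 - k' < h" using k'(1) by linarith
    have "(k + (n - 1 - k')) mod n = (Suc i mod n + k' + (n - 1 - k')) mod n"
      unfolding k'(2) by (rule mod_add_left_eq)
    also have "\<dots> = (Suc i mod n + (n - 1)) mod n" using k'(1) by simp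
    also have "\<dots> = i" using assms(1) by (cases "Suc i = n") auto
    finally have "i \<in> arc n k h" using x unfolding arc_def by force
    with assms(3) show False by simp
  qed
  with k' that show ?thesis by blast
qed

lemma (in torus) trapped_only: "trapped t r \<sigma> \<Longrightarrow> has \<sigma> u \<Longrightarrow> u = t"
  unfolding trapped_def by blast

locale transition = torus +
  fixes q r s :: nat
  assumes r: "r \<in> {1..q}" and s: "s \<in> {1..q}" and rs: "r \<noteq> s" and parity: "q = 2 \<or> even K"
begin

abbreviation "crossings \<equiv> paths q K L (const_config K L r) (const_config K L s)"

abbreviation "area \<sigma> \<equiv> card (cells K L \<sigma> s)"

definition allowed :: "config \<Rightarrow> bool" where
  "allowed \<sigma> \<longleftrightarrow> \<sigma> \<in> configs q K L \<and> dis \<sigma> \<le> 2 * K + 2 \<and>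
     (\<forall>t\<in>{1..q} - {r, s}. \<not> low q t \<sigma>)"

lemma finite_cells: "finite (cells K L \<sigma> c)"
  by (simp add: cells_def finite_vertices)

lemma area_update: "area (\<sigma>((i, j) := y)) \<le> Suc (area \<sigma>)"
proof -
  have "cells K L (\<sigma>((i, j) := y)) s \<subseteq> insert (i, j) (cells K L \<sigma> s)"
    by (auto simp: cells_def split: if_splits)
  then have "area (\<sigma>((i, j) := y)) \<le> card (insert (i, j) (cells K L \<sigma> s))"
    by (intro card_mono) (simp_all add: finite_cells)
  also have "\<dots> \<le> Suc (area \<sigma>)" by (rule card_insert_le_m1) simp_all
  finally show ?thesis .
qed

lemma card_two_colours:
  assumes "\<And>i j. i < K \<Longrightarrow> j < L \<Longrightarrow> \<sigma> (i, j) = r \<or> \<sigma> (i, j) = s"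
  shows "card (cells K L \<sigma> r) + area \<sigma> = K * L"
proof -
  have "card (cells K L \<sigma> r \<union> cells K L \<sigma> s) = card (cells K L \<sigma> r) + area \<sigma>"
    using rs by (intro card_Un_disjoint finite_cells) (auto simp: cells_def)
  moreover have "cells K L \<sigma> r \<union> cells K L \<sigma> s = vertices K L"
  proof -
    have "\<sigma> v = r \<or> \<sigma> v = s" if "v \<in> vertices K L" for v using assms that by (cases v) simp
    then show ?thesis by (auto simp: cells_def)
  qed
  ultimately show ?thesis by (simp add: vertices_def)
qed

text \<open>
  The configurations on the side of \<open>r\<close>: those with columns of \<open>r\<close> but not of \<open>s\<close>, those with both
  and a small area of \<open>s\<close>, and what an allowed path reaches from them: a single row of another
  colour around the torus (if \<open>L = K + 1\<close>) and the trapped configurations. One flip leaves this side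
  only as stated. The set \<open>Z\<close> permits to count some configurations without a column of \<open>s\<close> to the
  other side.
\<close>

lemma crossing:
  assumes \<omega>: "\<omega> \<in> crossings"
    and allowed: "\<And>\<xi>. \<xi> \<in> set \<omega> \<Longrightarrow> allowed \<xi>"
    and Z: "const_config K L r \<notin> Z" and a: "a < (L - 2) * K"
  obtains \<sigma> \<sigma>' where "\<sigma> \<in> set \<omega>" "\<sigma>' \<in> set \<omega>" "flip q K L \<sigma> \<sigma>'"
    "(has \<sigma> r \<and> has \<sigma> s \<and> area \<sigma> = a) \<or>
     (\<not> has \<sigma> s \<and> \<sigma> \<notin> Z \<and> has \<sigma>' r \<and> has \<sigma>' s \<and> a < area \<sigma>') \<or>
     (\<sigma>' \<in> Z \<and> \<not> (has \<sigma> r \<and> has \<sigma> s \<and> a < area \<sigma>))"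
proof -
  define T where "T = {1..q} - {r, s}"
  define P where "P = (\<lambda>\<sigma>. \<sigma> \<notin> Z \<and>
    (has \<sigma> r \<and> (\<forall>u. has \<sigma> u \<longrightarrow> u = r) \<or>
     (\<forall>u. \<not> has \<sigma> u) \<and> (\<exists>k<K. \<forall>i<K. i \<noteq> k \<longrightarrow> (\<forall>j<L. \<sigma> (i, j) = r)) \<or>
     (\<exists>t\<in>T. has \<sigma> r \<and> has \<sigma> t) \<or>
     (\<exists>t\<in>T. trapped t r \<sigma>) \<or>
     (has \<sigma> r \<and> has \<sigma> s \<and> area \<sigma> \<le> a)))"
  have "P (const_config K L r)" using Z by (simp add: P_def has_const)
  moreover have "\<not> P (const_config K L s)"
  proof -
    have "\<not> trapped t r (const_config K L s)" if "t \<in> T" for t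
    proof
      assume "trapped t r (const_config K L s)"
      then have "s = t" by (rule trapped_only) (simp add: has_const)
      with that show False by (simp add: T_def)
    qed
    then show ?thesis using rs by (auto simp: P_def has_const)
  qed
  ultimately obtain \<sigma> \<sigma>' where \<sigma>: "\<sigma> \<in> set \<omega>" "\<sigma>' \<in> set \<omega>" "P \<sigma>" "\<not> P \<sigma>'" "flip q K L \<sigma> \<sigma>'"
    using path_crossing[OF \<omega>] by blast
  obtain i j y where ij: "i < K" "j < L" "y \<noteq> \<sigma> (i, j)" "\<sigma>' = \<sigma>((i, j) := y)"
    using \<sigma>(5) by (auto simp: flip_def)
  have conf: "\<sigma> \<in> configs q K L" "\<sigma>' \<in> configs q K L" using flip_configs[OF \<sigma>(5)] by auto
  have d: "dis \<sigma> \<le> 2 * K + 2" "dis \<sigma>' \<le> 2 * K + 2" using allowed \<sigma> by (auto simp: allowed_def)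
  have nlow: "\<not> low q t \<sigma>" "\<not> low q t \<sigma>'" if "t \<in> T" for t
    using allowed \<sigma> that by (auto simp: allowed_def T_def)
  have colour: "u \<in> {1..q}" if u: "has \<sigma>' u" for u
  proof -
    obtain l where l: "l < L" "full \<sigma>' l u" using u unfolding has_col_def by blast
    have "0 < K" using K by simp
    from full_colD[OF l(2) this] config_value[OF conf(2) this l(1)] show ?thesis by simp
  qed
  have keep: "has \<sigma> u" if "l < L" "full \<sigma>' l u" "l \<noteq> j" for l u
    using that unfolding ij(4) by (intro has_colI[of l]) (simp_all add: full_update_other)
  have lost: "full \<sigma> j u" if u: "has \<sigma> u" "\<not> has \<sigma>' u" for u
  proof -
    obtain l where l: "l < L" "full \<sigma> l u" using u(1) unfolding has_col_def by blast
    have "l = j"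
    proof (rule ccontr)
      assume "l \<noteq> j"
      then have "has \<sigma>' u" using l unfolding ij(4) by (intro has_colI[of l]) (simp_all add: full_update_other)
      with u(2) show False by simp
    qed
    with l show ?thesis by simp
  qed
  have "(has \<sigma> r \<and> has \<sigma> s \<and> area \<sigma> = a) \<or>
     (\<not> has \<sigma> s \<and> \<sigma> \<notin> Z \<and> has \<sigma>' r \<and> has \<sigma>' s \<and> a < area \<sigma>') \<or>
     (\<sigma>' \<in> Z \<and> \<not> (has \<sigma> r \<and> has \<sigma> s \<and> a < area \<sigma>))"
  proof (cases "\<sigma>' \<in> Z")
    case True
    have "\<not> (has \<sigma> r \<and> has \<sigma> s \<and> a < area \<sigma>)"
    proof
      assume h: "has \<sigma> r \<and> has \<sigma> s \<and> a < area \<sigma>"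
      have "\<not> has \<sigma> t" if "t \<in> T" for t
        using two_columns_only[OF d(1), of r s t] h rs that by (auto simp: T_def)
      moreover have "\<not> trapped t r \<sigma>" if "t \<in> T" for t
      proof
        assume "trapped t r \<sigma>"
        then have "r = t" using h trapped_only by blast
        with that show False by (simp add: T_def)
      qed
      moreover have "\<not> (\<forall>u. has \<sigma> u \<longrightarrow> u = r)" "\<not> (\<forall>u. \<not> has \<sigma> u)" "\<not> area \<sigma> \<le> a"
        using h rs by auto
      ultimately show False using \<sigma>(3) unfolding P_def by blast
    qed
    with True show ?thesis by simp
  next
    case nZ: False
    have nP: "\<not> (has \<sigma>' r \<and> (\<forall>u. has \<sigma>' u \<longrightarrow> u = r))"
      "\<not> ((\<forall>u. \<not> has \<sigma>' u) \<and> (\<exists>k<K. \<forall>i<K. i \<noteq> k \<longrightarrow> (\<forall>j<L. \<sigma>' (i, j) = r)))"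
      "\<And>t. t \<in> T \<Longrightarrow> \<not> (has \<sigma>' r \<and> has \<sigma>' t)" "\<And>t. t \<in> T \<Longrightarrow> \<not> trapped t r \<sigma>'"
      "\<not> (has \<sigma>' r \<and> has \<sigma>' s \<and> area \<sigma>' \<le> a)"
      using \<sigma>(4) nZ unfolding P_def by blast+
    consider (r) "has \<sigma> r" "\<forall>u. has \<sigma> u \<longrightarrow> u = r"
      | (row) k where "\<forall>u. \<not> has \<sigma> u" "k < K" "\<forall>i<K. i \<noteq> k \<longrightarrow> (\<forall>j<L. \<sigma> (i, j) = r)"
      | (rt) t where "t \<in> T" "has \<sigma> r" "has \<sigma> t"
      | (t) t where "t \<in> T" "trapped t r \<sigma>"
      | (both) "has \<sigma> r" "has \<sigma> s" "area \<sigma> \<le> a"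
      using \<sigma>(3) unfolding P_def by blast
    then show ?thesis
    proof cases
      case r
      show ?thesis
      proof (cases "has \<sigma>' r")
        case True
        then obtain u where u: "has \<sigma>' u" "u \<noteq> r" using nP(1) by blast
        then have "u = s" using nP(3)[of u] True colour[OF u(1)] by (auto simp: T_def)
        moreover have "\<sigma> \<notin> Z" using \<sigma>(3) by (simp add: P_def)
        moreover have "\<not> has \<sigma> s" using r(2) rs by blast
        moreover have "a < area \<sigma>'" using nP(5) True u(1) \<open>u = s\<close> by (metis not_le)
        ultimately show ?thesis using u(1) True by blast
      next
        case False
        have col: "full \<sigma> j r" using lost[OF r(1) False] .
        have none: "\<not> has \<sigma>' u" for u
        proof
          assume "has \<sigma>' u"
          then obtain l where l: "l < L" "full \<sigma>' l u" unfolding has_col_def by blast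
          have "l \<noteq> j" using not_full_update[OF ij(1) col ij(3), of u] l(2) ij(4) by auto
          then have "u = r" using keep[OF l] r(2) by simp
          with \<open>has \<sigma>' u\<close> False show False by simp
        qed
        have "\<sigma>' (k, l) = r" if "k < K" "l < L" "k \<noteq> i" for k l
          using no_constant_column(2)[OF d(2) none that(1,2) ij(2)] full_colD[OF col that(1)] that(3) ij(4)
          by simp
        then show ?thesis using nP(2) none ij(1) by blast
      qed
    next
      case (row k)
      have lj: "Suc j mod L < L" "Suc j mod L \<noteq> j"
        using ij(2) L cyclic_neighbours_distinct[of L j] by auto
      have "\<exists>u. has \<sigma>' u"
      proof (rule ccontr)
        assume "\<not> ?thesis"
        then have n: "\<not> has \<sigma>' u" for u by blast
        have "\<sigma>' (i, j) = \<sigma>' (i, Suc j mod L)" "\<sigma> (i, j) = \<sigma> (i, Suc j mod L)"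
          using no_constant_column(2)[OF d(2) n ij(1,2) lj(1)]
            no_constant_column(2)[OF d(1) _ ij(1,2) lj(1)] row(1) by blast+
        with ij(3,4) lj show False by simp
      qed
      moreover have "u = r" if u: "has \<sigma>' u" for u
      proof -
        obtain l where l: "l < L" "full \<sigma>' l u" using u unfolding has_col_def by blast
        have "l = j" using keep[OF l] row(1) by blast
        obtain i' where i': "i' < K" "i' \<noteq> i" "i' \<noteq> k"
          using obtain_third[of K i k] K by auto
        then have "\<sigma>' (i', j) = r" using row(3) ij by simp
        with full_colD[OF l(2) i'(1)] \<open>l = j\<close> show ?thesis by simp
      qed
      ultimately show ?thesis using nP(1) by blast
    next
      case (rt t)
      have t: "t \<noteq> r" "t \<noteq> s" "t \<in> {1..q}" using rt by (auto simp: T_def)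
      have "even K"
      proof -
        have "card {r, s, t} \<le> card {1..q}" using r s t by (intro card_mono) auto
        then show ?thesis using parity t rs by auto
      qed
      show ?thesis
      proof (cases "has \<sigma>' r")
        case True
        then have "\<not> has (\<sigma>((i, j) := y)) t" using nP(3)[OF rt(1)] ij(4) by blast
        from lose_column(2,3)[OF d(1) rt(2,3) t(1)[symmetric] ij(1,3) this] nP(1) show ?thesis
          unfolding ij(4) by blast
      next
        case False
        then have "trapped t r \<sigma>'"
          using trapped_enter[OF conf(1) \<open>even K\<close> d(1) rt(3,2) t(1) ij(1-3) _ _ nlow(1)[OF rt(1)]] d(2) ij(4)
          by simp
        with nP(4)[OF rt(1)] show ?thesis by simp
      qed
    next
      case (t t)
      have "t \<noteq> r" using t by (auto simp: T_def)
      from trapped_step[OF t(2) this \<sigma>(5) d(2) nlow(2)[OF t(1)]] nP(3,4)[OF t(1)] show ?thesis by blast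
    next
      case both
      show ?thesis
      proof (cases "has \<sigma>' r")
        case hr: True
        show ?thesis
        proof (cases "has \<sigma>' s")
          case True
          then have "a < area \<sigma>'" using nP(5) hr by simp
          moreover have "area \<sigma>' \<le> Suc (area \<sigma>)" using area_update ij(4) by simp
          ultimately have "area \<sigma> = a" using both(3) by simp
          with both show ?thesis by simp
        next
          case False
          then have "\<not> has (\<sigma>((i, j) := y)) s" using ij(4) by simp
          from lose_column(2,3)[OF d(1) both(1,2) rs ij(1,3) this] nP(1) show ?thesis
            unfolding ij(4) by blast
        qed
      next
        case False
        then have nr: "\<not> has (\<sigma>((i, j) := y)) r" "dis (\<sigma>((i, j) := y)) \<le> 2 * K + 2" using ij(4) d(2) by simp_all
        have "card (cells K L \<sigma> r) \<le> 2 * K"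
          using d(1) both(2,1) rs[symmetric] ij(1-3) nr
        proof (cases rule: lose_last_column)
          case strip
          then show ?thesis by (simp add: card_columns)
        next
          case (bar k h c)
          have "card (cells K L \<sigma> r) \<le> card (columns {j}) + card (arc K k h \<times> {c})"
            unfolding bar(9) by (rule card_Un_le)
          then show ?thesis using bar(5) by (simp add: card_columns card_cartesian_product card_arc)
        qed
        moreover have "card (cells K L \<sigma> r) + area \<sigma> = K * L"
          using two_columns(2)[OF d(1) both(1,2) rs] by (rule card_two_colours)
        moreover have "(L - 2) * K + 2 * K = K * L" using L by (simp add: algebra_simps diff_mult_distrib)
        ultimately show ?thesis using a both(3) by linarith
      qed
    qed
  qed
  then show ?thesis using that \<sigma> by blast
qed


lemma const_not_droplet: "v \<in> vertices K L \<Longrightarrow> v \<in> A \<Longrightarrow> const_config K L r \<noteq> droplet K L r s A"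
proof
  assume v: "v \<in> vertices K L" "v \<in> A" and "const_config K L r = droplet K L r s A"
  then have "const_config K L r v = droplet K L r s A v" by simp
  with v rs show False by (simp add: const_config_def droplet_def)
qed

text \<open>
  The step at which the first column of \<open>s\<close> is completed: the site added faces the gap between the
  ends of the bar.
\<close>

lemma first_column:
  assumes f: "flip q K L \<sigma> \<sigma>'" and d: "dis \<sigma> \<le> 2 * K + 2" "dis \<sigma>' \<le> 2 * K + 2"
    and h: "\<not> has \<sigma> s" "has \<sigma>' r" "has \<sigma>' s" and a: "K < area \<sigma>'"
  obtains h where "1 \<le> h" "h < K" "area \<sigma>' = K + h"
    "h < K - 1 \<Longrightarrow> \<sigma> \<in> Bbar K L h 1 (K - 1) r s" "h = K - 1 \<Longrightarrow> \<sigma> \<in> Rbar K L 2 (K - 1) r s"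
proof -
  obtain i j y where ij: "i < K" "j < L" "y \<noteq> \<sigma>' (i, j)" "\<sigma> = \<sigma>'((i, j) := y)"
    using flip_sym[OF f] by (auto simp: flip_def)
  have conf: "\<sigma> \<in> configs q K L" using flip_configs[OF f] by simp
  have "\<not> has (\<sigma>'((i, j) := y)) s" "dis (\<sigma>'((i, j) := y)) \<le> 2 * K + 2" using h d ij(4) by simp_all
  with d(2) h(2,3) rs ij(1-3) show ?thesis
  proof (cases rule: lose_last_column)
    case strip
    then show ?thesis using a by (simp add: card_columns)
  next
    case (bar k h c)
    let ?p = "Suc i mod K"
    have area: "area \<sigma>' = K + h"
      using card_strip_bar[of j 1 h c k] bar ij(2) L by (simp add: arc_1 del: One_nat_def)
    obtain k' where k': "k = (?p + k') mod K" "k' + h \<le> K - 1" using arc_before[OF ij(1) bar(3,11)] .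
    have bar_arc: "arc K (?p + k') h = arc K k h" using k'(1) by (metis arc_mod)
    have cells: "cells K L \<sigma> s = ({..<K} - {i}) \<times> {j} \<union> arc K k h \<times> {c}"
    proof -
      have "cells K L \<sigma> s = cells K L \<sigma>' s - {(i, j)}"
        unfolding ij(4) using bar(10) rs ij(1,2) by (auto simp: cells_def)
      then show ?thesis unfolding bar(9) using bar(7) by (auto simp: columns_def)
    qed
    have drop: "\<sigma> = droplet K L r s A" if "A = cells K L \<sigma> s" for A
    proof (rule configs_two_colours[OF conf])
      show "A \<inter> vertices K L = cells K L \<sigma> s" unfolding that by (auto simp: cells_def)
      fix v assume "v \<in> vertices K L"
      then show "\<sigma> v = r \<or> \<sigma> v = s"
        using two_columns(2)[OF d(2) h(2,3) rs] bar(10) ij(4) by (cases v) auto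
    qed
    show ?thesis
    proof (rule that[of h])
      assume "h < K - 1"
      let ?c = "if c = Suc j mod L then j + 1 else j + L - 1"
      have c: "?c mod L = c" using bar(8) by (auto simp: pred_mod_def)
      have "block K L ?p j 1 (K - 1) \<union> block K L (?p + k') ?c 1 h = cells K L \<sigma> s"
        unfolding cells block_arc bar_arc arc_all_but_one[OF ij(1)] using ij(2) c
        by (simp add: arc_1 del: One_nat_def)
      from drop[OF this] show "\<sigma> \<in> Bbar K L h 1 (K - 1) r s"
        unfolding Bbar_def using k'(2) ij(2) K
        by (intro CollectI exI[of _ ?p] exI[of _ j] exI[of _ k'] exI[of _ ?c]) simp
    next
      assume "h = K - 1"
      then have "arc K k h = {..<K} - {i}"
        using bar(11) card_arc[of h K k] ij(1) arc_subset[of K k h] K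
        by (intro card_subset_eq) auto
      then have cells': "cells K L \<sigma> s = ({..<K} - {i}) \<times> {j, c}" unfolding cells by auto
      define c' where "c' = (if c = Suc j mod L then j else c)"
      have c': "c' < L" "arc L c' 2 = {j, c}"
      proof -
        have two: "arc L x 2 = {x mod L, Suc x mod L}" for x
          by (auto simp: arc_image numeral_2_eq_2 lessThan_Suc)
        have "Suc c mod L = j" if "c = pred_mod L j" using that ij(2) by (simp add: Suc_pred_mod)
        then show "arc L c' 2 = {j, c}" using bar(6,8) ij(2) unfolding c'_def two by auto
        show "c' < L" using bar(6) ij(2) by (simp add: c'_def)
      qed
      have "block K L ?p c' 2 (K - 1) = cells K L \<sigma> s"
        unfolding cells' block_arc c'(2) arc_all_but_one[OF ij(1)] ..
      from drop[OF this] show "\<sigma> \<in> Rbar K L 2 (K - 1) r s"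
        unfolding Rbar_def using c'(1) K by (intro CollectI exI[of _ ?p] exI[of _ c']) simp
    qed (use bar area in auto)
  qed
qed

text \<open>
  The first column of \<open>s\<close> is completed at an area of at most \<open>2 K - 1\<close>. From there on the area has to
  grow by single sites.
\<close>

lemma gate_strip_bar:
  assumes \<omega>: "\<omega> \<in> crossings"
    and allowed: "\<And>\<xi>. \<xi> \<in> set \<omega> \<Longrightarrow> allowed \<xi>"
    and jh: "1 \<le> h" "h < K" "2 * K - 1 \<le> j * K + h" "j \<le> L - 3"
  shows "set \<omega> \<inter> Bbar K L h j K r s \<noteq> {}"
proof -
  have a: "j * K + h < (L - 2) * K"
  proof -
    have "(j + 1) * K \<le> (L - 2) * K" using jh(4) L by (intro mult_le_mono1) linarith
    then show ?thesis using jh(2) by simp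
  qed
  obtain \<sigma> \<sigma>' where \<sigma>: "\<sigma> \<in> set \<omega>" "\<sigma>' \<in> set \<omega>" "flip q K L \<sigma> \<sigma>'"
    "(has \<sigma> r \<and> has \<sigma> s \<and> area \<sigma> = j * K + h) \<or>
     (\<not> has \<sigma> s \<and> \<sigma> \<notin> {} \<and> has \<sigma>' r \<and> has \<sigma>' s \<and> j * K + h < area \<sigma>') \<or>
     (\<sigma>' \<in> {} \<and> \<not> (has \<sigma> r \<and> has \<sigma> s \<and> j * K + h < area \<sigma>))"
    by (rule crossing[OF \<omega> allowed _ a, of "{}"]) auto
  have d: "dis \<sigma> \<le> 2 * K + 2" "dis \<sigma>' \<le> 2 * K + 2" "\<sigma> \<in> configs q K L"
    using allowed \<sigma> by (auto simp: allowed_def)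
  from \<sigma>(4) consider "has \<sigma> r" "has \<sigma> s" "area \<sigma> = j * K + h"
    | "\<not> has \<sigma> s" "has \<sigma>' r" "has \<sigma>' s" "j * K + h < area \<sigma>'" by blast
  then show ?thesis
  proof cases
    case 1
    then show ?thesis using strip_bar_by_area[OF d(3,1) 1(1,2) rs 1(3) jh(1,2)] \<sigma>(1) by blast
  next
    case 2
    then have "K < area \<sigma>'" using jh K by linarith
    then obtain h' where "h' < K" "area \<sigma>' = K + h'"
      using first_column[OF \<sigma>(3) d(1,2) 2(1-3)] by metis
    then show ?thesis using 2(4) jh(3) by linarith
  qed
qed

end

context torus
begin

lemma disagree_ge:
  assumes "R \<subseteq> {..<K}" "C \<subseteq> {..<L}"
    and "\<And>i. i \<in> R \<Longrightarrow> \<exists>j<L. \<exists>l<L. \<sigma> (i, j) \<noteq> \<sigma> (i, l)"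
    and "\<And>j. j \<in> C \<Longrightarrow> \<exists>i<K. \<exists>k<K. \<sigma> (i, j) \<noteq> \<sigma> (k, j)"
  shows "2 * card R + 2 * card C \<le> dis \<sigma>"
proof -
  have "2 \<le> changes L (\<lambda>j. \<sigma> (i, j))" if i: "i \<in> R" for i
  proof -
    obtain j l where "j < L" "l < L" "\<sigma> (i, j) \<noteq> \<sigma> (i, l)" using assms(3)[OF i] by blast
    then show ?thesis by (rule changes_row_ge_2)
  qed
  then have "2 * card R \<le> (\<Sum>i\<in>R. changes L (\<lambda>j. \<sigma> (i, j)))"
    using sum_bounded_below[of R 2 "\<lambda>i. changes L (\<lambda>j. \<sigma> (i, j))"] by (simp add: mult.commute)
  also have "\<dots> \<le> (\<Sum>i<K. changes L (\<lambda>j. \<sigma> (i, j)))"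
    by (rule sum_mono2) (use assms(1) in auto)
  finally have R: "2 * card R \<le> (\<Sum>i<K. changes L (\<lambda>j. \<sigma> (i, j)))" .
  have "2 \<le> changes K (\<lambda>i. \<sigma> (i, j))" if j: "j \<in> C" for j
  proof -
    obtain i k where "i < K" "k < K" "\<sigma> (i, j) \<noteq> \<sigma> (k, j)" using assms(4)[OF j] by blast
    then show ?thesis by (intro changes_ge_2[of i K k])
  qed
  then have "2 * card C \<le> (\<Sum>j\<in>C. changes K (\<lambda>i. \<sigma> (i, j)))"
    using sum_bounded_below[of C 2 "\<lambda>j. changes K (\<lambda>i. \<sigma> (i, j))"] by (simp add: mult.commute)
  also have "\<dots> \<le> (\<Sum>j<L. changes K (\<lambda>i. \<sigma> (i, j)))"
    by (rule sum_mono2) (use assms(2) in auto)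
  finally show ?thesis using R by (simp add: disagree_def)
qed

lemma column_outside:
  assumes "j < L"
  obtains e where "e < L" "e \<noteq> j" "e \<noteq> Suc j mod L" "e = pred_mod L j"
proof -
  have "pred_mod L j < L" "pred_mod L j \<noteq> j" "pred_mod L j \<noteq> Suc j mod L"
    using assms L cyclic_neighbours_distinct[of L j] pred_mod_less[of L j] by auto
  then show ?thesis using that by blast
qed

end

context transition
begin

text \<open>
  From a rectangle of \<open>2 \<times> (K - 1)\<close> only two kinds of flips do not exceed \<open>2 K + 2\<close>: a corner is
  removed, or one of the two columns is completed.
\<close>

lemma rectangle_neighbour:
  assumes f: "flip q K L \<sigma> \<sigma>'" and d: "dis \<sigma> \<le> 2 * K + 2" and rect: "\<sigma>' \<in> Rbar K L 2 (K - 1) r s"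
    and small: "\<not> (has \<sigma> r \<and> has \<sigma> s \<and> 2 * K - 2 < area \<sigma>)"
  shows "\<sigma> \<in> Bbar K L (K - 2) 1 (K - 1) r s"
proof -
  obtain i j where ij: "i < K" "j < L" "\<sigma>' = droplet K L r s (block K L i j 2 (K - 1))"
    using rect by (auto simp: Rbar_def)
  define g where "g = pred_mod K i"
  define p where "p = Suc j mod L"
  have g: "g < K" "Suc g mod K = i" "g \<noteq> i"
    using ij(1) K pred_mod_less[of K i] Suc_pred_mod[of i K] cyclic_neighbours_distinct[of K i]
    by (auto simp: g_def)
  have p: "p < L" "p \<noteq> j" "pred_mod L p = j"
    using ij(2) L cyclic_neighbours_distinct[of L j] by (auto simp: p_def pred_Suc_mod)
  have two: "arc L j 2 = {j, p}"
    using ij(2) by (auto simp: arc_image numeral_2_eq_2 lessThan_Suc p_def)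
  have rows: "arc K i (K - 1) = {..<K} - {g}" using arc_all_but_one[OF g(1)] g(2) by simp
  have val: "\<sigma>' (k, l) = (if k \<noteq> g \<and> (l = j \<or> l = p) then s else r)" if "k < K" "l < L" for k l
    using that unfolding ij(3) droplet_def block_arc rows two by auto
  obtain o' where o': "o' < L" "o' \<noteq> j" "o' \<noteq> p" "o' = pred_mod L j"
    using column_outside[OF ij(2)] unfolding p_def .
  have d': "2 * K + 2 \<le> dis \<sigma>'"
  proof -
    have "2 * card ({..<K} - {g}) + 2 * card {j, p} \<le> dis \<sigma>'"
    proof (rule disagree_ge)
      fix k assume "k \<in> {..<K} - {g}"
      then have "\<sigma>' (k, j) \<noteq> \<sigma>' (k, o')" using val ij(2) o' rs by auto
      then show "\<exists>j<L. \<exists>l<L. \<sigma>' (k, j) \<noteq> \<sigma>' (k, l)" using ij(2) o'(1) by blast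
    next
      fix l assume "l \<in> {j, p}"
      then have "\<sigma>' (i, l) \<noteq> \<sigma>' (g, l)" using val ij p g rs by auto
      then show "\<exists>i<K. \<exists>k<K. \<sigma>' (i, l) \<noteq> \<sigma>' (k, l)" using ij(1) g(1) by blast
    qed (use ij(2) p in auto)
    then show ?thesis using g p K by (simp add: card_Diff_singleton)
  qed
  obtain a b y where ab: "a < K" "b < L" "y \<noteq> \<sigma>' (a, b)" "\<sigma> = \<sigma>'((a, b) := y)"
    using flip_sym[OF f] by (auto simp: flip_def)
  have le: "nb \<sigma>' a b (\<sigma>' (a, b)) \<le> nb \<sigma>' a b y"
    using dis_update[of a b y \<sigma>'] ab d d' by simp
  define up dn where "up = Suc a mod K" and "dn = pred_mod K a"
  have ud: "up < K" "dn < K" "up \<noteq> a" "dn \<noteq> a" "up \<noteq> dn"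
    using ab(1) K cyclic_neighbours_distinct[of K a] pred_mod_less[of K a] by (auto simp: up_def dn_def)
  have lr: "Suc b mod L < L" "pred_mod L b < L"
    using ab(2) pred_mod_less[of L b] by auto
  have nbv: "nb \<sigma>' a b z = of_bool (\<sigma>' (up, b) = z) + of_bool (\<sigma>' (dn, b) = z) +
      of_bool (\<sigma>' (a, Suc b mod L) = z) + of_bool (\<sigma>' (a, pred_mod L b) = z)" for z
    by (simp add: nbrs_def up_def dn_def)
  have bcol: "b = j \<or> b = p"
  proof (rule ccontr)
    assume n: "\<not> ?thesis"
    have "(Suc b mod L \<noteq> j \<and> Suc b mod L \<noteq> p) \<or> (pred_mod L b \<noteq> j \<and> pred_mod L b \<noteq> p)"
      using n ij(2) ab(2) L by (auto simp: p_def Suc_mod_if pred_mod_if split: if_splits)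
    then have "3 \<le> nb \<sigma>' a b r"
      unfolding nbv using val ud lr ab(1,2) n by auto
    moreover have "\<sigma>' (a, b) = r" using val ab n by simp
    ultimately show False using le nbrs_disjoint[of r y K L \<sigma>' a b] ab(3) by auto
  qed
  define e where "e = (if b = j then p else j)"
  have e: "e < L" "e \<noteq> b" "{b, e} = {j, p}" using bcol p ij(2) by (auto simp: e_def)
  have hor: "of_bool (\<sigma>' (a, Suc b mod L) = z) + of_bool (\<sigma>' (a, pred_mod L b) = z) =
      (of_bool (\<sigma>' (a, e) = z) + of_bool (r = z) :: nat)" for z
  proof (cases "b = j")
    case True
    then have "Suc b mod L = e" by (simp add: e_def p_def)
    moreover have "\<sigma>' (a, pred_mod L b) = r" using val[OF ab(1), of "pred_mod L b"] o' True by simp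
    ultimately show ?thesis by simp
  next
    case False
    then have b: "b = p" "e = j" using bcol by (auto simp: e_def)
    have "Suc p mod L \<noteq> j" "Suc p mod L \<noteq> p"
      using cyclic_neighbours_distinct[of L p] p L by auto
    then have "\<sigma>' (a, Suc b mod L) = r" using val[OF ab(1) lr(1)] b by simp
    then show ?thesis using b p by simp
  qed
  have colv: "\<sigma>' (k, b) = (if k = g then r else s)" "\<sigma>' (k, e) = (if k = g then r else s)" if "k < K" for k
    using val[OF that ab(2)] val[OF that e(1)] e(3) bcol by auto
  have nb2: "nb \<sigma>' a b z = of_bool (\<sigma>' (up, b) = z) + of_bool (\<sigma>' (dn, b) = z) + of_bool (\<sigma>' (a, e) = z) + of_bool (r = z)" for z
    using hor[of z] unfolding nbv by simp
  have conf: "\<sigma> \<in> configs q K L" using flip_configs[OF f] by simp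
  have cells': "cells K L \<sigma>' s = ({..<K} - {g}) \<times> {b, e}"
  proof -
    have "(k, l) \<in> cells K L \<sigma>' s \<longleftrightarrow> k < K \<and> k \<noteq> g \<and> (l = j \<or> l = p)" for k l
    proof (cases "k < K \<and> l < L")
      case True
      then have "(k, l) \<in> cells K L \<sigma>' s \<longleftrightarrow> (if k \<noteq> g \<and> (l = j \<or> l = p) then s else r) = s"
        using val[of k l] by (simp add: cells_def)
      then show ?thesis using True rs by (simp split: if_splits)
    qed (use ij(2) p(1) in \<open>auto simp: cells_def\<close>)
    then show ?thesis unfolding e(3) by auto
  qed
  show ?thesis
  proof (cases "a = g")
    case True
    \<comment> \<open>The gap is filled: the column is completed, contrary to the assumption.\<close>
    have x: "\<sigma>' (a, b) = r" using colv ab True by simp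
    have "y = s"
    proof (rule ccontr)
      assume "y \<noteq> s"
      then have "nb \<sigma>' a b y = 0" unfolding nb2 using colv ud ab True x by auto
      moreover have "0 < nb \<sigma>' a b r" unfolding nb2 by simp
      ultimately show False using le x by simp
    qed
    have "full \<sigma> b s"
      using colv True \<open>y = s\<close> ab(4) by (simp add: full_col_def)
    moreover have "full \<sigma> o' r"
      using val o' bcol ab(4) by (auto simp: full_col_def)
    moreover have "area \<sigma> = 2 * K - 1"
    proof -
      have "cells K L \<sigma> s = insert (g, b) (cells K L \<sigma>' s)"
        unfolding ab(4) using True \<open>y = s\<close> ab(1,2) by (auto simp: cells_def)
      moreover have "(g, b) \<notin> cells K L \<sigma>' s" unfolding cells' by simp
      moreover have "card (cells K L \<sigma>' s) = (K - 1) * 2"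
        unfolding cells' card_cartesian_product using e(2) g(1) by (simp add: card_Diff_singleton)
      ultimately show ?thesis using K by (simp add: finite_cells)
    qed
    ultimately show ?thesis using small has_colI[OF ab(2), of \<sigma> s] has_colI[OF o'(1), of \<sigma> r] K by simp
  next
    case False
    \<comment> \<open>A site of the rectangle is lost: it must be a corner.\<close>
    have x: "\<sigma>' (a, b) = s" "\<sigma>' (a, e) = s" using colv ab False by auto
    have corner: "up = g \<or> dn = g"
    proof (rule ccontr)
      assume "\<not> ?thesis"
      then have "nb \<sigma>' a b s = 3" unfolding nb2 using colv ud x rs by auto
      then show False using le x nbrs_disjoint[of s y K L \<sigma>' a b] ab(3) by auto
    qed
    have "y = r"
    proof (rule ccontr)
      assume "y \<noteq> r"
      then have "nb \<sigma>' a b y = 0" unfolding nb2 using colv ud ab x by auto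
      moreover have "0 < nb \<sigma>' a b s" unfolding nb2 using x by simp
      ultimately show False using le x by simp
    qed
    define k where "k = (if up = g then 0 else 1 :: nat)"
    have bar: "arc K (i + k) (K - 2) = {..<K} - {g} - {a}"
    proof (cases "up = g")
      case True
      have "arc K i (Suc (K - 2)) - {(i + (K - 2)) mod K} = arc K i (K - 2)"
        using K by (intro arc_remove_last) simp
      moreover have "Suc (K - 2) = K - 1" using K by simp
      moreover have "(i + (K - 2)) mod K = a"
      proof -
        have "a = pred_mod K g" using True ab(1) g(1) Suc_mod_eq_iff[of g K a] by (simp add: up_def)
        then show ?thesis using ij(1) K by (auto simp: g_def pred_mod_if mod_if)
      qed
      ultimately show ?thesis using True rows by (simp add: k_def)
    next
      case False
      then have "a = i" using corner ab(1) g pred_mod_eq_iff[of g K a] by (simp add: dn_def)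
      have "arc K i (Suc (K - 2)) - {i mod K} = arc K (Suc i) (K - 2)"
        using K by (intro arc_remove_first) simp
      moreover have "Suc (K - 2) = K - 1" using K by simp
      ultimately show ?thesis using False rows ij(1) \<open>a = i\<close> by (simp add: k_def)
    qed
    obtain c where c: "c mod L = b" "c = e + 1 \<or> c = e + L - 1"
    proof (cases "b = p")
      case True
      then have "(e + 1) mod L = b" using p by (simp add: e_def p_def)
      then show ?thesis using that by blast
    next
      case False
      then have "(e + L - 1) mod L = b" using bcol p by (simp add: e_def pred_mod_def)
      then show ?thesis using that by blast
    qed
    have cells: "cells K L \<sigma> s = block K L i e 1 (K - 1) \<union> block K L (i + k) c 1 (K - 2)"
    proof -
      have "cells K L \<sigma> s = cells K L \<sigma>' s - {(a, b)}"
        unfolding ab(4) using \<open>y = r\<close> rs by (auto simp: cells_def)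
      also have "\<dots> = ({..<K} - {g}) \<times> {e} \<union> ({..<K} - {g} - {a}) \<times> {b}"
        unfolding cells' using e(2) by auto
      also have "\<dots> = block K L i e 1 (K - 1) \<union> block K L (i + k) c 1 (K - 2)"
        unfolding block_arc rows bar using c e(1) by (simp add: arc_1 del: One_nat_def)
      finally show ?thesis .
    qed
    have "\<sigma> = droplet K L r s (block K L i e 1 (K - 1) \<union> block K L (i + k) c 1 (K - 2))"
    proof (rule configs_two_colours[OF conf])
      show "(block K L i e 1 (K - 1) \<union> block K L (i + k) c 1 (K - 2)) \<inter> vertices K L = cells K L \<sigma> s"
        unfolding cells[symmetric] by (auto simp: cells_def)
      fix v assume "v \<in> vertices K L"
      then show "\<sigma> v = r \<or> \<sigma> v = s" using val \<open>y = r\<close> ab(4) by (cases v) auto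
    qed
    moreover have "k + (K - 2) \<le> K - 1"
    proof -
      have "k \<le> 1" by (simp add: k_def)
      then show ?thesis using K by linarith
    qed
    ultimately show ?thesis unfolding Bbar_def using ij(1) e(1) c(2) by blast
  qed
qed

text \<open>
  Either the area passes \<open>2 K - 2\<close> within the strips, or the first column of \<open>s\<close> is completed only
  by the step to the area \<open>2 K - 1\<close>, which starts at a rectangle.
\<close>

lemma gate_Q:
  assumes \<omega>: "\<omega> \<in> crossings"
    and allowed: "\<And>\<xi>. \<xi> \<in> set \<omega> \<Longrightarrow> allowed \<xi>"
  shows "set \<omega> \<inter> Qbar K L r s \<noteq> {}"
proof -
  have a: "K + (K - 2) < (L - 2) * K"
  proof -
    have "2 * K \<le> (L - 2) * K" using L by (intro mult_le_mono1) linarith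
    then show ?thesis using K by linarith
  qed
  obtain \<sigma> \<sigma>' where \<sigma>: "\<sigma> \<in> set \<omega>" "\<sigma>' \<in> set \<omega>" "flip q K L \<sigma> \<sigma>'"
    "(has \<sigma> r \<and> has \<sigma> s \<and> area \<sigma> = K + (K - 2)) \<or>
     (\<not> has \<sigma> s \<and> \<sigma> \<notin> {} \<and> has \<sigma>' r \<and> has \<sigma>' s \<and> K + (K - 2) < area \<sigma>') \<or>
     (\<sigma>' \<in> {} \<and> \<not> (has \<sigma> r \<and> has \<sigma> s \<and> K + (K - 2) < area \<sigma>))"
    by (rule crossing[OF \<omega> allowed _ a, of "{}"]) auto
  have d: "dis \<sigma> \<le> 2 * K + 2" "dis \<sigma>' \<le> 2 * K + 2" "\<sigma> \<in> configs q K L"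
    using allowed \<sigma> by (auto simp: allowed_def)
  from \<sigma>(4) consider "has \<sigma> r" "has \<sigma> s" "area \<sigma> = 1 * K + (K - 2)"
    | "\<not> has \<sigma> s" "has \<sigma>' r" "has \<sigma>' s" "K + (K - 2) < area \<sigma>'" by auto
  then have "\<sigma> \<in> Qbar K L r s"
  proof cases
    case 1
    have "1 \<le> K - 2" "K - 2 < K" using K by simp_all
    from strip_bar_by_area[OF d(3,1) 1(1,2) rs 1(3) this] show ?thesis by (simp add: Qbar_def)
  next
    case 2
    then have "K < area \<sigma>'" using K by linarith
    then obtain h where h: "h < K" "area \<sigma>' = K + h" "h = K - 1 \<Longrightarrow> \<sigma> \<in> Rbar K L 2 (K - 1) r s"
      using first_column[OF \<sigma>(3) d(1,2) 2(1-3)] by metis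
    then have "h = K - 1" using 2(4) by linarith
    with h(3) show ?thesis by (simp add: Qbar_def)
  qed
  with \<sigma>(1) show ?thesis by blast
qed

text \<open>
  Here the rectangles \<open>2 \<times> (K - 1)\<close> have to be counted to the side of \<open>s\<close>, since the gate does not
  contain them.
\<close>

lemma gate_H:
  assumes \<omega>: "\<omega> \<in> crossings"
    and allowed: "\<And>\<xi>. \<xi> \<in> set \<omega> \<Longrightarrow> allowed \<xi>"
    and i: "1 \<le> i" "i \<le> K - 3"
  shows "set \<omega> \<inter> Hbar K L i r s \<noteq> {}"
proof -
  let ?Z = "Rbar K L 2 (K - 1) r s"
  have a: "K + i < (L - 2) * K"
  proof -
    have "2 * K \<le> (L - 2) * K" using L by (intro mult_le_mono1) linarith
    then show ?thesis using K i by linarith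
  qed
  have Z: "const_config K L r \<notin> ?Z"
  proof
    assume "const_config K L r \<in> ?Z"
    then obtain k l where kl: "k < K" "l < L" "const_config K L r = droplet K L r s (block K L k l 2 (K - 1))"
      by (auto simp: Rbar_def)
    have "(k + 0) mod K \<in> arc K k (K - 1)" "(l + 0) mod L \<in> arc L l 2"
      unfolding arc_def using K by (intro CollectI exI[of _ 0] conjI refl; simp)+
    then have "(k, l) \<in> block K L k l 2 (K - 1)" using kl(1,2) by (simp add: block_arc)
    from const_not_droplet[OF _ this] kl show False by simp
  qed
  obtain \<sigma> \<sigma>' where \<sigma>: "\<sigma> \<in> set \<omega>" "\<sigma>' \<in> set \<omega>" "flip q K L \<sigma> \<sigma>'"
    "(has \<sigma> r \<and> has \<sigma> s \<and> area \<sigma> = K + i) \<or>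
     (\<not> has \<sigma> s \<and> \<sigma> \<notin> ?Z \<and> has \<sigma>' r \<and> has \<sigma>' s \<and> K + i < area \<sigma>') \<or>
     (\<sigma>' \<in> ?Z \<and> \<not> (has \<sigma> r \<and> has \<sigma> s \<and> K + i < area \<sigma>))"
    by (rule crossing[OF \<omega> allowed Z a]) auto
  have d: "dis \<sigma> \<le> 2 * K + 2" "dis \<sigma>' \<le> 2 * K + 2" "\<sigma> \<in> configs q K L"
    using allowed \<sigma> by (auto simp: allowed_def)
  from \<sigma>(4) consider "has \<sigma> r" "has \<sigma> s" "area \<sigma> = 1 * K + i"
    | "\<not> has \<sigma> s" "has \<sigma>' r" "has \<sigma>' s" "K + i < area \<sigma>'" "\<sigma> \<notin> ?Z"
    | "\<sigma>' \<in> ?Z" "\<not> (has \<sigma> r \<and> has \<sigma> s \<and> K + i < area \<sigma>)" by auto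
  then have "\<sigma> \<in> Hbar K L i r s"
  proof cases
    case 1
    have "i < K" using i K by linarith
    from strip_bar_by_area[OF d(3,1) 1(1,2) rs 1(3) i(1) this] show ?thesis by (simp add: Hbar_def)
  next
    case 2
    then have "K < area \<sigma>'" by linarith
    then obtain h where h: "h < K" "area \<sigma>' = K + h" "h = K - 1 \<Longrightarrow> \<sigma> \<in> ?Z"
      "h < K - 1 \<Longrightarrow> \<sigma> \<in> Bbar K L h 1 (K - 1) r s"
      using first_column[OF \<sigma>(3) d(1,2) 2(1-3)] by metis
    have "h \<noteq> K - 1" using h(3) 2(5) by blast
    then have "h < K - 1" "h \<in> {i + 1..K - 2}" using h(1,2) 2(4) by auto
    with h(4) show ?thesis by (auto simp: Hbar_def)
  next
    case 3
    then have "\<not> (has \<sigma> r \<and> has \<sigma> s \<and> 2 * K - 2 < area \<sigma>)" using i K by linarith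
    from rectangle_neighbour[OF \<sigma>(3) d(1) 3(1) this] show ?thesis
      using i K by (auto simp: Hbar_def intro!: bexI[of _ "K - 2"])
  qed
  with \<sigma>(1) show ?thesis by blast
qed

end

section \<open>Growing droplets\<close>

lemma arc_memI: "x < l \<Longrightarrow> (p + x) mod n \<in> arc n p l"
  by (auto simp: arc_def)

lemma path_Cons:
  assumes "flip q K L \<sigma> \<rho>" "\<omega> \<in> paths q K L \<rho> \<tau>"
  shows "\<sigma> # \<omega> \<in> paths q K L \<sigma> \<tau>"
  using assms flip_configs[OF assms(1)] connectivity_flip[OF assms(1)]
  by (cases \<omega>) (auto simp: paths_iff)

context torus
begin

lemma nbrs_ge:
  fixes f :: "nat \<times> nat \<Rightarrow> bool"
  assumes "d = Suc c mod L \<or> d = pred_mod L c" "b \<Longrightarrow> f (i, d)"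
  shows "of_bool (f (Suc i mod K, c)) + of_bool (f (pred_mod K i, c)) + of_bool b \<le> nb f i c True"
  using assms by (cases b) (auto simp: nbrs_def)

abbreviation "per A \<equiv> dis (\<lambda>v. v \<in> A)"

lemma per_empty: "per {} = 0"
  by (subst disagree_def) (simp add: changes_def)

lemma per_insert:
  assumes "i < K" "j < L" "(i, j) \<notin> A" "k \<le> nb (\<lambda>v. v \<in> A) i j True"
  shows "per (insert (i, j) A) + 2 * k \<le> per A + 4"
proof -
  have "(\<lambda>v. v \<in> insert (i, j) A) = (\<lambda>v. v \<in> A)((i, j) := True)" by (auto simp: fun_eq_iff)
  then have "per (insert (i, j) A) + nb (\<lambda>v. v \<in> A) i j True = per A + nb (\<lambda>v. v \<in> A) i j False"
    using dis_update[of i j True "\<lambda>v. v \<in> A"] assms by simp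
  moreover have "nb (\<lambda>v. v \<in> A) i j False = 4 - nb (\<lambda>v. v \<in> A) i j True" by (auto simp: nbrs_def)
  moreover have "nb (\<lambda>v. v \<in> A) i j True \<le> 4" by (rule nbrs_le_4)
  ultimately show ?thesis using assms(4) by linarith
qed

definition grow1 :: "(nat \<times> nat) set \<Rightarrow> (nat \<times> nat) set \<Rightarrow> bool" where
  "grow1 A B \<longleftrightarrow> (\<exists>v\<in>vertices K L - A. B = insert v A \<and> per B \<le> 2 * K + 2)"

abbreviation "grow \<equiv> grow1\<^sup>*\<^sup>*"

lemma grow_subset: "grow A B \<Longrightarrow> A \<subseteq> B"
  by (induction rule: rtranclp_induct) (auto simp: grow1_def)

text \<open>
  Sites are added to a column \<open>c\<close> one after the other, each next to the previous one. If the
  neighbouring column \<open>d\<close> is occupied beside them (the case \<open>b\<close>), the first site raises the perimeter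
  by 2, the last one lowers it by 2 and the others do not change it. Otherwise the first site raises
  it by 4, the last one does not change it and the others raise it by 2.
\<close>

context
  fixes A :: "(nat \<times> nat) set" and c d p h :: nat and b :: bool
  assumes c: "c < L" and d: "d = Suc c mod L \<or> d = pred_mod L c"
    and A: "\<And>i. (i, c) \<notin> A" and side: "\<And>i. b \<Longrightarrow> i \<in> arc K p h \<Longrightarrow> (i, d) \<in> A"
    and h: "h \<le> K" and per: "per A \<le> (if b then 2 * K else 0)"
begin

lemma per_bar:
  "l \<le> h \<Longrightarrow> per (A \<union> arc K p l \<times> {c}) \<le> per A +
     (if l = 0 then 0 else if b then (if l = K then 0 else 2) else if l = K then 2 * K else 2 * l + 2)"
proof (induction l)
  case 0
  then show ?case by (simp add: arc_0)
next
  case (Suc l)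
  let ?B = "A \<union> arc K p l \<times> {c}"
  define i where "i = (p + l) mod K"
  have lK: "l < K" and iK: "i < K" using Suc h K by (auto simp: i_def)
  have new: "(i, c) \<notin> ?B" using A arc_new[OF lK, of p] by (simp add: i_def)
  have sd: "(i, d) \<in> ?B" if b using side[OF that arc_memI[of l h p K]] Suc.prems by (simp add: i_def)
  have prev: "(pred_mod K i, c) \<in> ?B" if "l \<noteq> 0"
  proof -
    have "i = Suc ((p + (l - 1)) mod K) mod K" using that by (simp add: i_def mod_Suc_eq)
    then have "pred_mod K i = (p + (l - 1)) mod K" using K by (simp add: pred_Suc_mod)
    then show ?thesis using that arc_memI[of "l - 1" l p K] by simp
  qed
  have last: "(Suc i mod K, c) \<in> ?B" if "Suc l = K"
  proof -
    have "Suc i mod K = (p + K) mod K" using that by (simp add: i_def mod_Suc_eq flip: that)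
    then show ?thesis using K that by (auto simp: arc_def intro!: exI[of _ 0])
  qed
  let ?k = "(if l = 0 then 0 else if Suc l = K then 2 else 1) + of_bool b :: nat"
  have "?k \<le> nb (\<lambda>v. v \<in> ?B) i c True"
  proof -
    have "of_bool ((Suc i mod K, c) \<in> ?B) + of_bool ((pred_mod K i, c) \<in> ?B) + of_bool b \<le> nb (\<lambda>v. v \<in> ?B) i c True"
      using d sd by (rule nbrs_ge)
    moreover have "(if l = 0 then 0 else 1 :: nat) \<le> of_bool ((pred_mod K i, c) \<in> ?B)"
      using prev by (cases "l = 0") simp_all
    moreover have "(if Suc l = K then 1 else 0 :: nat) \<le> of_bool ((Suc i mod K, c) \<in> ?B)"
      using last by (cases "Suc l = K") simp_all
    ultimately show ?thesis using K by (simp only: split: if_splits) linarith+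
  qed
  from per_insert[OF iK c new this] have "per (insert (i, c) ?B) + 2 * ?k \<le> per ?B + 4" .
  moreover have "insert (i, c) ?B = A \<union> arc K p (Suc l) \<times> {c}" by (auto simp: arc_Suc i_def)
  ultimately show ?case using Suc K lK by (cases b) (simp_all split: if_splits)
qed

lemma grow_bar: "l \<le> m \<Longrightarrow> m \<le> h \<Longrightarrow> grow (A \<union> arc K p l \<times> {c}) (A \<union> arc K p m \<times> {c})"
proof (induction m rule: dec_induct)
  case (step m)
  have m: "m < K" using step h by simp
  have "grow1 (A \<union> arc K p m \<times> {c}) (A \<union> arc K p (Suc m) \<times> {c})"
    unfolding grow1_def
  proof (intro bexI conjI)
    show "A \<union> arc K p (Suc m) \<times> {c} = insert ((p + m) mod K, c) (A \<union> arc K p m \<times> {c})"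
      by (auto simp: arc_Suc)
    show "((p + m) mod K, c) \<in> vertices K L - (A \<union> arc K p m \<times> {c})"
      using A arc_new[OF m, of p] c K by simp
    show "per (A \<union> arc K p (Suc m) \<times> {c}) \<le> 2 * K + 2"
      using per_bar[of "Suc m"] step per m by (simp split: if_splits)
  qed
  with step show ?case by (simp add: rtranclp.rtrancl_into_rtrancl)
qed simp

end

lemmas bar_beside = per_bar[where b = True, unfolded if_True True_implies_equals]
  grow_bar[where b = True, unfolded if_True True_implies_equals]

lemma grow_single_arc:
  assumes "c < L" "l \<le> K"
  shows "per (arc K p l \<times> {c}) \<le> (if l = 0 then 0 else if l = K then 2 * K else 2 * l + 2)"
    "grow {} (arc K p l \<times> {c})"
proof -
  have A: "\<And>i. (i, c) \<notin> {}" "\<And>i. False \<Longrightarrow> i \<in> arc K p l \<Longrightarrow> (i, Suc c mod L) \<in> {}"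
    "per {} \<le> (if False then 2 * K else 0)"
    using per_empty by simp_all
  show "per (arc K p l \<times> {c}) \<le> (if l = 0 then 0 else if l = K then 2 * K else 2 * l + 2)"
    using per_bar[where p = p, OF assms(1) disjI1[OF refl] A(1,2) assms(2) A(3) order_refl] per_empty
    unfolding if_False Un_empty_left by linarith
  show "grow {} (arc K p l \<times> {c})"
    using grow_bar[where p = p, OF assms(1) disjI1[OF refl] A(1,2) assms(2) A(3) le0 order_refl]
    unfolding Un_empty_left by (simp add: arc_0)
qed

text \<open>
  A strip is widened column by column; its perimeter returns to at most \<open>2 K\<close> whenever a column is
  completed.
\<close>

lemma add_column:
  assumes C: "per (columns C) \<le> 2 * K" and c: "c < L" "c \<notin> C" and d: "d = Suc c mod L \<or> d = pred_mod L c" "d \<in> C"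
  shows "per (columns (insert c C)) \<le> 2 * K" "grow (columns C) (columns (insert c C))"
    "h \<le> K \<Longrightarrow> grow (columns C) (columns C \<union> arc K p h \<times> {c})"
    "h \<le> K \<Longrightarrow> per (columns C \<union> arc K p h \<times> {c}) \<le> 2 * K + 2"
    "h \<le> K \<Longrightarrow> grow (columns C \<union> arc K p h \<times> {c}) (columns (insert c C))"
proof -
  have notin: "(i, c) \<notin> columns C" for i using c(2) by (simp add: columns_def)
  have side: "(i, d) \<in> columns C" if "i \<in> arc K p K" for i p
    using that d(2) arc_full[of K p] K by (simp add: columns_def)
  have bar1: "per (columns C \<union> arc K p l \<times> {c}) \<le> per (columns C) + (if l = 0 then 0 else if l = K then 0 else 2)"
    and bar2: "grow (columns C \<union> arc K p l \<times> {c}) (columns C \<union> arc K p m \<times> {c})" if "l \<le> m" "m \<le> K" for l m p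
  proof -
    have sd: "\<And>i. i \<in> arc K p K \<Longrightarrow> (i, d) \<in> columns C" using side .
    show "per (columns C \<union> arc K p l \<times> {c}) \<le> per (columns C) + (if l = 0 then 0 else if l = K then 0 else 2)"
      using bar_beside(1)[where p = p and l = l, OF c(1) d(1) notin sd order_refl C] that by linarith
    show "grow (columns C \<union> arc K p l \<times> {c}) (columns C \<union> arc K p m \<times> {c})"
      using bar_beside(2)[where p = p, OF c(1) d(1) notin sd order_refl C that] .
  qed
  have full: "columns C \<union> arc K p K \<times> {c} = columns (insert c C)" for p
    using arc_full[of K p] K by (auto simp: columns_def)
  show "per (columns (insert c C)) \<le> 2 * K" using bar1[of K K 0] C unfolding full by (simp split: if_splits)
  show "grow (columns C) (columns (insert c C))" using bar2[of 0 K 0] unfolding full by (simp add: arc_0)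
  assume h: "h \<le> K"
  show "grow (columns C) (columns C \<union> arc K p h \<times> {c})" using bar2[of 0 h p] h by (simp add: arc_0)
  show "per (columns C \<union> arc K p h \<times> {c}) \<le> 2 * K + 2" using bar1[OF order_refl h, of p] C by (simp split: if_splits)
  show "grow (columns C \<union> arc K p h \<times> {c}) (columns (insert c C))"
    using bar2[of h K p] h unfolding full by simp
qed

lemma grow_columns_all:
  assumes "C \<subseteq> {..<L}" "C \<noteq> {}" "per (columns C) \<le> 2 * K"
  shows "grow (columns C) (vertices K L)"
  using assms
proof (induction "card ({..<L} - C)" arbitrary: C)
  case 0
  then have "C = {..<L}" by auto
  then have "columns C = vertices K L" by (auto simp: columns_def vertices_def)
  then show ?case by simp
next
  case (Suc n)
  then obtain b where b: "b < L" "b \<notin> C" by (metis Diff_iff card.empty equals0I lessThan_iff nat.distinct(1))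
  obtain a where a: "a < L" "a \<in> C" using Suc by auto
  obtain x where x: "x < L" "x \<in> C" "Suc x mod L \<notin> C"
    using cyclic_exit[of a L "\<lambda>x. x \<in> C" b] a b by blast
  let ?c = "Suc x mod L"
  have c: "?c < L" "pred_mod L ?c = x" using x by (simp_all add: pred_Suc_mod)
  have add: "per (columns (insert ?c C)) \<le> 2 * K" "grow (columns C) (columns (insert ?c C))"
    using add_column(1,2)[of C ?c x] Suc.prems(3) c x by simp_all
  have "n = card ({..<L} - insert ?c C)"
  proof -
    have "{..<L} - insert ?c C = ({..<L} - C) - {?c}" by auto
    moreover have "?c \<in> {..<L} - C" using c x by simp
    ultimately show ?thesis using Suc.hyps(2) by simp
  qed
  then have "grow (columns (insert ?c C)) (vertices K L)"
    using Suc.hyps(1)[of "insert ?c C"] Suc.prems(1) c add(1) by auto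
  with add(2) show ?case by (rule rtranclp_trans)
qed

lemma grow_strip:
  assumes "p < L" "1 \<le> m" "m \<le> L"
  shows "per (columns (arc L p m)) \<le> 2 * K \<and> grow {} (columns (arc L p m))"
  using assms(2,3)
proof (induction m rule: dec_induct)
  case base
  have "columns (arc L p 1) = arc K 0 K \<times> {p}"
    using arc_full[of K 0] K assms(1) by (simp add: arc_1 columns_def del: One_nat_def)
  then show ?case
    using grow_single_arc[OF assms(1), of K 0] K by simp
next
  case (step m)
  let ?c = "(p + m) mod L" and ?d = "(p + (m - 1)) mod L"
  have "?d \<in> arc L p m" using step by (intro arc_memI) simp
  moreover have "?d = pred_mod L ?c"
  proof -
    have "?c = Suc ?d mod L" using step by (simp add: mod_Suc_eq)
    then show ?thesis using L by (simp add: pred_Suc_mod)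
  qed
  moreover have "?c \<notin> arc L p m" "?c < L" using arc_new[of m L p] step L by simp_all
  ultimately have add: "per (columns (insert ?c (arc L p m))) \<le> 2 * K"
      "grow (columns (arc L p m)) (columns (insert ?c (arc L p m)))"
    using add_column(1,2)[of "arc L p m" ?c ?d] step by simp_all
  have "grow {} (columns (arc L p m))" using step by simp
  from rtranclp_trans[OF this add(2)] add(1) show ?case by (simp add: arc_Suc)
qed

lemma bar_column:
  assumes "m < L" "c = p + m \<or> c = p + L - 1"
  shows "c mod L \<notin> arc L p m"
  using assms(2)
proof
  assume "c = p + m"
  then show ?thesis using arc_mem_iff[of m L m p] assms(1) by simp
next
  assume "c = p + L - 1"
  then have "c = p + (L - 1)" using L by simp
  then show ?thesis using arc_mem_iff[of m L "L - 1" p] assms(1) by simp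
qed

text \<open>Completing the column of the bar leads to a wider strip, and strips grow until they cover the torus.\<close>

lemma grow_strip_bar:
  fixes p m h c k :: nat
  assumes "p < L" "1 \<le> m" "m < L" "h \<le> K" "c = p + m \<or> c = p + L - 1"
  defines "A \<equiv> columns (arc L p m) \<union> arc K k h \<times> {c mod L}"
  shows "grow {} A" "grow A (vertices K L)" "per A \<le> 2 * K + 2"
proof -
  have cL: "c mod L < L" using L by simp
  have notin: "c mod L \<notin> arc L p m" using bar_column[OF assms(3,5)] .
  obtain d where d: "d = Suc (c mod L) mod L \<or> d = pred_mod L (c mod L)" "d \<in> arc L p m"
    using assms(5)
  proof
    assume c: "c = p + m"
    have "c mod L = Suc ((p + (m - 1)) mod L) mod L" using c assms(2) by (simp add: mod_Suc_eq)
    then have "pred_mod L (c mod L) = (p + (m - 1)) mod L" using L by (simp add: pred_Suc_mod)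
    moreover have "(p + (m - 1)) mod L \<in> arc L p m" using assms(2) by (intro arc_memI) simp
    ultimately show ?thesis using that by metis
  next
    assume c: "c = p + L - 1"
    then have "c mod L = pred_mod L p" by (simp add: pred_mod_def)
    then have "Suc (c mod L) mod L = p" using assms(1) by (simp add: Suc_pred_mod)
    moreover have "p \<in> arc L p m" using assms(1,2) by (auto simp: arc_def intro!: exI[of _ 0])
    ultimately show ?thesis using that by metis
  qed
  have strip: "per (columns (arc L p m)) \<le> 2 * K" "grow {} (columns (arc L p m))"
    using grow_strip[of p m] assms by auto
  note add = add_column[OF strip(1) cL notin d]
  show "grow {} A" unfolding A_def using rtranclp_trans[OF strip(2) add(3)[OF assms(4)]] .
  show "per A \<le> 2 * K + 2" unfolding A_def using add(4)[OF assms(4)] .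
  have "grow (columns (insert (c mod L) (arc L p m))) (vertices K L)"
    using add(1) cL arc_subset[of L p m] L by (intro grow_columns_all) auto
  then show "grow A (vertices K L)" unfolding A_def using rtranclp_trans[OF add(5)[OF assms(4)]] by blast
qed

lemma grow_arc_bar:
  fixes i j k l h c :: nat
  assumes j: "j < L" and kh: "k + h \<le> l" "l \<le> K - 1" and c: "c = j + 1 \<or> c = j + L - 1"
  defines "A \<equiv> arc K i l \<times> {j} \<union> arc K (i + k) h \<times> {c mod L}"
  shows "grow {} A" "per A \<le> 2 * l + 4"
proof -
  have cL: "c mod L < L" using L by simp
  have cj: "c mod L \<noteq> j" "j = Suc (c mod L) mod L \<or> j = pred_mod L (c mod L)"
  proof -
    have "c mod L = Suc j mod L \<or> c mod L = pred_mod L j" using c by (auto simp: pred_mod_def)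
    then show "c mod L \<noteq> j" "j = Suc (c mod L) mod L \<or> j = pred_mod L (c mod L)"
      using j L cyclic_neighbours_distinct[of L j] by (auto simp: pred_Suc_mod Suc_pred_mod)
  qed
  have per: "per (arc K i l \<times> {j}) \<le> 2 * K" "per (arc K i l \<times> {j}) \<le> 2 * l + 2"
  proof -
    have "l < K" using kh K by linarith
    then show "per (arc K i l \<times> {j}) \<le> 2 * K" "per (arc K i l \<times> {j}) \<le> 2 * l + 2"
      using grow_single_arc(1)[OF j, of l i] by (simp_all split: if_splits)
  qed
  have notin: "(x, c mod L) \<notin> arc K i l \<times> {j}" for x using cj by simp
  have side: "\<And>x. x \<in> arc K (i + k) h \<Longrightarrow> (x, j) \<in> arc K i l \<times> {j}"
    using arc_shift[OF kh(1), of K i] by auto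
  have h: "h \<le> K" using kh by simp
  note bar = bar_beside(1)[where p = "i + k", OF cL cj(2) notin side h per(1) order_refl, folded A_def]
    bar_beside(2)[where p = "i + k", OF cL cj(2) notin side h per(1) le0 order_refl, folded A_def]
  show "per A \<le> 2 * l + 4" using bar(1) per(2) by (simp split: if_splits)
  have "grow {} (arc K i l \<times> {j})" using kh by (intro grow_single_arc(2)[OF j]) simp
  moreover have "grow (arc K i l \<times> {j}) A" using bar(2) by (simp add: arc_0)
  ultimately show "grow {} A" by (rule rtranclp_trans)
qed

lemma complete_column:
  fixes i j k h c :: nat
  assumes ij: "i < K" "j < L" and kh: "k + h \<le> K - 1" and c: "c = j + 1 \<or> c = j + L - 1"
  defines "A \<equiv> arc K i (K - 1) \<times> {j} \<union> arc K (i + k) h \<times> {c mod L}"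
    and "B \<equiv> columns (arc L j 1) \<union> arc K (i + k) h \<times> {c mod L}"
  shows "grow1 A B"
  unfolding grow1_def
proof (intro bexI conjI)
  have "per B \<le> 2 * K + 2" unfolding B_def using ij(2) c L kh by (intro grow_strip_bar(3)) auto
  then show "per B \<le> 2 * K + 2" .
  let ?g = "pred_mod K i"
  have g: "?g < K" "Suc ?g mod K = i" using ij(1) pred_mod_less[of K i] by (simp_all add: Suc_pred_mod)
  have rows: "arc K i (K - 1) = {..<K} - {?g}" using arc_all_but_one[OF g(1)] g(2) by simp
  have cj: "c mod L \<noteq> j"
  proof -
    have "c mod L = Suc j mod L \<or> c mod L = pred_mod L j" using c by (auto simp: pred_mod_def)
    then show ?thesis using ij(2) L cyclic_neighbours_distinct[of L j] by auto
  qed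
  have "columns (arc L j 1) = insert (?g, j) (arc K i (K - 1) \<times> {j})"
    unfolding rows arc_1 using g(1) ij(2) by (auto simp: columns_def)
  then show "B = insert (?g, j) A" unfolding A_def B_def by simp
  have "(?g, j) \<notin> A" unfolding A_def rows using cj by auto
  then show "(?g, j) \<in> vertices K L - A" using g(1) ij(2) by simp
qed

end

section \<open>Optimal paths\<close>

lemma path_height_rev: "path_height K L (rev \<omega>) = path_height K L \<omega>"
  by (simp add: path_height_def)

lemma comm_height_commute: "comm_height q K L \<sigma> \<sigma>' = comm_height q K L \<sigma>' \<sigma>"
proof -
  have "path_height K L ` paths q K L \<sigma> \<sigma>' \<subseteq> path_height K L ` paths q K L \<sigma>' \<sigma>" for \<sigma> \<sigma>'
    using path_rev path_height_rev by (metis image_subsetI rev_image_eqI)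
  then have "path_height K L ` paths q K L \<sigma> \<sigma>' = path_height K L ` paths q K L \<sigma>' \<sigma>" by blast
  then show ?thesis by (simp add: comm_height_def)
qed

lemma optimal_paths_rev: "\<omega> \<in> optimal_paths q K L \<sigma> \<sigma>' \<Longrightarrow> rev \<omega> \<in> optimal_paths q K L \<sigma>' \<sigma>"
  using comm_height_commute[of q K L \<sigma> \<sigma>'] by (simp add: optimal_paths_def path_rev path_height_rev)

lemma restricted_paths_rev:
  assumes "\<omega> \<in> restricted_paths q K L \<sigma> \<sigma>'"
  shows "rev \<omega> \<in> restricted_paths q K L \<sigma>' \<sigma>"
proof -
  have "valley q K L \<sigma> \<sigma>' \<eta> = valley q K L \<sigma>' \<sigma> \<eta>" for \<eta>
    using comm_height_commute[of q K L \<sigma> \<sigma>'] by (simp add: valley_def)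
  then show ?thesis
    using assms optimal_paths_rev by (auto simp: restricted_paths_def)
qed

lemma minimal_saddles_commute: "minimal_saddles q K L \<sigma> \<sigma>' = minimal_saddles q K L \<sigma>' \<sigma>"
proof -
  have "minimal_saddles q K L \<sigma> \<sigma>' \<subseteq> minimal_saddles q K L \<sigma>' \<sigma>" for \<sigma> \<sigma>'
  proof
    fix \<xi> assume "\<xi> \<in> minimal_saddles q K L \<sigma> \<sigma>'"
    then obtain \<omega> where "\<xi> \<in> configs q K L" "\<omega> \<in> optimal_paths q K L \<sigma> \<sigma>'" "\<xi> \<in> set \<omega>"
      "hamiltonian K L \<xi> = Max (hamiltonian K L ` set \<omega>)"
      by (auto simp: minimal_saddles_def)
    then show "\<xi> \<in> minimal_saddles q K L \<sigma>' \<sigma>"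
      unfolding minimal_saddles_def using optimal_paths_rev[of \<omega>]
      by (intro CollectI conjI bexI[of _ "rev \<omega>"]) auto
  qed
  then show ?thesis by blast
qed

lemma minimal_restricted_gate_commute:
  assumes "minimal_restricted_gate q K L \<sigma>' \<sigma> W"
  shows "minimal_restricted_gate q K L \<sigma> \<sigma>' W"
  unfolding minimal_restricted_gate_def restricted_gate_def
proof (intro conjI ballI allI impI)
  have W: "restricted_gate q K L \<sigma>' \<sigma> W" using assms by (simp add: minimal_restricted_gate_def)
  then show "W \<subseteq> minimal_saddles q K L \<sigma> \<sigma>'"
    using minimal_saddles_commute by (auto simp: restricted_gate_def)
  show "set \<omega> \<inter> W \<noteq> {}" if "\<omega> \<in> restricted_paths q K L \<sigma> \<sigma>'" for \<omega>
    using W restricted_paths_rev[OF that] unfolding restricted_gate_def by (metis set_rev)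
  show "\<exists>\<omega>\<in>optimal_paths q K L \<sigma> \<sigma>'. set \<omega> \<inter> W' = {}" if "W' \<subset> W" for W'
    using assms that optimal_paths_rev unfolding minimal_restricted_gate_def by (metis set_rev)
qed

context transition
begin

abbreviation "spot X \<equiv> droplet K L r s X"

lemma dis_droplet: "dis (spot X) = per X"
  using rs by (intro disagree_cong) (auto simp: droplet_def)

lemma cells_droplet: "X \<subseteq> vertices K L \<Longrightarrow> cells K L (spot X) s = X"
  using rs by (auto simp: cells_def droplet_def)

lemma droplet_configs: "spot X \<in> configs q K L"
  using r s by (auto simp: configs_def droplet_def)

lemma droplet_empty: "spot {} = const_config K L r"
  by (simp add: droplet_def const_config_def)

lemma droplet_all: "spot (vertices K L) = const_config K L s"
  by (auto simp: droplet_def const_config_def)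

lemma droplet_inj: "X \<subseteq> vertices K L \<Longrightarrow> Y \<subseteq> vertices K L \<Longrightarrow> spot X = spot Y \<Longrightarrow> X = Y"
  using cells_droplet by metis

lemma flip_insert:
  assumes "v \<in> vertices K L - X"
  shows "flip q K L (spot X) (spot (insert v X))"
proof -
  obtain i j where v: "v = (i, j)" "i < K" "j < L" "(i, j) \<notin> X" using assms by (cases v) auto
  then have "spot (insert v X) = (spot X)((i, j) := s)" by (auto simp: droplet_def)
  moreover have "s \<noteq> spot X (i, j)" using v rs by (simp add: droplet_def)
  ultimately show ?thesis using v s droplet_configs unfolding flip_def by blast
qed

lemma path_of_grow:
  assumes "grow A B" "per A \<le> 2 * K + 2"
  obtains \<omega> where "\<omega> \<in> paths q K L (spot A) (spot B)"
    "\<And>\<xi>. \<xi> \<in> set \<omega> \<Longrightarrow> \<exists>X. A \<subseteq> X \<and> X \<subseteq> B \<and> \<xi> = spot X \<and> per X \<le> 2 * K + 2"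
proof -
  from assms have "\<exists>\<omega>\<in>paths q K L (spot A) (spot B).
    \<forall>\<xi>\<in>set \<omega>. \<exists>X. A \<subseteq> X \<and> X \<subseteq> B \<and> \<xi> = spot X \<and> per X \<le> 2 * K + 2"
  proof (induction rule: converse_rtranclp_induct)
    case base
    then show ?case
      by (intro bexI[of _ "[spot B]"]) (auto simp: paths_def droplet_configs)
  next
    case (step A Y)
    then obtain v where v: "v \<in> vertices K L - A" "Y = insert v A" "per Y \<le> 2 * K + 2"
      by (auto simp: grow1_def)
    obtain \<omega> where \<omega>: "\<omega> \<in> paths q K L (spot Y) (spot B)"
      "\<forall>\<xi>\<in>set \<omega>. \<exists>X. Y \<subseteq> X \<and> X \<subseteq> B \<and> \<xi> = spot X \<and> per X \<le> 2 * K + 2"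
      using step.IH[OF v(3)] by blast
    have "spot A # \<omega> \<in> paths q K L (spot A) (spot B)"
      using path_Cons[OF flip_insert[OF v(1)]] \<omega>(1) v(2) by simp
    moreover have "\<exists>X. A \<subseteq> X \<and> X \<subseteq> B \<and> \<xi> = spot X \<and> per X \<le> 2 * K + 2" if "\<xi> \<in> set (spot A # \<omega>)" for \<xi>
    proof (cases "\<xi> = spot A")
      case True
      moreover have "A \<subseteq> B" using grow_subset[OF step.hyps(2)] v(2) by blast
      ultimately show ?thesis using step.prems by blast
    next
      case False
      with that \<omega>(2) obtain X where "Y \<subseteq> X" "X \<subseteq> B" "\<xi> = spot X" "per X \<le> 2 * K + 2" by auto
      then show ?thesis using v(2) by blast
    qed
    ultimately show ?case by blast
  qed
  then show ?thesis using that by blast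
qed

lemma hamiltonian_le_iff:
  "hamiltonian K L \<sigma> \<le> int m - 2 * int (K * L) \<longleftrightarrow> dis \<sigma> \<le> m"
  using hamiltonian_disagree[of K L \<sigma>] K by simp

text \<open>
  The upper bound comes from a strip that is widened column by column, the lower one from the fact
  that no path between the two configurations stays below this level.
\<close>

lemma comm_height_eq:
  "comm_height q K L (const_config K L r) (const_config K L s) = int (2 * K + 2) - 2 * int (K * L)"
    (is "?h = ?\<Gamma>")
proof (rule antisym)
  have "0 < L" using L by simp
  have "grow {} (columns (arc L 0 L))" using grow_strip[of 0 L] L by simp
  moreover have "columns (arc L 0 L) = vertices K L"
    using arc_full[OF \<open>0 < L\<close>] by (auto simp: columns_def vertices_def)
  ultimately obtain \<omega> where \<omega>: "\<omega> \<in> crossings"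
    "\<And>\<xi>. \<xi> \<in> set \<omega> \<Longrightarrow> dis \<xi> \<le> 2 * K + 2"
    using path_of_grow[of "{}" "vertices K L"] per_empty dis_droplet droplet_empty droplet_all
    by (metis le0)
  show "?h \<le> ?\<Gamma>"
    using comm_height_le[OF \<omega>(1)] \<omega>(2) path_height_le_iff[OF \<omega>(1), of ?\<Gamma>] hamiltonian_le_iff
    by (meson order_trans)
  have "crossings \<noteq> {}" using \<omega>(1) by blast
  then have "?h \<in> path_height K L ` crossings"
    unfolding comm_height_def by (intro Min_in finite_path_heights) simp
  then obtain \<omega>' where \<omega>': "\<omega>' \<in> crossings"
    "?h = path_height K L \<omega>'" by blast
  show "?\<Gamma> \<le> ?h"
  proof (rule ccontr)
    assume "\<not> ?thesis"
    then have "path_height K L \<omega>' \<le> int (2 * K + 1) - 2 * int (K * L)" using \<omega>'(2) by simp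
    then have "dis \<xi> \<le> 2 * K + 1" if "\<xi> \<in> set \<omega>'" for \<xi>
      using that path_height_le_iff[OF \<omega>'(1)] hamiltonian_le_iff by blast
    then show False using no_low_path[OF \<omega>'(1) rs] by blast
  qed
qed

lemma optimal_iff:
  "\<omega> \<in> optimal_paths q K L (const_config K L r) (const_config K L s) \<longleftrightarrow>
   \<omega> \<in> crossings \<and> (\<forall>\<xi>\<in>set \<omega>. dis \<xi> \<le> 2 * K + 2)"
  (is "?L \<longleftrightarrow> ?P \<and> ?D")
proof -
  have "path_height K L \<omega> = comm_height q K L (const_config K L r) (const_config K L s) \<longleftrightarrow> ?D" if ?P
  proof -
    have "path_height K L \<omega> \<le> comm_height q K L (const_config K L r) (const_config K L s) \<longleftrightarrow> ?D"
      unfolding comm_height_eq path_height_le_iff[OF that] hamiltonian_le_iff ..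
    with comm_height_le[OF that] show ?thesis by linarith
  qed
  then show ?thesis by (auto simp: optimal_paths_def)
qed

lemma restricted_allowed:
  assumes "\<omega> \<in> restricted_paths q K L (const_config K L r) (const_config K L s)" "\<xi> \<in> set \<omega>"
  shows "allowed \<xi>"
proof -
  have opt: "\<omega> \<in> optimal_paths q K L (const_config K L r) (const_config K L s)"
    using assms(1) by (simp add: restricted_paths_def)
  then have \<xi>: "\<xi> \<in> configs q K L" "dis \<xi> \<le> 2 * K + 2"
    using assms(2) by (auto simp: optimal_iff paths_def)
  have "\<not> low q t \<xi>" if t: "t \<in> {1..q} - {r, s}" for t
  proof
    assume low: "low q t \<xi>"
    then have "(\<lambda>x y. flip q K L x y \<and> dis y \<le> 2 * K + 1)\<^sup>*\<^sup>* \<xi> (const_config K L t)" "dis \<xi> \<le> 2 * K + 1"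
      by (simp_all add: low_def)
    then obtain \<omega>' where \<omega>': "\<omega>' \<in> paths q K L \<xi> (const_config K L t)"
      "\<And>\<eta>. \<eta> \<in> set \<omega>' \<Longrightarrow> dis \<eta> \<le> 2 * K + 1"
      using path_of_flips[of q K L "\<lambda>y. dis y \<le> 2 * K + 1" \<xi>] \<xi>(1) by blast
    have "comm_height q K L (const_config K L t) \<xi> \<le> path_height K L \<omega>'"
      using comm_height_le[OF path_rev[OF \<omega>'(1)]] by (simp add: path_height_rev)
    also have "\<dots> \<le> int (2 * K + 1) - 2 * int (K * L)"
      unfolding path_height_le_iff[OF \<omega>'(1)] hamiltonian_le_iff using \<omega>'(2) by blast
    also have "\<dots> < comm_height q K L (const_config K L r) (const_config K L s)"
      by (simp add: comm_height_eq)
    finally have "\<xi> \<in> valley q K L (const_config K L r) (const_config K L s) (const_config K L t)"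
      using \<xi>(1) by (simp add: valley_def)
    moreover have "const_config K L t \<in> stable_configs q K L - {const_config K L r, const_config K L s}"
    proof -
      have "const_config K L t \<noteq> const_config K L u" if "t \<noteq> u" for u
        using has_const[of t t] has_const[of u t] that by metis
      then show ?thesis using t stable_configs_eq[of q K L] K L r by auto
    qed
    ultimately show False using assms by (auto simp: restricted_paths_def)
  qed
  with \<xi> show ?thesis by (simp add: allowed_def)
qed

section \<open>Minimality\<close>

abbreviation "minimal_gate \<equiv> minimal_restricted_gate q K L (const_config K L r) (const_config K L s)"

text \<open>
  A path that meets the gate in \<open>\<xi>\<close> only avoids all proper subsets without \<open>\<xi>\<close>. As \<open>\<xi>\<close> has the
  maximal energy on this path, it is a minimal saddle as well.
\<close>

lemma minimal_gateI:
  assumes gate: "\<And>\<omega>. \<omega> \<in> crossings \<Longrightarrow>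
      (\<And>\<xi>. \<xi> \<in> set \<omega> \<Longrightarrow> allowed \<xi>) \<Longrightarrow> set \<omega> \<inter> W \<noteq> {}"
    and avoid: "\<And>\<xi>. \<xi> \<in> W \<Longrightarrow> \<exists>\<omega>\<in>crossings.
      (\<forall>\<eta>\<in>set \<omega>. dis \<eta> \<le> 2 * K + 2) \<and> \<xi> \<in> set \<omega> \<and> set \<omega> \<inter> W \<subseteq> {\<xi>}"
    and level: "\<And>\<xi>. \<xi> \<in> W \<Longrightarrow> 2 * K + 2 \<le> dis \<xi>"
  shows "minimal_gate W"
  unfolding minimal_restricted_gate_def restricted_gate_def
proof (intro conjI ballI allI impI)
  show "W \<subseteq> minimal_saddles q K L (const_config K L r) (const_config K L s)"
  proof
    fix \<xi> assume "\<xi> \<in> W"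
    then obtain \<omega> where \<omega>: "\<omega> \<in> crossings"
      "\<forall>\<eta>\<in>set \<omega>. dis \<eta> \<le> 2 * K + 2" "\<xi> \<in> set \<omega>" using avoid by blast
    have opt: "\<omega> \<in> optimal_paths q K L (const_config K L r) (const_config K L s)"
      using \<omega> by (simp add: optimal_iff)
    have "dis \<xi> = 2 * K + 2" using level[OF \<open>\<xi> \<in> W\<close>] \<omega>(2,3) by force
    then have "hamiltonian K L \<xi> = comm_height q K L (const_config K L r) (const_config K L s)"
      using hamiltonian_disagree[of K L \<xi>] K by (simp add: comm_height_eq)
    also have "\<dots> = Max (hamiltonian K L ` set \<omega>)"
      using opt by (simp add: optimal_paths_def path_height_def)
    finally show "\<xi> \<in> minimal_saddles q K L (const_config K L r) (const_config K L s)"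
      unfolding minimal_saddles_def using opt \<omega>(1,3) by (auto simp: paths_def)
  qed
  show "set \<omega> \<inter> W \<noteq> {}" if "\<omega> \<in> restricted_paths q K L (const_config K L r) (const_config K L s)" for \<omega>
    using gate[of \<omega>] restricted_allowed[OF that] that by (auto simp: restricted_paths_def optimal_paths_def)
  fix W' assume "W' \<subset> W"
  then obtain \<xi> where \<xi>: "\<xi> \<in> W" "\<xi> \<notin> W'" by blast
  obtain \<omega> where \<omega>: "\<omega> \<in> crossings"
    "\<forall>\<eta>\<in>set \<omega>. dis \<eta> \<le> 2 * K + 2" "set \<omega> \<inter> W \<subseteq> {\<xi>}" using avoid[OF \<xi>(1)] by blast
  have "set \<omega> \<inter> W' = {}" using \<omega>(3) \<xi>(2) \<open>W' \<subset> W\<close> by blast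
  then show "\<exists>\<omega>\<in>optimal_paths q K L (const_config K L r) (const_config K L s). set \<omega> \<inter> W' = {}"
    using \<omega> optimal_iff by blast
qed

lemma path_through:
  assumes "grow {} A" "grow A (vertices K L)"
  obtains \<omega> where "\<omega> \<in> crossings" "spot A \<in> set \<omega>"
    "\<And>\<eta>. \<eta> \<in> set \<omega> \<Longrightarrow> dis \<eta> \<le> 2 * K + 2"
    "\<And>\<eta>. \<eta> \<in> set \<omega> \<Longrightarrow> \<exists>X\<subseteq>vertices K L. \<eta> = spot X \<and> (X \<subseteq> A \<or> A \<subseteq> X)"
proof -
  have AV: "A \<subseteq> vertices K L" by (rule grow_subset[OF assms(2)])
  have "per A \<le> 2 * K + 2"
    using assms(1) per_empty by (cases rule: rtranclp.cases) (auto simp: grow1_def)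
  from path_of_grow[OF assms(2) this] obtain \<omega>2 where \<omega>2: "\<omega>2 \<in> paths q K L (spot A) (const_config K L s)"
    "\<And>\<xi>. \<xi> \<in> set \<omega>2 \<Longrightarrow> \<exists>X. A \<subseteq> X \<and> X \<subseteq> vertices K L \<and> \<xi> = spot X \<and> per X \<le> 2 * K + 2"
    unfolding droplet_all by blast
  have "per {} \<le> 2 * K + 2" using per_empty by simp
  from path_of_grow[OF assms(1) this] obtain \<omega>1 where \<omega>1: "\<omega>1 \<in> paths q K L (const_config K L r) (spot A)"
    "\<And>\<xi>. \<xi> \<in> set \<omega>1 \<Longrightarrow> \<exists>X. {} \<subseteq> X \<and> X \<subseteq> A \<and> \<xi> = spot X \<and> per X \<le> 2 * K + 2"
    unfolding droplet_empty by blast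
  let ?\<omega> = "butlast \<omega>1 @ \<omega>2"
  have split: "\<eta> \<in> set \<omega>1 \<or> \<eta> \<in> set \<omega>2" if "\<eta> \<in> set ?\<omega>" for \<eta>
    using that by (auto dest: in_set_butlastD)
  show ?thesis
  proof (rule that)
    show "?\<omega> \<in> crossings"
      using path_append[OF \<omega>1(1) \<omega>2(1)] .
    have "hd \<omega>2 = spot A" "\<omega>2 \<noteq> []" using \<omega>2(1) by (auto simp: paths_def)
    then show "spot A \<in> set ?\<omega>" using hd_in_set[of \<omega>2] by simp
    show "dis \<eta> \<le> 2 * K + 2" if "\<eta> \<in> set ?\<omega>" for \<eta>
      using split[OF that] \<omega>1(2) \<omega>2(2) dis_droplet by metis
    show "\<exists>X\<subseteq>vertices K L. \<eta> = spot X \<and> (X \<subseteq> A \<or> A \<subseteq> X)" if "\<eta> \<in> set ?\<omega>" for \<eta>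
      using split[OF that] \<omega>1(2)[of \<eta>] \<omega>2(2)[of \<eta>] AV by blast
  qed
qed

text \<open>
  If all droplets of the gate have the same area, a path along which \<open>s\<close> only grows meets just one
  of them.
\<close>

lemma minimal_gate_by_area:
  assumes gate: "\<And>\<omega>. \<omega> \<in> crossings \<Longrightarrow>
      (\<And>\<xi>. \<xi> \<in> set \<omega> \<Longrightarrow> allowed \<xi>) \<Longrightarrow> set \<omega> \<inter> W \<noteq> {}"
    and W: "\<And>\<xi>. \<xi> \<in> W \<Longrightarrow> \<exists>A. \<xi> = spot A \<and> card A = a \<and> grow {} A \<and> grow A (vertices K L) \<and> 2 * K + 2 \<le> per A"
  shows "minimal_gate W"
proof (rule minimal_gateI[OF gate])
  fix \<xi> assume "\<xi> \<in> W"
  then obtain A where A: "\<xi> = spot A" "card A = a" "grow {} A" "grow A (vertices K L)" "2 * K + 2 \<le> per A"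
    using W by blast
  show "2 * K + 2 \<le> dis \<xi>" using A by (simp add: dis_droplet)
  have AV: "A \<subseteq> vertices K L" by (rule grow_subset[OF A(4)])
  obtain \<omega> where \<omega>: "\<omega> \<in> crossings" "spot A \<in> set \<omega>"
    "\<And>\<eta>. \<eta> \<in> set \<omega> \<Longrightarrow> dis \<eta> \<le> 2 * K + 2"
    "\<And>\<eta>. \<eta> \<in> set \<omega> \<Longrightarrow> \<exists>X\<subseteq>vertices K L. \<eta> = spot X \<and> (X \<subseteq> A \<or> A \<subseteq> X)"
    using path_through[OF A(3,4)] by blast
  have "\<eta> = \<xi>" if \<eta>: "\<eta> \<in> set \<omega>" "\<eta> \<in> W" for \<eta>
  proof -
    obtain X where X: "X \<subseteq> vertices K L" "\<eta> = spot X" "X \<subseteq> A \<or> A \<subseteq> X" using \<omega>(4)[OF \<eta>(1)] by blast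
    obtain B where B: "\<eta> = spot B" "card B = a" "grow B (vertices K L)" using W[OF \<eta>(2)] by blast
    have "X = B" using droplet_inj[OF X(1) grow_subset[OF B(3)]] X(2) B(1) by simp
    have fin: "finite A" "finite X" using AV X(1) finite_vertices finite_subset by metis+
    have "X = A"
      using X(3)
    proof
      assume "X \<subseteq> A"
      then show ?thesis using card_subset_eq[OF fin(1)] B(2) A(2) \<open>X = B\<close> by simp
    next
      assume "A \<subseteq> X"
      then show ?thesis using card_subset_eq[OF fin(2)] B(2) A(2) \<open>X = B\<close> by metis
    qed
    with X A show ?thesis by simp
  qed
  then show "\<exists>\<omega>\<in>crossings.
      (\<forall>\<eta>\<in>set \<omega>. dis \<eta> \<le> 2 * K + 2) \<and> \<xi> \<in> set \<omega> \<and> set \<omega> \<inter> W \<subseteq> {\<xi>}"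
    using \<omega> A(1) by blast
qed

end

context torus
begin

lemma strip_bar_perimeter:
  assumes p: "p < L" and m: "1 \<le> m" "m + 1 < L" and h: "1 \<le> h" "h < K" and c: "c = p + m \<or> c = p + L - 1"
  shows "2 * K + 2 \<le> per (columns (arc L p m) \<union> arc K k h \<times> {c mod L})"
proof -
  let ?A = "columns (arc L p m) \<union> arc K k h \<times> {c mod L}"
  have notin: "c mod L \<notin> arc L p m" using bar_column[OF _ c] m by simp
  have pin: "p \<in> arc L p m" using arc_memI[of 0 m p L] m p by simp
  obtain e where e: "e < L" "e \<notin> insert (c mod L) (arc L p m)"
  proof (rule obtain_outside)
    show "card (insert (c mod L) (arc L p m)) < L"
      using notin m by (simp add: finite_arc card_arc)
  qed (simp_all add: finite_arc)
  have "2 * card {..<K} + 2 * card {c mod L} \<le> per ?A"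
  proof (rule disagree_ge)
    fix i assume "i \<in> {..<K}"
    then have "(i, p) \<in> ?A" "(i, e) \<notin> ?A" using pin e by (auto simp: columns_def)
    then have "((i, p) \<in> ?A) \<noteq> ((i, e) \<in> ?A)" by simp
    then show "\<exists>j<L. \<exists>l<L. ((i, j) \<in> ?A) \<noteq> ((i, l) \<in> ?A)" using p e(1) by blast
  next
    fix j assume "j \<in> {c mod L}"
    then have j: "j = c mod L" by simp
    have "(k + 0) mod K \<in> arc K k h" "(k + h) mod K \<notin> arc K k h"
      using h arc_memI[of 0 h k K] arc_new[of h K k] by simp_all
    then have "((k + 0) mod K, j) \<in> ?A" "((k + h) mod K, j) \<notin> ?A"
      using notin by (auto simp: j columns_def)
    then have "(((k + 0) mod K, j) \<in> ?A) \<noteq> (((k + h) mod K, j) \<in> ?A)" by simp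
    moreover have "(k + 0) mod K < K" "(k + h) mod K < K" using K by simp_all
    ultimately show "\<exists>x<K. \<exists>y<K. ((x, j) \<in> ?A) \<noteq> ((y, j) \<in> ?A)" by blast
  qed (use L in auto)
  then show ?thesis by simp
qed

text \<open>
  For \<open>h \<le> K - 2\<close> these are the droplets without a column of \<open>s\<close> in the gates \<open>Hbar\<close>, for \<open>h = K - 1\<close>
  the rectangles in \<open>Qbar\<close>.
\<close>

definition arc_bar :: "nat \<Rightarrow> nat \<Rightarrow> nat \<Rightarrow> nat \<Rightarrow> nat \<Rightarrow> (nat \<times> nat) set" where
  "arc_bar i j k h c = arc K i (K - 1) \<times> {j} \<union> arc K (i + k) h \<times> {c mod L}"

lemma beside:
  assumes "j < L" "c = j + 1 \<or> c = j + L - 1"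
  shows "c mod L < L" "c mod L \<noteq> j"
proof -
  have "c mod L = Suc j mod L \<or> c mod L = pred_mod L j" using assms(2) by (auto simp: pred_mod_def)
  then show "c mod L \<noteq> j" using assms(1) L cyclic_neighbours_distinct[of L j] by auto
qed (use L in simp)

lemma arc_bar_properties:
  assumes ij: "i < K" "j < L" and kh: "1 \<le> h" "k + h \<le> K - 1" and c: "c = j + 1 \<or> c = j + L - 1"
  shows "card (arc_bar i j k h c) = K - 1 + h" "grow {} (arc_bar i j k h c)"
    "grow (arc_bar i j k h c) (vertices K L)" "2 * K + 2 \<le> per (arc_bar i j k h c)"
proof -
  let ?A = "arc_bar i j k h c"
  note cj = beside[OF ij(2) c]
  have "card ?A = card (arc K i (K - 1) \<times> {j}) + card (arc K (i + k) h \<times> {c mod L})"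
    unfolding arc_bar_def using cj by (intro card_Un_disjoint) (auto simp: finite_arc)
  then show "card ?A = K - 1 + h" using kh by (simp add: card_cartesian_product card_arc)
  show "grow {} ?A" unfolding arc_bar_def by (rule grow_arc_bar(1)[OF ij(2) kh(2) order_refl c])
  have "grow1 ?A (columns (arc L j 1) \<union> arc K (i + k) h \<times> {c mod L})"
    unfolding arc_bar_def by (rule complete_column[OF ij kh(2) c])
  moreover have "grow (columns (arc L j 1) \<union> arc K (i + k) h \<times> {c mod L}) (vertices K L)"
    using ij(2) c L kh by (intro grow_strip_bar(2)) auto
  ultimately show "grow ?A (vertices K L)" by (rule converse_rtranclp_into_rtranclp)
  let ?g = "pred_mod K i"
  have g: "?g < K" "Suc ?g mod K = i" using ij(1) pred_mod_less[of K i] by (simp_all add: Suc_pred_mod)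
  have rows: "arc K i (K - 1) = {..<K} - {?g}" using arc_all_but_one[OF g(1)] g(2) by simp
  have sub: "arc K (i + k) h \<subseteq> arc K i (K - 1)" by (rule arc_shift[OF kh(2)])
  obtain e where e: "e < L" "e \<notin> {j, c mod L}"
    using obtain_third[of L j "c mod L"] L by auto
  have "2 * card (arc K i (K - 1)) + 2 * card {j, c mod L} \<le> per ?A"
  proof (rule disagree_ge)
    fix x assume "x \<in> arc K i (K - 1)"
    then have "(x, j) \<in> ?A" "(x, e) \<notin> ?A" using e by (auto simp: arc_bar_def)
    then have "((x, j) \<in> ?A) \<noteq> ((x, e) \<in> ?A)" by simp
    then show "\<exists>j<L. \<exists>l<L. ((x, j) \<in> ?A) \<noteq> ((x, l) \<in> ?A)" using ij(2) e(1) by blast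
  next
    fix b assume b: "b \<in> {j, c mod L}"
    have "(i + k + 0) mod K \<in> arc K (i + k) h" using kh by (intro arc_memI) simp
    then have x: "((i + k + 0) mod K, b) \<in> ?A" using b sub by (auto simp: arc_bar_def)
    have "?g \<notin> arc K i (K - 1)" unfolding rows by simp
    then have y: "(?g, b) \<notin> ?A" using b sub by (auto simp: arc_bar_def)
    have "(i + k + 0) mod K < K" using K by simp
    with x y g(1) show "\<exists>x<K. \<exists>y<K. ((x, b) \<in> ?A) \<noteq> ((y, b) \<in> ?A)" by blast
  qed (use cj ij(2) arc_subset[of K i "K - 1"] K in auto)
  then show "2 * K + 2 \<le> per ?A" using cj(2) K by (simp add: card_arc)
qed

end

context transition
begin

lemma strip_bar_droplet:
  assumes \<xi>: "\<xi> \<in> Bbar K L h m K r s" and m: "1 \<le> m" "m + 1 < L" and h: "1 \<le> h" "h < K"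
  obtains A where "\<xi> = spot A" "card A = m * K + h" "grow {} A" "grow A (vertices K L)" "2 * K + 2 \<le> per A"
    "\<exists>j<L. {..<K} \<times> {j} \<subseteq> A"
proof -
  obtain i j k c where ijk: "\<xi> = spot (block K L i j m K \<union> block K L (i + k) c 1 h)" "i < K" "j < L"
    "c = j + m \<or> c = j + L - 1"
    using \<xi> by (auto simp: Bbar_def)
  define A where "A = columns (arc L j m) \<union> arc K (i + k) h \<times> {c mod L}"
  have "\<xi> = spot A"
    using ijk(1) K by (simp add: A_def block_arc arc_1 arc_full columns_def del: One_nat_def)
  moreover have "card A = m * K + h"
    unfolding A_def using ijk(3) m h bar_column[OF _ ijk(4)] by (intro card_strip_bar) auto
  moreover have "grow {} A" "grow A (vertices K L)"
    unfolding A_def using ijk(3,4) m h by (intro grow_strip_bar; simp)+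
  moreover have "2 * K + 2 \<le> per A"
    unfolding A_def by (rule strip_bar_perimeter[OF ijk(3) m h ijk(4)])
  moreover have "{..<K} \<times> {j} \<subseteq> A"
    using arc_memI[of 0 m j L] m ijk(3) by (auto simp: A_def columns_def)
  ultimately show ?thesis using that ijk(3) by blast
qed

lemma arc_bar_droplet:
  assumes "\<xi> \<in> Bbar K L h 1 (K - 1) r s"
  obtains i j k c where "\<xi> = spot (arc_bar i j k h c)" "i < K" "j < L" "k + h \<le> K - 1" "c = j + 1 \<or> c = j + L - 1"
proof -
  obtain i j k c where ijk: "\<xi> = spot (block K L i j 1 (K - 1) \<union> block K L (i + k) c 1 h)" "i < K" "j < L"
    "k + h \<le> K - 1" "c = j + 1 \<or> c = j + L - 1"
    using assms by (auto simp: Bbar_def)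
  have "block K L i j 1 (K - 1) \<union> block K L (i + k) c 1 h = arc_bar i j k h c"
    using ijk(3) by (simp add: block_arc arc_1 arc_bar_def del: One_nat_def)
  with ijk that show ?thesis by simp
qed

lemma rectangle_droplet:
  assumes "\<xi> \<in> Rbar K L 2 (K - 1) r s"
  obtains i j where "\<xi> = spot (arc_bar i j 0 (K - 1) (j + 1))" "i < K" "j < L"
proof -
  obtain i j where ij: "\<xi> = spot (block K L i j 2 (K - 1))" "i < K" "j < L"
    using assms by (auto simp: Rbar_def)
  have "arc L j 2 = {j, (j + 1) mod L}"
    using ij(3) by (auto simp: arc_image numeral_2_eq_2 lessThan_Suc)
  then have "block K L i j 2 (K - 1) = arc_bar i j 0 (K - 1) (j + 1)"
    by (auto simp: block_arc arc_bar_def)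
  with ij that show ?thesis by simp
qed

lemma minimal_gate_strip_bar:
  assumes "1 \<le> j" "j \<le> L - 3" "1 \<le> h" "h < K" "2 * K - 1 \<le> j * K + h"
  shows "minimal_gate (Bbar K L h j K r s)"
proof (rule minimal_gate_by_area[where a = "j * K + h"])
  fix \<omega> assume "\<omega> \<in> crossings" "\<And>\<xi>. \<xi> \<in> set \<omega> \<Longrightarrow> allowed \<xi>"
  then show "set \<omega> \<inter> Bbar K L h j K r s \<noteq> {}" using assms by (intro gate_strip_bar)
next
  fix \<xi> assume "\<xi> \<in> Bbar K L h j K r s"
  moreover have "j + 1 < L" using assms(2) L by simp
  ultimately show "\<exists>A. \<xi> = spot A \<and> card A = j * K + h \<and> grow {} A \<and> grow A (vertices K L) \<and> 2 * K + 2 \<le> per A"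
    using strip_bar_droplet[of \<xi> h j] assms by metis
qed

lemma minimal_gate_P: "minimal_gate (Pbar K L r s)"
  unfolding Pbar_def using K L by (intro minimal_gate_strip_bar) simp_all

lemma minimal_gate_Q: "minimal_gate (Qbar K L r s)"
proof (rule minimal_gate_by_area[OF gate_Q, where a = "K - 1 + (K - 1)"])
  fix \<xi> assume "\<xi> \<in> Qbar K L r s"
  then consider "\<xi> \<in> Rbar K L 2 (K - 1) r s" | "\<xi> \<in> Bbar K L (K - 2) 1 K r s" by (auto simp: Qbar_def)
  then show "\<exists>A. \<xi> = spot A \<and> card A = K - 1 + (K - 1) \<and> grow {} A \<and> grow A (vertices K L) \<and> 2 * K + 2 \<le> per A"
  proof cases
    case 1
    obtain i j where ij: "\<xi> = spot (arc_bar i j 0 (K - 1) (j + 1))" "i < K" "j < L"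
      using rectangle_droplet[OF 1] .
    have "1 \<le> K - 1" "0 + (K - 1) \<le> K - 1" using K by simp_all
    from arc_bar_properties[OF ij(2,3) this, of "j + 1"] ij(1) show ?thesis by blast
  next
    case 2
    have *: "1 + 1 < L" "1 \<le> K - 2" "K - 2 < K" using K L by simp_all
    have "1 * K + (K - 2) = K - 1 + (K - 1)" using K by simp
    with strip_bar_droplet[OF 2 order_refl *] show ?thesis by metis
  qed
qed

text \<open>
  Since \<open>Hbar\<close> contains droplets of different areas, they have to be told from the other droplets on a
  growing path by their columns as well.
\<close>

lemma Hbar_droplet:
  assumes i: "1 \<le> i" "i \<le> K - 3" and X: "X \<subseteq> vertices K L" "spot X \<in> Hbar K L i r s"
  shows "K + i \<le> card X" "\<exists>j<L. K - 1 \<le> card {k. (k, j) \<in> X}"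
    "{..<K} \<times> {j} \<subseteq> X \<Longrightarrow> j < L \<Longrightarrow> card X = K + i"
proof -
  have iK: "i < K" "1 + 1 < L" using i K L by simp_all
  consider "spot X \<in> Bbar K L i 1 K r s" | h where "i + 1 \<le> h" "h \<le> K - 2" "spot X \<in> Bbar K L h 1 (K - 1) r s"
    using X(2) by (auto simp: Hbar_def)
  then have "K + i \<le> card X \<and> (\<exists>j<L. K - 1 \<le> card {k. (k, j) \<in> X}) \<and>
    (\<forall>j<L. {..<K} \<times> {j} \<subseteq> X \<longrightarrow> card X = K + i)"
  proof cases
    case 1
    obtain A where A: "spot X = spot A" "card A = 1 * K + i" "grow A (vertices K L)" "\<exists>j<L. {..<K} \<times> {j} \<subseteq> A"
      using strip_bar_droplet[OF 1 order_refl iK(2) i(1) iK(1)] by metis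
    have "X = A" using droplet_inj[OF X(1) grow_subset[OF A(3)] A(1)] .
    obtain j where j: "j < L" "{..<K} \<times> {j} \<subseteq> A" using A(4) by blast
    have "finite {k. (k, j) \<in> X}"
      by (rule finite_subset[of _ "{..<K}"]) (use X(1) in \<open>auto simp: vertices_def\<close>)
    then have "card {..<K} \<le> card {k. (k, j) \<in> X}" using j \<open>X = A\<close> by (intro card_mono) auto
    then have "K - 1 \<le> card {k. (k, j) \<in> X}" by simp
    then show ?thesis using A(2) \<open>X = A\<close> j(1) by auto
  next
    case (2 h)
    obtain a j k c where A: "spot X = spot (arc_bar a j k h c)" "a < K" "j < L" "k + h \<le> K - 1"
      "c = j + 1 \<or> c = j + L - 1" using arc_bar_droplet[OF 2(3)] .
    have h: "1 \<le> h" using 2(1) i by simp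
    note props = arc_bar_properties[OF A(2,3) h A(4,5)]
    have X': "X = arc_bar a j k h c" using droplet_inj[OF X(1) grow_subset[OF props(3)] A(1)] .
    have cols: "{x. (x, l) \<in> X} = (if l = j then arc K a (K - 1) else if l = c mod L then arc K (a + k) h else {})" for l
      unfolding X' arc_bar_def using beside[OF A(3,5)] by auto
    have "card {x. (x, j) \<in> X} = K - 1" by (simp add: cols card_arc)
    moreover have "\<not> {..<K} \<times> {l} \<subseteq> X" for l
    proof
      assume "{..<K} \<times> {l} \<subseteq> X"
      then have "{..<K} \<subseteq> {x. (x, l) \<in> X}" by auto
      moreover have "finite {x. (x, l) \<in> X}" by (simp add: cols finite_arc)
      ultimately have "card {..<K} \<le> card {x. (x, l) \<in> X}" by (intro card_mono)
      then have "K \<le> card {x. (x, l) \<in> X}" by simp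
      also have "\<dots> \<le> K - 1"
      proof -
        have "h \<le> K - 1" using 2(2) by linarith
        then show ?thesis by (simp add: cols card_arc)
      qed
      finally show False using K by simp
    qed
    ultimately show ?thesis using A(3) props(1) X' 2(1) K by auto
  qed
  then show "K + i \<le> card X" "\<exists>j<L. K - 1 \<le> card {k. (k, j) \<in> X}"
    "{..<K} \<times> {j} \<subseteq> X \<Longrightarrow> j < L \<Longrightarrow> card X = K + i" by blast+
qed

text \<open>
  To reach an arc of \<open>K - 1\<close> sites with a bar, the end of the arc that does not face the bar is added
  last. No column of the earlier droplets then has \<open>K - 1\<close> sites.
\<close>

lemma short_columns_first:
  assumes ij: "i < K" "j < L" and kh: "1 \<le> h" "k + h \<le> K - 1" "h \<le> K - 2" and c: "c = j + 1 \<or> c = j + L - 1"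
  obtains A' where "grow {} A'" "grow1 A' (arc_bar i j k h c)" "\<And>l. card {x. (x, l) \<in> A'} \<le> K - 2"
proof -
  note cj = beside[OF ij(2) c]
  have K2: "Suc (K - 2) = K - 1" using K by simp
  have perA: "per (arc_bar i j k h c) \<le> 2 * K + 2"
    using grow_arc_bar(2)[OF ij(2) kh(2) order_refl c, of i] K by (simp add: arc_bar_def)
  note result = that
  have final: ?thesis
    if a: "k' + h \<le> K - 2" "arc K (i' + k') h = arc K (i + k) h" and v: "v < K" "v \<notin> arc K i' (K - 2)"
      "arc K i (K - 1) = insert v (arc K i' (K - 2))" for i' k' v
  proof (rule result)
    let ?A' = "arc K i' (K - 2) \<times> {j} \<union> arc K (i' + k') h \<times> {c mod L}"
    show "grow {} ?A'" using K by (intro grow_arc_bar(1)[OF ij(2) a(1) _ c]) simp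
    show "grow1 ?A' (arc_bar i j k h c)"
      unfolding grow1_def
    proof (intro bexI conjI)
      show "arc_bar i j k h c = insert (v, j) ?A'" unfolding arc_bar_def v(3) a(2) by auto
      show "(v, j) \<in> vertices K L - ?A'" using v cj ij(2) by auto
    qed (rule perA)
    show "card {x. (x, l) \<in> ?A'} \<le> K - 2" for l
    proof -
      have "{x. (x, l) \<in> ?A'} = (if l = j then arc K i' (K - 2) else if l = c mod L then arc K (i' + k') h else {})"
        using cj by auto
      then show ?thesis using kh(3) by (simp add: card_arc)
    qed
  qed
  show ?thesis
  proof (cases "k + h \<le> K - 2")
    case True
    have "(i + (K - 2)) mod K \<notin> arc K i (K - 2)" using K by (intro arc_new) simp
    moreover have "arc K i (K - 1) = insert ((i + (K - 2)) mod K) (arc K i (K - 2))"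
      using arc_Suc[of K i "K - 2"] K2 by simp
    moreover have "(i + (K - 2)) mod K < K" using K by simp
    ultimately show ?thesis using final[OF True refl] by blast
  next
    case False
    then have k: "1 \<le> k" "k - 1 + h \<le> K - 2" using kh by simp_all
    have "arc K i (K - 1) - {i} = arc K (Suc i) (K - 2)"
      using arc_remove_first[of "K - 2" K i] K2 K ij(1) by simp
    moreover have "arc K i (K - 1) = insert i (arc K (Suc i) (K - 2))"
      using arc_Suc_first[of K i "K - 2"] K2 ij(1) by simp
    moreover have "arc K (Suc i + (k - 1)) h = arc K (i + k) h" using k(1) by simp
    ultimately show ?thesis using final[OF k(2), of "Suc i" i] ij(1) by blast
  qed
qed

text \<open>
  Every droplet of the gate has a column with at least \<open>K - 1\<close> sites, and only the smallest ones have a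
  complete column. If \<open>\<xi>\<close> has a complete column, any growing path through it will do. Otherwise the last
  site added before \<open>\<xi>\<close> is an end of its arc, and the first one after \<open>\<xi>\<close> completes the column.
\<close>

lemma minimal_gate_H:
  assumes i: "1 \<le> i" "i \<le> K - 3"
  shows "minimal_gate (Hbar K L i r s)"
proof (rule minimal_gateI)
  fix \<omega> assume "\<omega> \<in> crossings" "\<And>\<xi>. \<xi> \<in> set \<omega> \<Longrightarrow> allowed \<xi>"
  then show "set \<omega> \<inter> Hbar K L i r s \<noteq> {}" using gate_H i by blast
next
  fix \<xi> assume "\<xi> \<in> Hbar K L i r s"
  then consider "\<xi> \<in> Bbar K L i 1 K r s" | h where "i + 1 \<le> h" "h \<le> K - 2" "\<xi> \<in> Bbar K L h 1 (K - 1) r s"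
    by (auto simp: Hbar_def)
  then have "2 * K + 2 \<le> dis \<xi> \<and> (\<exists>\<omega>\<in>crossings.
      (\<forall>\<eta>\<in>set \<omega>. dis \<eta> \<le> 2 * K + 2) \<and> \<xi> \<in> set \<omega> \<and> set \<omega> \<inter> Hbar K L i r s \<subseteq> {\<xi>})"
  proof cases
    case 1
    have iK: "i < K" "1 + 1 < L" using i K L by simp_all
    obtain A where A: "\<xi> = spot A" "card A = 1 * K + i" "grow {} A" "grow A (vertices K L)" "2 * K + 2 \<le> per A"
      "\<exists>j<L. {..<K} \<times> {j} \<subseteq> A"
      using strip_bar_droplet[OF 1 order_refl iK(2) i(1) iK(1)] by metis
    obtain j where j: "j < L" "{..<K} \<times> {j} \<subseteq> A" using A(6) by blast
    obtain \<omega> where \<omega>: "\<omega> \<in> crossings" "spot A \<in> set \<omega>"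
      "\<And>\<eta>. \<eta> \<in> set \<omega> \<Longrightarrow> dis \<eta> \<le> 2 * K + 2"
      "\<And>\<eta>. \<eta> \<in> set \<omega> \<Longrightarrow> \<exists>X\<subseteq>vertices K L. \<eta> = spot X \<and> (X \<subseteq> A \<or> A \<subseteq> X)"
      using path_through[OF A(3,4)] by blast
    have "\<eta> = \<xi>" if \<eta>: "\<eta> \<in> set \<omega>" "\<eta> \<in> Hbar K L i r s" for \<eta>
    proof -
      obtain X where X: "X \<subseteq> vertices K L" "\<eta> = spot X" "X \<subseteq> A \<or> A \<subseteq> X" using \<omega>(4)[OF \<eta>(1)] by blast
      note H = Hbar_droplet[OF i X(1) \<eta>(2)[unfolded X(2)]]
      have fin: "finite A" "finite X"
        using grow_subset[OF A(4)] X(1) finite_vertices finite_subset by metis+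
      have "X = A"
        using X(3)
      proof
        assume "X \<subseteq> A"
        then show ?thesis using card_seteq[OF fin(1)] H(1) A(2) by simp
      next
        assume "A \<subseteq> X"
        then have "card X = K + i" using H(3)[of j] j by blast
        then show ?thesis using card_seteq[OF fin(2) \<open>A \<subseteq> X\<close>] A(2) by simp
      qed
      with X A show ?thesis by simp
    qed
    then show ?thesis using \<omega> A(1,5) dis_droplet by auto
  next
    case (2 h)
    obtain a j k c where A: "\<xi> = spot (arc_bar a j k h c)" "a < K" "j < L" "k + h \<le> K - 1"
      "c = j + 1 \<or> c = j + L - 1" using arc_bar_droplet[OF 2(3)] .
    have h: "1 \<le> h" using 2(1) by simp
    define A where "A = arc_bar a j k h c"
    define B where "B = columns (arc L j 1) \<union> arc K (a + k) h \<times> {c mod L}"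
    note props = arc_bar_properties[OF A(2,3) h A(4,5), folded A_def]
    obtain A' where A': "grow {} A'" "grow1 A' A" "\<And>l. card {x. (x, l) \<in> A'} \<le> K - 2"
      using short_columns_first[OF A(2,3) h A(4) 2(2) A(5)] unfolding A_def by blast
    have AB: "grow1 A B" unfolding A_def arc_bar_def B_def by (rule complete_column[OF A(2,3,4,5)])
    have BV: "grow B (vertices K L)"
      unfolding B_def using A(3,5) L A(4) by (intro grow_strip_bar(2)) auto
    have sub: "A' \<subseteq> A" "A \<subseteq> B" "B \<subseteq> vertices K L"
      using A'(2) AB grow_subset[OF BV] by (auto simp: grow1_def)
    have perB: "per A' \<le> 2 * K + 2" "per A \<le> 2 * K + 2" "per B \<le> 2 * K + 2"
    proof -
      show "per A' \<le> 2 * K + 2"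
        using A'(1) per_empty by (cases rule: rtranclp.cases) (auto simp: grow1_def)
    qed (use A'(2) AB in \<open>auto simp: grow1_def\<close>)
    obtain \<omega>1 where \<omega>1: "\<omega>1 \<in> paths q K L (const_config K L r) (spot A')"
      "\<And>\<eta>. \<eta> \<in> set \<omega>1 \<Longrightarrow> \<exists>X. {} \<subseteq> X \<and> X \<subseteq> A' \<and> \<eta> = spot X \<and> per X \<le> 2 * K + 2"
      using path_of_grow[OF A'(1)] per_empty unfolding droplet_empty by auto
    obtain \<omega>2 where \<omega>2: "\<omega>2 \<in> paths q K L (spot B) (const_config K L s)"
      "\<And>\<eta>. \<eta> \<in> set \<omega>2 \<Longrightarrow> \<exists>X. B \<subseteq> X \<and> X \<subseteq> vertices K L \<and> \<eta> = spot X \<and> per X \<le> 2 * K + 2"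
      using path_of_grow[OF BV perB(3)] unfolding droplet_all by blast
    have "flip q K L (spot A') (spot A)" "flip q K L (spot A) (spot B)"
      using A'(2) AB flip_insert unfolding grow1_def by blast+
    then have \<omega>3: "spot A' # spot A # \<omega>2 \<in> paths q K L (spot A') (const_config K L s)"
      using path_Cons \<omega>2(1) by blast
    let ?\<omega> = "butlast \<omega>1 @ spot A' # spot A # \<omega>2"
    have \<omega>: "?\<omega> \<in> crossings"
      using path_append[OF \<omega>1(1) \<omega>3] .
    have split: "\<exists>X. \<eta> = spot X \<and> X \<subseteq> vertices K L \<and> per X \<le> 2 * K + 2 \<and> (X \<subseteq> A' \<or> X = A \<or> B \<subseteq> X)"
      if \<eta>: "\<eta> \<in> set ?\<omega>" for \<eta>
    proof -
      consider "\<eta> \<in> set \<omega>1" | "\<eta> = spot A'" | "\<eta> = spot A" | "\<eta> \<in> set \<omega>2"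
        using \<eta> by (auto dest: in_set_butlastD)
      then show ?thesis
      proof cases
        case 1
        then show ?thesis using \<omega>1(2)[OF 1] sub by blast
      next
        case 2
        then show ?thesis using sub perB by blast
      next
        case 3
        then show ?thesis using sub perB by blast
      next
        case 4
        then show ?thesis using \<omega>2(2)[OF 4] by blast
      qed
    qed
    have "\<eta> = \<xi>" if \<eta>: "\<eta> \<in> set ?\<omega>" "\<eta> \<in> Hbar K L i r s" for \<eta>
    proof -
      obtain X where X: "X \<subseteq> vertices K L" "\<eta> = spot X" "X \<subseteq> A' \<or> X = A \<or> B \<subseteq> X"
        using split[OF \<eta>(1)] by blast
      note H = Hbar_droplet[OF i X(1) \<eta>(2)[unfolded X(2)]]
      have fin: "finite A'" "finite B" "finite X" "finite A"
        using sub X(1) finite_vertices finite_subset by (metis subset_trans)+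
      have "\<not> X \<subseteq> A'"
      proof
        assume "X \<subseteq> A'"
        obtain l where l: "K - 1 \<le> card {x. (x, l) \<in> X}" using H(2) by blast
        have "finite {x. (x, l) \<in> A'}"
          by (rule finite_subset[of _ "fst ` A'"]) (force simp: fin(1))+
        then have "card {x. (x, l) \<in> X} \<le> card {x. (x, l) \<in> A'}"
          using \<open>X \<subseteq> A'\<close> by (intro card_mono) auto
        then show False using l A'(3)[of l] K by linarith
      qed
      moreover have "\<not> B \<subseteq> X"
      proof
        assume "B \<subseteq> X"
        have "{..<K} \<times> {j} \<subseteq> B" using A(3) by (auto simp: B_def columns_def arc_1 simp del: One_nat_def)
        then have "card X = K + i" using H(3)[of j] \<open>B \<subseteq> X\<close> A(3) by blast
        moreover have "card B \<le> card X" using \<open>B \<subseteq> X\<close> fin(3) by (rule card_mono[rotated])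
        moreover have "card B = Suc (card A)" using AB fin(4) by (auto simp: grow1_def)
        ultimately show False using props(1) 2(1) K by linarith
      qed
      ultimately show ?thesis using X A(1) unfolding A_def by blast
    qed
    moreover have "\<forall>\<eta>\<in>set ?\<omega>. dis \<eta> \<le> 2 * K + 2" using split dis_droplet by metis
    moreover have "\<xi> \<in> set ?\<omega>" using A(1) by (simp add: A_def)
    moreover have "2 * K + 2 \<le> dis \<xi>" using props(4) A(1) by (simp add: A_def dis_droplet)
    ultimately show ?thesis using \<omega> by blast
  qed
  then show "2 * K + 2 \<le> dis \<xi>" "\<exists>\<omega>\<in>crossings.
      (\<forall>\<eta>\<in>set \<omega>. dis \<eta> \<le> 2 * K + 2) \<and> \<xi> \<in> set \<omega> \<and> set \<omega> \<inter> Hbar K L i r s \<subseteq> {\<xi>}" by blast+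
qed

end

theorem theorem3p1:
  fixes q K L r s :: nat
  assumes "2 \<le> q" and "K < L" and "3 \<le> max K L"
    and "3 \<le> K" and "q = 2 \<or> even K"
    and "const_config K L r \<in> stable_configs q K L"
    and "const_config K L s \<in> stable_configs q K L"
    and "const_config K L s \<noteq> const_config K L r"
  defines "min_gate \<equiv> minimal_restricted_gate q K L (const_config K L r) (const_config K L s)"
  shows "(min_gate (Pbar K L r s) \<and> min_gate (Ptilde K L r s)) \<and>
         (min_gate (Qbar K L r s) \<and> min_gate (Qtilde K L r s)) \<and>
         (\<forall>i\<in>{1..K - 3}. min_gate (Hbar K L i r s) \<and> min_gate (Htilde K L i r s)) \<and>
         (\<forall>j\<in>{2..L - 3}. \<forall>h\<in>{1..K - 1}. min_gate (Wgate K L j h r s))"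
proof -
  have colour: "a \<in> {1..q}" if "const_config K L a \<in> stable_configs q K L" for a
  proof -
    have "const_config K L a \<in> configs q K L" using that by (simp add: stable_configs_def)
    from config_value[OF this, of 0 0] show ?thesis using assms(2,4) by (simp add: const_config_def)
  qed
  have "transition K L q r s"
    using assms colour by unfold_locales auto
  interpret rs: transition K L q r s by fact
  interpret sr: transition K L q s r
    by unfold_locales (use rs.r rs.s rs.rs rs.parity in auto)
  note tilde = minimal_restricted_gate_commute[of q K L "const_config K L s" "const_config K L r"]
  have "min_gate (Pbar K L r s)" "min_gate (Ptilde K L r s)"
    using rs.minimal_gate_P tilde[OF sr.minimal_gate_P]
    by (simp_all add: min_gate_def Ptilde_def Pbar_def Btilde_def)
  moreover have "min_gate (Qbar K L r s)" "min_gate (Qtilde K L r s)"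
    using rs.minimal_gate_Q tilde[OF sr.minimal_gate_Q]
    by (simp_all add: min_gate_def Qtilde_def Qbar_def Btilde_def Rtilde_def)
  moreover have "min_gate (Hbar K L i r s) \<and> min_gate (Htilde K L i r s)" if "i \<in> {1..K - 3}" for i
    using rs.minimal_gate_H[of i] tilde[OF sr.minimal_gate_H[of i]] that
    by (simp add: min_gate_def Htilde_def Hbar_def Btilde_def)
  moreover have "min_gate (Wgate K L j h r s)" if "j \<in> {2..L - 3}" "h \<in> {1..K - 1}" for j h
  proof -
    have "2 * K \<le> j * K" using that(1) by simp
    then have "2 * K - 1 \<le> j * K + h" by linarith
    then show ?thesis
      unfolding min_gate_def Wgate_def using that assms(4) by (intro rs.minimal_gate_strip_bar) auto
  qed
  ultimately show ?thesis by blast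
qed

end
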